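(* There is a deterministic algorithm which, starting from an empty graph on $n$ fixed vertices, maintains a maximal independent set over any sequence of edge insertions and deletions in $O(m^{2/3}\sqrt{\log m})$ amortized update time, where $m$ denotes the number of dynamic edges.
   Context: Fully dynamic maximal independent set (MIS) problem: a graph on a fixed set of $n$ vertices undergoes a sequence of edge updates, each being the insertion or the deletion of one edge; after every update the algorithm must hold explicitly a maximal independent set of the current graph (an independent set not contained in any strictly larger independent set). The amortized update time is the total running time over the updates performed so far divided by their number. "The number of dynamic edges" $m$ refers to the number of edges of the dynamically changing graph. *)

theory Defs
  imports Complex_Main "HOL-Library.Landau_Symbols"
begin

section \<open>Graphs on a fixed vertex set, maximal independent sets, edge updates\<close>

text \<open>The vertex set is \<open>{..<n}\<close>; a graph is the set of its edges, each a two-element set.\<close>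

type_synonym edges = "nat set set"

definition independent :: "nat \<Rightarrow> edges \<Rightarrow> nat set \<Rightarrow> bool" where
  "independent n E I \<longleftrightarrow> I \<subseteq> {..<n} \<and> (\<forall>u\<in>I. \<forall>v\<in>I. {u, v} \<notin> E)"

definition maximal_independent :: "nat \<Rightarrow> edges \<Rightarrow> nat set \<Rightarrow> bool" where
  "maximal_independent n E I \<longleftrightarrow>
     independent n E I \<and> \<not> (\<exists>J. independent n E J \<and> I \<subset> J)"

datatype update = Insert nat nat | Delete nat nat

fun admissible :: "nat \<Rightarrow> edges \<Rightarrow> update \<Rightarrow> bool" where
  "admissible n E (Insert u v) \<longleftrightarrow> u < n \<and> v < n \<and> u \<noteq> v \<and> {u, v} \<notin> E"
| "admissible n E (Delete u v) \<longleftrightarrow> {u, v} \<in> E"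

fun apply_update :: "update \<Rightarrow> edges \<Rightarrow> edges" where
  "apply_update (Insert u v) E = insert {u, v} E"
| "apply_update (Delete u v) E = E - {{u, v}}"

fun valid_from :: "nat \<Rightarrow> edges \<Rightarrow> update list \<Rightarrow> bool" where
  "valid_from n E [] \<longleftrightarrow> True"
| "valid_from n E (x # xs) \<longleftrightarrow> admissible n E x \<and> valid_from n (apply_update x E) xs"

abbreviation valid_updates :: "nat \<Rightarrow> update list \<Rightarrow> bool" where
  "valid_updates n xs \<equiv> valid_from n {} xs"

definition graph_after :: "update list \<Rightarrow> edges" where
  "graph_after xs = fold apply_update xs {}"


section \<open>A deterministic word RAM\<close>

text \<open>
  Programs are structured (while programs) over named registers and a random access memory.
  All words have \<open>w\<close> bits and arithmetic is modulo \<open>2 ^ w\<close>; an address is a word, so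
  \<open>2 ^ w\<close> memory cells are reachable.  Subtraction wraps around,
  division by zero gives 0, and a word is read as true iff it is nonzero.
  A program mentions only finitely many registers.
\<close>

datatype binop = Add | Sub | Mul | Div | Mod | Less | Eq

datatype exp = Const nat | Reg string | Mem exp | Op binop exp exp

datatype com =
    Skip
  | Assign string exp
  | Store exp exp  \<comment> \<open>address, value\<close>
  | Seq com com
  | If exp com com
  | While exp com

record state =
  reg :: "string \<Rightarrow> nat"
  mem :: "nat \<Rightarrow> nat"

fun op_val :: "nat \<Rightarrow> binop \<Rightarrow> nat \<Rightarrow> nat \<Rightarrow> nat" where
  "op_val w Add x y = (x + y) mod 2 ^ w"
| "op_val w Sub x y = (x + 2 ^ w - y) mod 2 ^ w"
| "op_val w Mul x y = (x * y) mod 2 ^ w"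
| "op_val w Div x y = x div y"
| "op_val w Mod x y = x mod y"
| "op_val w Less x y = (if x < y then 1 else 0)"
| "op_val w Eq x y = (if x = y then 1 else 0)"

fun val :: "nat \<Rightarrow> exp \<Rightarrow> state \<Rightarrow> nat" where
  "val w (Const k) s = k mod 2 ^ w"
| "val w (Reg x) s = reg s x"
| "val w (Mem a) s = mem s (val w a s)"
| "val w (Op f a b) s = op_val w f (val w a s) (val w b s)"

text \<open>Unit cost per constant, register access, memory access and word operation.\<close>

fun cost :: "exp \<Rightarrow> nat" where
  "cost (Const k) = 1"
| "cost (Reg x) = 1"
| "cost (Mem a) = cost a + 1"
| "cost (Op f a b) = cost a + cost b + 1"

text \<open>
  \<open>exec w c s t s'\<close>: started in \<open>s\<close>, the program \<open>c\<close> terminates in \<open>s'\<close> after time \<open>t\<close>.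
\<close>

inductive exec :: "nat \<Rightarrow> com \<Rightarrow> state \<Rightarrow> nat \<Rightarrow> state \<Rightarrow> bool" for w where
  Skip: "exec w Skip s 1 s"
| Assign: "exec w (Assign x e) s (cost e + 1) (s\<lparr>reg := (reg s)(x := val w e s)\<rparr>)"
| Store: "exec w (Store a e) s (cost a + cost e + 1)
            (s\<lparr>mem := (mem s)(val w a s := val w e s)\<rparr>)"
| Seq: "exec w c1 s t1 s1 \<Longrightarrow> exec w c2 s1 t2 s2 \<Longrightarrow> exec w (Seq c1 c2) s (t1 + t2) s2"
| IfTrue: "val w b s \<noteq> 0 \<Longrightarrow> exec w c1 s t s' \<Longrightarrow> exec w (If b c1 c2) s (cost b + 1 + t) s'"
| IfFalse: "val w b s = 0 \<Longrightarrow> exec w c2 s t s' \<Longrightarrow> exec w (If b c1 c2) s (cost b + 1 + t) s'"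
| WhileFalse: "val w b s = 0 \<Longrightarrow> exec w (While b c) s (cost b + 1) s"
| WhileTrue: "val w b s \<noteq> 0 \<Longrightarrow> exec w c s t1 s1 \<Longrightarrow> exec w (While b c) s1 t2 s2 \<Longrightarrow>
     exec w (While b c) s (cost b + 1 + t1 + t2) s2"

inductive_cases SkipE: "exec w Skip s t s'"
  and AssignE: "exec w (Assign x e) s t s'"
  and StoreE: "exec w (Store a e) s t s'"
  and SeqE: "exec w (Seq c1 c2) s t s'"
  and IfE: "exec w (If b c1 c2) s t s'"
  and WhileE: "exec w (While b c) s t s'"

lemma exec_deterministic:
  "exec w c s t s' \<Longrightarrow> exec w c s u s'' \<Longrightarrow> u = t \<and> s'' = s'"
proof (induction arbitrary: u s'' rule: exec.induct)
  case (Skip s)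
  then show ?case by (rule SkipE) simp
next
  case (Assign x e s)
  then show ?case by (rule AssignE) simp
next
  case (Store a e s)
  then show ?case by (rule StoreE) simp
next
  case (Seq c1 s t1 s1 c2 t2 s2)
  from Seq.prems obtain v1 r v2
    where u: "u = v1 + v2" and 1: "exec w c1 s v1 r" and 2: "exec w c2 r v2 s''"
    by (rule SeqE)
  from Seq.IH(1)[OF 1] have eq: "v1 = t1" "r = s1" by simp_all
  from Seq.IH(2)[OF 2[unfolded eq]] show ?case by (simp only: u eq)
next
  case (IfTrue b s c1 t s' c2)
  from IfTrue.prems obtain v where u: "u = cost b + 1 + v" and 1: "exec w c1 s v s''"
    by (rule IfE) (simp_all add: IfTrue.hyps(1))
  from IfTrue.IH[OF 1] show ?case by (simp only: u)
next
  case (IfFalse b s c2 t s' c1)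
  from IfFalse.prems obtain v where u: "u = cost b + 1 + v" and 1: "exec w c2 s v s''"
    by (rule IfE) (simp_all add: IfFalse.hyps(1))
  from IfFalse.IH[OF 1] show ?case by (simp only: u)
next
  case (WhileFalse b s c)
  from WhileFalse.prems show ?case by (rule WhileE) (simp_all add: WhileFalse.hyps)
next
  case (WhileTrue b s c t1 s1 t2 s2)
  from WhileTrue.prems obtain v1 r v2
    where u: "u = cost b + 1 + v1 + v2" and 1: "exec w c s v1 r"
      and 2: "exec w (While b c) r v2 s''"
    by (rule WhileE) (simp_all add: WhileTrue.hyps(1))
  from WhileTrue.IH(1)[OF 1] have eq: "v1 = t1" "r = s1" by simp_all
  from WhileTrue.IH(2)[OF 2[unfolded eq]] show ?case by (simp only: u eq)
qed


section \<open>Dynamic algorithms\<close>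

text \<open>
  The three programs are fixed: they depend neither on \<open>n\<close> nor on the update sequence.
  Registers and memory persist between updates.
\<close>

record dynamic_algorithm =
  init :: com
  ins :: com
  del :: com

text \<open>Words of \<open>c * \<lceil>log 2 (n + 2)\<rceil>\<close> bits, that is, of \<open>\<Theta>(log n)\<close> bits for fixed \<open>c > 0\<close>.\<close>

definition word_length :: "nat \<Rightarrow> nat \<Rightarrow> nat" where
  "word_length c n = c * nat \<lceil>log 2 (real n + 2)\<rceil>"

text \<open>For \<open>c > 0\<close> the number \<open>n\<close>, and hence every vertex, fits into one word.\<close>

lemma less_two_power_word_length:
  assumes "0 < c"
  shows "n < 2 ^ word_length c n"
proof -
  define k where "k = nat \<lceil>log 2 (real n + 2)\<rceil>"
  have "log 2 (real n + 2) \<le> real k"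
    unfolding k_def by linarith
  then have "real n + 2 \<le> 2 powr real k"
    by (simp add: log_le_iff)
  then have "real (n + 2) \<le> real (2 ^ k)"
    by (simp add: powr_realpow)
  then have "n + 2 \<le> 2 ^ k"
    by (simp only: of_nat_le_iff)
  moreover have "(2::nat) ^ k \<le> 2 ^ word_length c n"
    unfolding word_length_def k_def[symmetric] by (rule power_increasing) (use assms in auto)
  ultimately show ?thesis by linarith
qed

definition start :: "nat \<Rightarrow> state" where
  "start n = \<lparr>reg = (\<lambda>_. 0)(''n'' := n), mem = (\<lambda>_. 0)\<rparr>"

fun handler :: "dynamic_algorithm \<Rightarrow> update \<Rightarrow> com" where
  "handler A (Insert u v) = ins A"
| "handler A (Delete u v) = del A"

definition pass_edge :: "nat \<Rightarrow> nat \<Rightarrow> state \<Rightarrow> state" where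
  "pass_edge u v s = s\<lparr>reg := (reg s)(''u'' := u, ''v'' := v)\<rparr>"

fun pass_input :: "update \<Rightarrow> state \<Rightarrow> state" where
  "pass_input (Insert u v) s = pass_edge u v s"
| "pass_input (Delete u v) s = pass_edge u v s"

text \<open>
  \<open>run w A s xs T s'\<close>: handling the updates \<open>xs\<close> one after the other, from \<open>s\<close>, takes total
  time \<open>T\<close> and ends in \<open>s'\<close>.  No update is seen before the preceding ones have been handled.
\<close>

inductive run :: "nat \<Rightarrow> dynamic_algorithm \<Rightarrow> state \<Rightarrow> update list \<Rightarrow> nat \<Rightarrow> state \<Rightarrow> bool"
  for w A where
  Nil: "run w A s [] 0 s"
| Cons: "exec w (handler A x) (pass_input x s) t s1 \<Longrightarrow> run w A s1 xs T s2 \<Longrightarrow>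
     run w A s (x # xs) (t + T) s2"

inductive_cases run_NilE: "run w A s [] T s'"
  and run_ConsE: "run w A s (x # xs) T s'"

lemma run_deterministic:
  "run w A s xs T s' \<Longrightarrow> run w A s xs T' s'' \<Longrightarrow> T' = T \<and> s'' = s'"
proof (induction arbitrary: T' s'' rule: run.induct)
  case (Nil s)
  then show ?case by (auto elim: run_NilE)
next
  case (Cons x s t s1 xs T s2)
  from Cons.prems show ?case
    by (rule run_ConsE) (use Cons.IH exec_deterministic[OF Cons.hyps(1)] in blast)
qed

text \<open>The output is the characteristic vector stored in the first \<open>n\<close> memory cells.\<close>

definition held_set :: "nat \<Rightarrow> state \<Rightarrow> nat set" where
  "held_set n s = {v. v < n \<and> mem s v \<noteq> 0}"

definition amortized_time :: "nat \<Rightarrow> update list \<Rightarrow> real" where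
  "amortized_time T xs = real T / real (length xs)"

text \<open>
  The number of edges changes with time.  A budget of \<open>g m\<close> per update is therefore charged
  with \<open>m\<close> the number of edges right after that update, and the budget for a sequence is
  the average; if \<open>m\<close> does not exceed some \<open>M\<close> and \<open>g\<close> is monotone, it is at most \<open>g M\<close>.
\<close>

definition amortized_budget :: "(nat \<Rightarrow> real) \<Rightarrow> update list \<Rightarrow> real" where
  "amortized_budget g xs =
     (\<Sum>i<length xs. g (card (graph_after (take (Suc i) xs)))) / real (length xs)"

text \<open>
  Every prefix of a valid update sequence is valid and runs are deterministic, so a requirement
  for all valid finite sequences is a requirement after every single update.  The empty
  sequence covers the state after initialization; the initialization is not part of the
  update time, but may take only linear time.
\<close>

definition maintains_mis :: "dynamic_algorithm \<Rightarrow> (nat \<Rightarrow> real) \<Rightarrow> bool" where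
  "maintains_mis A g \<longleftrightarrow>
     (\<exists>(c::nat) (C::real). 0 < c \<and>
       (\<forall>n. \<exists>t\<^sub>0 s\<^sub>0.
          exec (word_length c n) (init A) (start n) t\<^sub>0 s\<^sub>0 \<and> real t\<^sub>0 \<le> C * (real n + 1) \<and>
          (\<forall>xs. valid_updates n xs \<longrightarrow>
             (\<exists>T s. run (word_length c n) A s\<^sub>0 xs T s \<and>
                maximal_independent n (graph_after xs) (held_set n s) \<and>
                amortized_time T xs \<le> amortized_budget g xs))))"

end

(*
  Fix a threshold D of order m^(2/3).  Call a vertex heavy if its degree is at least D; there are
  at most 2m/D of them, of order sqrt D.  Among the light vertices a maximal independent set S is
  maintained together with the number of neighbours in S of every vertex.  An update removes at
  most two vertices from S, but may let many vertices enter S; each vertex outside S therefore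
  holds a credit of order D, spent on scanning its neighbours when it enters S.  The heavy
  vertices are treated greedily from scratch after every update; testing all pairs costs order D.
  Since the number of edges drifts, D is recomputed after every m/2 + 1 updates, and the cost of
  this, of order m D, is paid for by the phase that ends.
*)
theory Submission
  imports Defs
begin

section \<open>Structured programs on a memory of rows\<close>

text \<open>The threshold balances two costs: with at most 2m/D heavy vertices the pair tests cost
  about (m/D)^2, which matches D when D^3 is about m^2. No step of an update may depend on n, which
  can be far larger than m. Two facts make this possible. Between updates an isolated vertex always
  belongs to S, so the total credit starts at 0 and is of order D per non-isolated vertex at most;
  and a list covering the non-isolated vertices lets a rebuild visit only those. The counters record
  neighbours in S, never chosen heavy vertices, since keeping them up to date would cost the degree
  of a heavy vertex; the pair tests read adjacency from a table of list positions instead. The heavy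
  vertices are taken out of the output before an update touches the adjacency lists, so that the
  output row then marks S alone and the counters can be adjusted from it. Programs are verified over
  natural numbers with side conditions against overflow, and the postcondition receives the running
  time, so the amortised analysis is part of the correctness proof.\<close>

datatype aexp =
    N nat
  | V string
  | Cell aexp aexp
  | Plus aexp aexp
  | Minus aexp aexp
  | Times aexp aexp
  | Half aexp

datatype bexp = Lt aexp aexp | Eql aexp aexp | Neg bexp | Conj bexp bexp

type_synonym regs = "string \<Rightarrow> nat"
type_synonym rows = "nat \<Rightarrow> nat \<Rightarrow> nat"

text \<open>Rows of n cells, one after the other. Row 0 occupies the first n memory cells, which are
  the ones read as output.\<close>

abbreviation addr :: "exp \<Rightarrow> exp \<Rightarrow> exp" where
  "addr r i \<equiv> Op Add (Op Mul r (Reg ''n'')) i"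

fun acomp :: "aexp \<Rightarrow> exp" where
  "acomp (N k) = Const k"
| "acomp (V x) = Reg x"
| "acomp (Cell r i) = Mem (addr (acomp r) (acomp i))"
| "acomp (Plus a b) = Op Add (acomp a) (acomp b)"
| "acomp (Minus a b) = Op Sub (acomp a) (acomp b)"
| "acomp (Times a b) = Op Mul (acomp a) (acomp b)"
| "acomp (Half a) = Op Div (acomp a) (Const 2)"

text \<open>Truth values are the words 0 and 1, so a product is a conjunction and a comparison with
  0 a negation.\<close>

fun bcomp :: "bexp \<Rightarrow> exp" where
  "bcomp (Lt a b) = Op Less (acomp a) (acomp b)"
| "bcomp (Eql a b) = Op Eq (acomp a) (acomp b)"
| "bcomp (Neg b) = Op Eq (bcomp b) (Const 0)"
| "bcomp (Conj a b) = Op Mul (bcomp a) (bcomp b)"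

fun aval :: "aexp \<Rightarrow> regs \<Rightarrow> rows \<Rightarrow> nat" where
  "aval (N k) \<rho> M = k"
| "aval (V x) \<rho> M = \<rho> x"
| "aval (Cell r i) \<rho> M = M (aval r \<rho> M) (aval i \<rho> M)"
| "aval (Plus a b) \<rho> M = aval a \<rho> M + aval b \<rho> M"
| "aval (Minus a b) \<rho> M = aval a \<rho> M - aval b \<rho> M"
| "aval (Times a b) \<rho> M = aval a \<rho> M * aval b \<rho> M"
| "aval (Half a) \<rho> M = aval a \<rho> M div 2"

fun bval :: "bexp \<Rightarrow> regs \<Rightarrow> rows \<Rightarrow> bool" where
  "bval (Lt a b) \<rho> M \<longleftrightarrow> aval a \<rho> M < aval b \<rho> M"
| "bval (Eql a b) \<rho> M \<longleftrightarrow> aval a \<rho> M = aval b \<rho> M"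
| "bval (Neg b) \<rho> M \<longleftrightarrow> \<not> bval b \<rho> M"
| "bval (Conj a b) \<rho> M \<longleftrightarrow> bval a \<rho> M \<and> bval b \<rho> M"

definition assign :: "string \<Rightarrow> aexp \<Rightarrow> com" where
  "assign x e = Assign x (acomp e)"

definition store :: "aexp \<Rightarrow> aexp \<Rightarrow> aexp \<Rightarrow> com" where
  "store r i e = Store (addr (acomp r) (acomp i)) (acomp e)"

definition ite :: "bexp \<Rightarrow> com \<Rightarrow> com \<Rightarrow> com" where
  "ite b = If (bcomp b)"

definition while :: "bexp \<Rightarrow> com \<Rightarrow> com" where
  "while b = While (bcomp b)"

fun seq :: "com list \<Rightarrow> com" where
  "seq [] = Skip"
| "seq (c # cs) = Seq c (seq cs)"

declare seq.simps [simp del]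

lemma address_inject:
  fixes i j n r q :: nat
  assumes "r * n + i = q * n + j" "i < n" "j < n"
  shows "r = q \<and> i = j"
proof -
  have "(r * n + i) div n = r" "(q * n + j) div n = q" using assms(2,3) by auto
  then have "r = q" using assms(1) by metis
  then show ?thesis using assms by auto
qed

text \<open>The exponent 10 leaves room for the largest intermediate value, the cube of the
  threshold, which is at most (n + 2)^6.\<close>

locale ram =
  fixes n w :: nat
  assumes word_size: "(n + 2) ^ 10 \<le> 2 ^ w"
begin

section \<open>Room in a word\<close>

lemma word_bound: "x < (n + 2) ^ 10 \<Longrightarrow> x < 2 ^ w"
  using word_size by linarith

lemma word_cubic: "(n + 2) ^ 3 * 100 < 2 ^ w"
proof (rule word_bound)
  have "(n + 2) ^ 3 * 100 < (n + 2) ^ 3 * 2 ^ 7" by simp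
  also have "\<dots> \<le> (n + 2) ^ 3 * (n + 2) ^ 7"
    by (intro mult_left_mono power_mono) auto
  finally show "(n + 2) ^ 3 * 100 < (n + 2) ^ 10" by (simp flip: power_add)
qed

lemma word_linear: "n + 100 < 2 ^ w"
proof -
  have "n + 2 \<le> (n + 2) ^ 3" by (rule self_le_power) auto
  then show ?thesis using word_cubic by linarith
qed

text \<open>There are 2 n + 6 rows in use: six vertex arrays and, for every vertex, one row of
  neighbours and one row of places.\<close>

lemma word_address:
  assumes "r < 2 * n + 6" "i < n"
  shows "r * n + i < 2 ^ w"
proof -
  have "r * n + i \<le> (2 * n + 6) * n + n" using assms by (intro add_mono mult_right_mono) auto
  also have "\<dots> \<le> 100 * (n + 2) ^ 3" by (simp add: power3_eq_cube algebra_simps)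
  also have "\<dots> < 2 ^ w" using word_cubic by simp
  finally show ?thesis .
qed

text \<open>Side conditions under which word arithmetic agrees with \<open>aval\<close>: no
  overflow, no negative difference, every row and column in range. Constants below 100 fit because n
  + 100 < 2^w.\<close>

fun aok :: "aexp \<Rightarrow> regs \<Rightarrow> rows \<Rightarrow> bool" where
  "aok (N k) \<rho> M \<longleftrightarrow> k < 100"
| "aok (V x) \<rho> M \<longleftrightarrow> True"
| "aok (Cell r i) \<rho> M \<longleftrightarrow>
     aok r \<rho> M \<and> aok i \<rho> M \<and> aval r \<rho> M < 2 * n + 6 \<and> aval i \<rho> M < n"
| "aok (Plus a b) \<rho> M \<longleftrightarrow> aok a \<rho> M \<and> aok b \<rho> M \<and> aval a \<rho> M + aval b \<rho> M < 2 ^ w"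
| "aok (Minus a b) \<rho> M \<longleftrightarrow>
     aok a \<rho> M \<and> aok b \<rho> M \<and> aval b \<rho> M \<le> aval a \<rho> M \<and> aval a \<rho> M < 2 ^ w"
| "aok (Times a b) \<rho> M \<longleftrightarrow> aok a \<rho> M \<and> aok b \<rho> M \<and> aval a \<rho> M * aval b \<rho> M < 2 ^ w"
| "aok (Half a) \<rho> M \<longleftrightarrow> aok a \<rho> M"

fun bok :: "bexp \<Rightarrow> regs \<Rightarrow> rows \<Rightarrow> bool" where
  "bok (Lt a b) \<rho> M \<longleftrightarrow> aok a \<rho> M \<and> aok b \<rho> M"
| "bok (Eql a b) \<rho> M \<longleftrightarrow> aok a \<rho> M \<and> aok b \<rho> M"
| "bok (Neg b) \<rho> M \<longleftrightarrow> bok b \<rho> M"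
| "bok (Conj a b) \<rho> M \<longleftrightarrow> bok a \<rho> M \<and> bok b \<rho> M"

text \<open>Cells \<open>M r i\<close> with \<open>i \<ge> n\<close> have no address of their own and are left unconstrained.\<close>

definition represents :: "regs \<Rightarrow> rows \<Rightarrow> state \<Rightarrow> bool" where
  "represents \<rho> M s \<longleftrightarrow> reg s = \<rho> \<and> \<rho> ''n'' = n \<and> (\<forall>r. \<forall>i<n. mem s (r * n + i) = M r i)"

text \<open>Total correctness; since executions are deterministic, the existence of a good one says
  everything. Q receives the exact running time, so a claim about time plus potential is an ordinary
  postcondition.\<close>

definition wp :: "com \<Rightarrow> (nat \<Rightarrow> regs \<Rightarrow> rows \<Rightarrow> bool) \<Rightarrow> regs \<Rightarrow> rows \<Rightarrow> bool" where
  "wp c Q \<rho> M \<longleftrightarrow> (\<forall>s. represents \<rho> M s \<longrightarrow>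
     (\<exists>t s' \<rho>' M'. exec w c s t s' \<and> represents \<rho>' M' s' \<and> Q t \<rho>' M'))"

lemma val_addr:
  assumes "represents \<rho> M s" "val w r s = r'" "val w i s = i'" "r' < 2 * n + 6" "i' < n"
  shows "val w (addr r i) s = r' * n + i'"
proof -
  have "r' * n + i' < 2 ^ w" using assms by (intro word_address) auto
  then show ?thesis using assms by (simp add: represents_def)
qed

lemma val_acomp: "represents \<rho> M s \<Longrightarrow> aok e \<rho> M \<Longrightarrow> val w (acomp e) s = aval e \<rho> M"
proof (induction e)
  case (N k)
  then show ?case using word_linear by simp
next
  case (Cell r i)
  then have "val w (addr (acomp r) (acomp i)) s = aval r \<rho> M * n + aval i \<rho> M"
    by (intro val_addr) auto
  then show ?case using Cell by (simp add: represents_def)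
next
  case (Minus a b)
  \<comment> \<open>The machine adds 2^w before it subtracts; with the minuend written as subtrahend
    plus d, modular and truncated subtraction both give d.\<close>
  then obtain d where "aval a \<rho> M = aval b \<rho> M + d" by (auto simp: le_iff_add)
  then show ?case using Minus by simp
next
  case (Half a)
  moreover have "2 mod 2 ^ w = (2::nat)" using word_linear by simp
  ultimately show ?case by simp
qed (auto simp: represents_def)

lemma val_bcomp:
  "represents \<rho> M s \<Longrightarrow> bok b \<rho> M \<Longrightarrow> val w (bcomp b) s = (if bval b \<rho> M then 1 else 0)"
proof -
  have "1 mod 2 ^ w = (1::nat)" using word_linear by (intro mod_less) linarith
  then show "represents \<rho> M s \<Longrightarrow> bok b \<rho> M \<Longrightarrow> val w (bcomp b) s = (if bval b \<rho> M then 1 else 0)"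
    by (induction b) (auto simp: val_acomp)
qed

lemma represents_store:
  assumes "represents \<rho> M s" "i < n"
  shows "represents \<rho> (M(r := (M r)(i := x))) (s\<lparr>mem := (mem s)(r * n + i := x)\<rparr>)"
  using assms address_inject[of _ n _ r i] by (fastforce simp: represents_def)

section \<open>Proof rules with running times\<close>

lemma wp_skip: "Q 1 \<rho> M \<Longrightarrow> wp Skip Q \<rho> M"
  unfolding wp_def by (blast intro: exec.Skip)

lemma wp_assign:
  assumes "x \<noteq> ''n''" "aok e \<rho> M" "Q (cost (acomp e) + 1) (\<rho>(x := aval e \<rho> M)) M"
  shows "wp (assign x e) Q \<rho> M"
  unfolding wp_def assign_def
proof (intro allI impI)
  fix s assume s: "represents \<rho> M s"
  show "\<exists>t s' \<rho>' M'. exec w (Assign x (acomp e)) s t s' \<and> represents \<rho>' M' s' \<and> Q t \<rho>' M'"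
    by (intro exI conjI, rule exec.Assign, use s assms val_acomp[OF s assms(2)] in
      \<open>auto simp: represents_def\<close>)
qed

text \<open>The 4 consists of the access to register \<open>n\<close>, the multiplication and the
  addition of the address, and the store itself.\<close>

lemma wp_store:
  assumes "aok r \<rho> M" "aok i \<rho> M" "aok e \<rho> M" "aval r \<rho> M < 2 * n + 6" "aval i \<rho> M < n"
    and "Q (cost (acomp r) + cost (acomp i) + cost (acomp e) + 4) \<rho>
      (M(aval r \<rho> M := (M (aval r \<rho> M))(aval i \<rho> M := aval e \<rho> M)))"
  shows "wp (store r i e) Q \<rho> M"
  unfolding wp_def store_def
proof (intro allI impI)
  fix s assume s: "represents \<rho> M s"
  have a: "val w (addr (acomp r) (acomp i)) s = aval r \<rho> M * n + aval i \<rho> M"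
    using s assms by (intro val_addr val_acomp) (auto simp: val_acomp)
  show "\<exists>t s' \<rho>' M'. exec w (Store (addr (acomp r) (acomp i)) (acomp e)) s t s' \<and>
      represents \<rho>' M' s' \<and> Q t \<rho>' M'"
    apply (intro exI conjI, rule exec.Store)
     apply (subst a, subst val_acomp[OF s assms(3)], rule represents_store[OF s assms(5)])
    using assms(6) by (simp add: eval_nat_numeral ac_simps)
qed

lemma wp_Seq: "wp c (\<lambda>t. wp d (\<lambda>u. Q (t + u))) \<rho> M \<Longrightarrow> wp (Seq c d) Q \<rho> M"
  unfolding wp_def by (meson exec.Seq)

lemma wp_seq_Nil: "Q 1 \<rho> M \<Longrightarrow> wp (seq []) Q \<rho> M"
  by (simp add: wp_skip seq.simps)

lemma wp_seq_Cons: "wp c (\<lambda>t. wp (seq cs) (\<lambda>u. Q (t + u))) \<rho> M \<Longrightarrow> wp (seq (c # cs)) Q \<rho> M"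
  by (simp add: wp_Seq seq.simps)

lemma wp_ite:
  assumes "bok b \<rho> M"
    and "bval b \<rho> M \<Longrightarrow> wp c (\<lambda>t. Q (cost (bcomp b) + 1 + t)) \<rho> M"
    and "\<not> bval b \<rho> M \<Longrightarrow> wp d (\<lambda>t. Q (cost (bcomp b) + 1 + t)) \<rho> M"
  shows "wp (ite b c d) Q \<rho> M"
  unfolding wp_def ite_def
proof (intro allI impI)
  fix s assume s: "represents \<rho> M s"
  note v = val_bcomp[OF s assms(1)]
  show "\<exists>t s' \<rho>' M'. exec w (If (bcomp b) c d) s t s' \<and> represents \<rho>' M' s' \<and> Q t \<rho>' M'"
  proof (cases "bval b \<rho> M")
    case True
    then obtain t s' \<rho>' M' where "exec w c s t s'" "represents \<rho>' M' s'" "Q (cost (bcomp b) + 1 + t) \<rho>' M'"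
      using assms(2) s unfolding wp_def by blast
    moreover have "val w (bcomp b) s \<noteq> 0" using v True by simp
    ultimately show ?thesis by (blast intro: exec.IfTrue)
  next
    case False
    then obtain t s' \<rho>' M' where "exec w d s t s'" "represents \<rho>' M' s'" "Q (cost (bcomp b) + 1 + t) \<rho>' M'"
      using assms(3) s unfolding wp_def by blast
    moreover have "val w (bcomp b) s = 0" using v False by simp
    ultimately show ?thesis by (blast intro: exec.IfFalse)
  qed
qed

lemma wp_mono:
  assumes "wp c P \<rho> M" "\<And>t \<rho>' M'. P t \<rho>' M' \<Longrightarrow> Q t \<rho>' M'"
  shows "wp c Q \<rho> M"
  using assms unfolding wp_def by meson

text \<open>\<open>I k \<tau> \<rho> M\<close>: the invariant after \<open>k\<close> of \<open>l\<close> rounds, which have taken time \<open>\<tau>\<close>.\<close>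

lemma wp_while:
  assumes step: "\<And>k \<tau> \<rho> M. k < l \<Longrightarrow> I k \<tau> \<rho> M \<Longrightarrow>
      bok b \<rho> M \<and> bval b \<rho> M \<and> wp c (\<lambda>t. I (Suc k) (\<tau> + cost (bcomp b) + 1 + t)) \<rho> M"
    and exit: "\<And>\<tau> \<rho> M. I l \<tau> \<rho> M \<Longrightarrow> bok b \<rho> M \<and> \<not> bval b \<rho> M \<and> Q (\<tau> + cost (bcomp b) + 1) \<rho> M"
    and "I 0 0 \<rho> M"
  shows "wp (while b c) Q \<rho> M"
proof -
  \<comment> \<open>Generalised to an arbitrary round k for an induction on the remaining l - k
    rounds; the elapsed time is a parameter because Q speaks of the total.\<close>
  have "\<exists>t s' \<rho>' M'. exec w (while b c) s t s' \<and> represents \<rho>' M' s' \<and> Q (\<tau> + t) \<rho>' M'"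
    if "k \<le> l" "I k \<tau> \<rho> M" "represents \<rho> M s" for k \<tau> \<rho> M s
    using that
  proof (induction "l - k" arbitrary: k \<tau> \<rho> M s)
    case 0
    then have "I l \<tau> \<rho> M" by simp
    from exit[OF this] have "bok b \<rho> M" "\<not> bval b \<rho> M" and Q: "Q (\<tau> + (cost (bcomp b) + 1)) \<rho> M"
      by (simp_all add: add.assoc)
    then have "val w (bcomp b) s = 0" using val_bcomp[OF 0(4)] by simp
    from exec.WhileFalse[OF this] show ?case using Q 0(4) unfolding while_def by blast
  next
    case (Suc d)
    then have "k < l" by simp
    from step[OF this Suc.prems(2)] have b: "bok b \<rho> M" "bval b \<rho> M"
      and c: "wp c (\<lambda>t. I (Suc k) (\<tau> + cost (bcomp b) + 1 + t)) \<rho> M" by auto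
    have v: "val w (bcomp b) s \<noteq> 0" using val_bcomp[OF Suc.prems(3) b(1)] b(2) by simp
    from c Suc.prems(3) obtain t s' \<rho>' M' where e: "exec w c s t s'" and r: "represents \<rho>' M' s'"
      and I: "I (Suc k) (\<tau> + cost (bcomp b) + 1 + t) \<rho>' M'" unfolding wp_def by blast
    from Suc.hyps(1)[OF _ _ I r] Suc.hyps(2) \<open>k < l\<close>
    obtain t' s'' \<rho>'' M'' where e': "exec w (while b c) s' t' s''" and r': "represents \<rho>'' M'' s''"
      and Q: "Q (\<tau> + cost (bcomp b) + 1 + t + t') \<rho>'' M''" by force
    have "exec w (while b c) s (cost (bcomp b) + 1 + t + t') s''"
      using exec.WhileTrue[OF v e] e' unfolding while_def by blast
    moreover have "Q (\<tau> + (cost (bcomp b) + 1 + t + t')) \<rho>'' M''" using Q by (simp add: add.assoc)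
    ultimately show ?case using r' by blast
  qed
  from this[OF _ \<open>I 0 0 \<rho> M\<close>] show ?thesis unfolding wp_def by auto
qed

lemmas wp_intros = wp_seq_Nil wp_seq_Cons wp_skip wp_assign wp_store wp_ite

end

section \<open>Light vertices\<close>

text \<open>Register \<open>D\<close> holds the degree from which on a vertex is heavy, \<open>k\<close> the number of updates left in
  the current phase, \<open>m\<close> the number of edges, and \<open>t\<close> and \<open>h\<close> the lengths of the lists in the
  rows \<open>touched\<close> and \<open>heavy\<close>.  The former lists every vertex that is not isolated; \<open>known\<close> marks
  its elements.\<close>

abbreviation "out \<equiv> Cell (N 0)"
abbreviation "cnt \<equiv> Cell (N 1)"
abbreviation "deg \<equiv> Cell (N 2)"
abbreviation "known \<equiv> Cell (N 3)"
abbreviation "touched \<equiv> Cell (N 4)"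
abbreviation "heavy \<equiv> Cell (N 5)"
abbreviation "adj_row a \<equiv> Plus (N 6) a"
abbreviation "adj a \<equiv> Cell (adj_row a)"
abbreviation "pos_row a \<equiv> Plus (adj_row a) (V ''n'')"
abbreviation "pos a \<equiv> Cell (pos_row a)"

definition incr :: "string \<Rightarrow> com" where
  "incr x = assign x (Plus (V x) (N 1))"

definition nbrs :: "(aexp \<Rightarrow> aexp \<Rightarrow> aexp) \<Rightarrow> com" where
  "nbrs f = seq
    [assign ''i'' (N 0),
     while (Lt (V ''i'') (deg (V ''a'')))
       (seq [store (N 1) (adj (V ''a'') (V ''i'')) (f (cnt (adj (V ''a'') (V ''i''))) (N 1)),
             incr ''i''])]"

definition try_add :: com where
  "try_add = ite
     (Conj (Eql (out (V ''a'')) (N 0))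
       (Conj (Eql (cnt (V ''a'')) (N 0)) (Lt (deg (V ''a'')) (V ''D''))))
     (seq [store (N 0) (V ''a'') (N 1), nbrs Plus]) Skip"

text \<open>Removing \<open>x\<close> can only free its neighbours, so they alone are offered to S
  again.\<close>

definition drop_vertex :: com where
  "drop_vertex = seq
    [store (N 0) (V ''x'') (N 0), assign ''a'' (V ''x''), nbrs Minus,
     assign ''j'' (N 0),
     while (Lt (V ''j'') (deg (V ''x'')))
       (seq [assign ''a'' (adj (V ''x'') (V ''j'')), try_add, incr ''j''])]"

definition fix_vertex :: com where
  "fix_vertex = ite
     (Conj (Neg (Eql (out (V ''x'')) (N 0)))
       (Neg (Conj (Eql (cnt (V ''x'')) (N 0)) (Lt (deg (V ''x'')) (V ''D'')))))
     drop_vertex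
     (seq [assign ''a'' (V ''x''), try_add])"

text \<open>Serves the endpoints of a changed edge and, in a rebuild, all touched vertices. In both
  cases \<open>x\<close> has left the heavy list beforehand, so appending it creates no
  duplicate.\<close>

definition settle :: com where
  "settle = seq
    [fix_vertex,
     ite (Lt (deg (V ''x'')) (V ''D'')) Skip
       (seq [store (N 5) (V ''h'') (V ''x''), incr ''h''])]"

context ram
begin

lemma wp_incr:
  "x \<noteq> ''n'' \<Longrightarrow> \<rho> x + 1 < 2 ^ w \<Longrightarrow> Q 4 (\<rho>(x := \<rho> x + 1)) M \<Longrightarrow> wp (incr x) Q \<rho> M"
  unfolding incr_def by (rule wp_assign) (auto simp: eval_nat_numeral)

section \<open>Invariants of lists, marks and counters\<close>

definition graph :: "(nat \<Rightarrow> nat set) \<Rightarrow> bool" where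
  "graph G \<longleftrightarrow> (\<forall>a. G a \<subseteq> {..<n} \<and> a \<notin> G a) \<and> (\<forall>a b. b \<in> G a \<longleftrightarrow> a \<in> G b)"

text \<open>Row \<open>6 + a\<close> lists the neighbours of \<open>a\<close>; row \<open>6 + a + n\<close> gives their places in that list,
  counted from one, with 0 for non-neighbours.\<close>

definition adjacency :: "(nat \<Rightarrow> nat set) \<Rightarrow> rows \<Rightarrow> bool" where
  "adjacency G M \<longleftrightarrow> (\<forall>a<n. G a \<subseteq> {..<n} \<and> M 2 a = card (G a) \<and>
     bij_betw (M (6 + a)) {..<card (G a)} (G a) \<and>
     (\<forall>b<n. b \<notin> G a \<longrightarrow> M (6 + a + n) b = 0) \<and>
     (\<forall>i<card (G a). M (6 + a + n) (M (6 + a) i) = Suc i))"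

text \<open>The set is a parameter because row 0 changes its role: it marks the light set S during
  repairs, and S with the chosen heavy vertices between updates.\<close>

definition marks :: "nat set \<Rightarrow> rows \<Rightarrow> bool" where
  "marks S M \<longleftrightarrow> S \<subseteq> {..<n} \<and> (\<forall>v<n. M 0 v = 0 \<longleftrightarrow> v \<notin> S)"

text \<open>Counted by the lists that contain b instead of by the list of b: while an edge is being
  changed G is briefly asymmetric, and a change to the list of a then affects the counter of b
  alone.\<close>

definition counts :: "(nat \<Rightarrow> nat set) \<Rightarrow> nat set \<Rightarrow> rows \<Rightarrow> bool" where
  "counts G S M \<longleftrightarrow> (\<forall>b<n. M 1 b = card {a \<in> S. b \<in> G a})"

definition core :: "(nat \<Rightarrow> nat set) \<Rightarrow> nat set \<Rightarrow> rows \<Rightarrow> bool" where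
  "core G S M \<longleftrightarrow> adjacency G M \<and> marks S M \<and> counts G S M"

text \<open>\<open>B\<close> collects the vertices at which the maximality of \<open>S\<close> still has to be repaired.\<close>

definition no_excess :: "(nat \<Rightarrow> nat set) \<Rightarrow> nat set \<Rightarrow> nat \<Rightarrow> nat set \<Rightarrow> bool" where
  "no_excess G S D B \<longleftrightarrow> (\<forall>v\<in>S - B. card (G v) < D \<and> G v \<inter> S = {})"

definition no_lack :: "(nat \<Rightarrow> nat set) \<Rightarrow> nat set \<Rightarrow> nat \<Rightarrow> nat set \<Rightarrow> bool" where
  "no_lack G S D B \<longleftrightarrow> (\<forall>v\<in>{..<n} - S - B. card (G v) < D \<longrightarrow> G v \<inter> S \<noteq> {})"

lemma adjacencyD:
  assumes "adjacency G M" "a < n"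
  shows "G a \<subseteq> {..<n}" "M 2 a = card (G a)" "inj_on (M (6 + a)) {..<card (G a)}"
    "M (6 + a) ` {..<card (G a)} = G a" "card (G a) \<le> n"
    "b < n \<Longrightarrow> b \<notin> G a \<Longrightarrow> M (6 + a + n) b = 0"
    "i < card (G a) \<Longrightarrow> M (6 + a + n) (M (6 + a) i) = Suc i"
    "i < card (G a) \<Longrightarrow> M (6 + a) i < n"
    "i < card (G a) \<Longrightarrow> M (6 + a) i \<in> G a"
proof -
  have G: "G a \<subseteq> {..<n}" "M 2 a = card (G a)" "bij_betw (M (6 + a)) {..<card (G a)} (G a)"
    "b < n \<Longrightarrow> b \<notin> G a \<Longrightarrow> M (6 + a + n) b = 0"
    "i < card (G a) \<Longrightarrow> M (6 + a + n) (M (6 + a) i) = Suc i" for b i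
    using assms unfolding adjacency_def by auto
  then show "G a \<subseteq> {..<n}" "M 2 a = card (G a)" "inj_on (M (6 + a)) {..<card (G a)}"
    "M (6 + a) ` {..<card (G a)} = G a" "b < n \<Longrightarrow> b \<notin> G a \<Longrightarrow> M (6 + a + n) b = 0"
    "i < card (G a) \<Longrightarrow> M (6 + a + n) (M (6 + a) i) = Suc i"
    by (auto simp: bij_betw_def)
  show "card (G a) \<le> n" using card_mono[OF _ G(1)] by simp
  show *: "M (6 + a) i \<in> G a" if "i < card (G a)"
    using bij_betw_apply[OF G(3)] that by simp
  show "M (6 + a) i < n" if "i < card (G a)" using *[OF that] G(1) by auto
qed

text \<open>One statement for entering and for leaving S. The bound n on the counters excludes
  overflow; positive counters at the neighbours exclude a negative difference.\<close>

lemma wp_nbrs: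
  assumes A: "adjacency G M" "a < n" "\<rho> ''a'' = a"
    and F: "f = Plus \<and> F = Suc \<and> (\<forall>b<n. M 1 b \<le> n) \<or>
      f = Minus \<and> F = (\<lambda>x. x - 1) \<and> (\<forall>b\<in>G a. Suc 0 \<le> M 1 b) \<and> (\<forall>b<n. M 1 b \<le> n)"
  shows "wp (nbrs f) (\<lambda>t \<rho>' M'. t \<le> 50 * card (G a) + 20 \<and> \<rho>' = \<rho>(''i'' := card (G a)) \<and>
    M' = M(1 := \<lambda>b. if b \<in> G a then F (M 1 b) else M 1 b)) \<rho> M"
proof -
  note G = adjacencyD[OF A(1,2)]
  define I where "I k \<tau> \<rho>' M' \<longleftrightarrow> \<rho>' = \<rho>(''i'' := k) \<and> \<tau> \<le> 50 * k \<and>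
    M' = M(1 := \<lambda>b. if b \<in> M (6 + a) ` {..<k} then F (M 1 b) else M 1 b)" for k \<tau> :: nat and \<rho>' M'
  show ?thesis
    unfolding nbrs_def
  proof (intro wp_intros, goal_cases)
    case 3
    show ?case
    proof (rule wp_while[where I = I and l = "card (G a)"], goal_cases)
      case (1 k \<tau> \<rho>' M')
      \<comment> \<open>List entries are distinct, so the counter of the k-th neighbour still has
        its original value.\<close>
      have y: "M (6 + a) k \<notin> M (6 + a) ` {..<k}"
        using inj_on_image_mem_iff[OF G(3), of k "{..<k}"] 1(1) by auto
      have b: "M (6 + a) k < n" "M (6 + a) k \<in> G a" "M 1 (M (6 + a) k) \<le> n"
        using G(8,9) 1(1) F by auto
      have c: "Suc (M 1 (M (6 + a) k)) < 2 ^ w" "M 1 (M (6 + a) k) < 2 ^ w" "Suc k < 2 ^ w"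
        using b(3) 1(1) G(5) word_linear by linarith+
      have r: "\<rho>' = \<rho>(''i'' := k)" "\<tau> \<le> 50 * k"
        "M' = M(1 := \<lambda>b. if b \<in> M (6 + a) ` {..<k} then F (M 1 b) else M 1 b)"
        using 1(2) by (auto simp: I_def)
      have f: "f = Plus \<and> F = Suc \<or> f = Minus \<and> F = (\<lambda>x. x - 1) \<and> Suc 0 \<le> M 1 (M (6 + a) k)"
        using F b(2) by auto
      have d: "M 2 a = card (G a)" using G(2) .
      show ?case
        apply (intro conjI wp_intros wp_incr)
        using f b(1) y c 1(1) A(2,3) r(2) d G(5) word_linear
        unfolding I_def r(1,3)
        by (auto simp: lessThan_Suc fun_eq_iff)
    next
      case (2 \<tau> \<rho>' M')
      then show ?case using A(2,3) G(2,4) by (auto simp: I_def intro!: wp_intros)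
    qed (auto simp: I_def)
  qed auto
qed

lemma adjacency_cong:
  assumes "adjacency G M" "\<And>r. r = 2 \<or> 6 \<le> r \<Longrightarrow> M' r = M r"
  shows "adjacency G M'"
  using assms unfolding adjacency_def by simp

lemma core_cong:
  assumes "core G S M" "\<And>r. r \<le> 2 \<or> 6 \<le> r \<Longrightarrow> M' r = M r"
  shows "core G S M'"
proof -
  have "adjacency G M" using assms(1) by (simp add: core_def)
  then have "adjacency G M'" by (rule adjacency_cong) (rule assms(2), auto)
  moreover have "M' 0 = M 0" "M' 1 = M 1" using assms(2) by auto
  ultimately show ?thesis using assms(1) unfolding core_def marks_def counts_def by simp
qed

lemma coreD:
  assumes "core G S M"
  shows "adjacency G M" "S \<subseteq> {..<n}" "finite S" "v < n \<Longrightarrow> (M 0 v = 0) = (v \<notin> S)"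
    "v < n \<Longrightarrow> M 1 v = card {a \<in> S. v \<in> G a}" "\<forall>b<n. M 1 b \<le> n" "card S \<le> n"
proof -
  show *: "adjacency G M" "S \<subseteq> {..<n}" "v < n \<Longrightarrow> (M 0 v = 0) = (v \<notin> S)"
    "v < n \<Longrightarrow> M 1 v = card {a \<in> S. v \<in> G a}"
    using assms unfolding core_def marks_def counts_def by auto
  show "finite S" by (rule finite_subset[OF *(2)]) simp
  have "card {a \<in> S. b \<in> G a} \<le> n" for b
    using card_mono[of "{..<n}" "{a \<in> S. b \<in> G a}"] *(2) by auto
  then show "\<forall>b<n. M 1 b \<le> n" using assms unfolding core_def counts_def by auto
  show "card S \<le> n" using card_mono[of "{..<n}" S] *(2) by auto
qed

lemma graphD:
  assumes "graph G"
  shows "G a \<subseteq> {..<n}" "a \<notin> G a" "b \<in> G a \<Longrightarrow> a \<in> G b" "finite (G a)" "b \<in> G a \<Longrightarrow> b < n"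
    "b \<in> G a \<Longrightarrow> a < n"
proof -
  show "G a \<subseteq> {..<n}" "a \<notin> G a" using assms by (auto simp: graph_def)
  from finite_subset[OF this(1)] show "finite (G a)" by simp
  show sym: "a \<in> G b" if "b \<in> G a" using assms that by (simp add: graph_def)
  show "b < n" if "b \<in> G a" using \<open>G a \<subseteq> {..<n}\<close> that by auto
  show "a < n" if "b \<in> G a" using sym[OF that] assms by (auto simp: graph_def)
qed

text \<open>Symmetry of G turns the number of lists that contain v into the number of neighbours of
  v in S.\<close>

lemma count_zero_iff:
  assumes "graph G" "core G S M" "v < n"
  shows "M 1 v = 0 \<longleftrightarrow> G v \<inter> S = {}"
proof -
  have "{a \<in> S. v \<in> G a} = G v \<inter> S" using graphD(3)[OF assms(1)] by auto
  then show ?thesis using coreD(3,5)[OF assms(2)] assms(3) by simp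
qed

section \<open>Entering and leaving the light set\<close>

lemma core_insert:
  assumes "core G S M" "y < n" "y \<notin> S" "c \<noteq> 0"
  shows "core G (insert y S)
    (M(0 := (M 0)(y := c), 1 := \<lambda>b. if b \<in> G y then Suc (M 1 b) else M 1 b))"
proof -
  note c = coreD[OF assms(1)]
  have "{a \<in> insert y S. b \<in> G a} = (if b \<in> G y then insert y {a \<in> S. b \<in> G a} else {a \<in> S. b \<in> G a})"
    for b by auto
  then show ?thesis
    using assms c unfolding core_def marks_def counts_def
    by (auto intro: adjacency_cong)
qed

lemma core_delete:
  assumes "core G S M" "y < n" "y \<in> S"
  shows "core G (S - {y})
    (M(0 := (M 0)(y := 0), 1 := \<lambda>b. if b \<in> G y then M 1 b - 1 else M 1 b))"
proof -
  note c = coreD[OF assms(1)]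
  have "{a \<in> S - {y}. b \<in> G a} = {a \<in> S. b \<in> G a} - {y}" for b by auto
  then show ?thesis
    using assms c unfolding core_def marks_def counts_def
    by (auto intro: adjacency_cong simp: card_Diff_singleton_if)
qed

lemma no_excess_insert:
  assumes "graph G" "no_excess G S D B" "G y \<inter> S = {}" "card (G y) < D"
  shows "no_excess G (insert y S) D B"
  using assms graphD(2,3)[OF assms(1)] unfolding no_excess_def by blast

lemma no_lack_mono: "no_lack G S D B \<Longrightarrow> B \<subseteq> C \<Longrightarrow> no_lack G S D C"
  unfolding no_lack_def by blast

text \<open>Enlarging S never undoes a repair, which is why the exceptions can be worked off one at
  a time.\<close>

lemma no_lack_insert:
  assumes "no_lack G S D B"
  shows "no_lack G (insert y S) D (B - {y})"
  using assms unfolding no_lack_def by blast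

text \<open>The credit of \<open>50 * D\<close> per vertex outside \<open>S\<close> pays for scanning its fewer than \<open>D\<close> neighbours
  when it enters \<open>S\<close>.\<close>

definition potential :: "nat \<Rightarrow> nat set \<Rightarrow> nat" where
  "potential D S = 50 * D * (n - card S)"

definition keeps :: "string set \<Rightarrow> regs \<Rightarrow> regs \<Rightarrow> bool" where
  "keeps X \<rho> \<rho>' \<longleftrightarrow> (\<forall>x. x \<notin> X \<longrightarrow> \<rho>' x = \<rho> x)"

text \<open>Constant amortised time: the scan takes 50 steps per neighbour, y has fewer than D of
  them, and its entry into S releases 50 * D. The inclusion for \<open>S'\<close> keeps the degrees
  of members bounded, which later limits the cost of dropping one.\<close>

lemma wp_try_add:
  assumes g: "graph G" and c: "core G S M" and y: "\<rho> ''a'' = y" "y < n"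
    and e: "no_excess G S (\<rho> ''D'') B" and l: "no_lack G S (\<rho> ''D'') B'"
  shows "wp try_add (\<lambda>t \<rho>' M'. keeps {''i''} \<rho> \<rho>' \<and> (\<forall>r\<ge>2. M' r = M r) \<and>
    (\<exists>S'. core G S' M' \<and> S' \<subseteq> S \<union> {v. card (G v) < \<rho> ''D''} \<and> no_excess G S' (\<rho> ''D'') B \<and> no_lack G S' (\<rho> ''D'') (B' - {y}) \<and>
      t + potential (\<rho> ''D'') S' \<le> potential (\<rho> ''D'') S + 100)) \<rho> M"
proof -
  note C = coreD[OF c] and A = adjacencyD[OF coreD(1)[OF c] y(2)] and Z = count_zero_iff[OF g c y(2)]
  let ?M = "M(0 := (M 0)(y := 1))"
  have adj: "adjacency G ?M" using C(1) by (rule adjacency_cong) auto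
  show ?thesis
    unfolding try_add_def
  proof (intro wp_intros, goal_cases)
    case 1
    then show ?case using y by simp
  next
    case 7
    then have f: "y \<notin> S" "G y \<inter> S = {}" "card (G y) < \<rho> ''D''"
      using 7 y A(2) C(4)[OF y(2)] Z by auto
    have "potential (\<rho> ''D'') S = potential (\<rho> ''D'') (insert y S) + 50 * \<rho> ''D''"
    proof -
      have "card (insert y S) \<le> n" using card_mono[of "{..<n}" "insert y S"] C(2) y by auto
      then have "n - card S = (n - card (insert y S)) + 1" using f C(3) by auto
      then show ?thesis unfolding potential_def by (simp add: algebra_simps)
    qed
    then show ?case
      apply (intro wp_mono[OF wp_nbrs[where a = y and f = Plus and F = Suc]])
      using y adj C(6) core_insert[OF c y(2) f(1), of 1] no_excess_insert[OF g e f(2,3)] no_lack_insert[OF l, of y] f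
      by (auto intro!: wp_intros exI[of _ "insert y S"] simp: keeps_def cong: if_cong)
  next
    case 8
    then have f: "y \<in> S \<or> G y \<inter> S \<noteq> {} \<or> \<not> card (G y) < \<rho> ''D''"
      using 8 y A(2) C(4)[OF y(2)] Z by auto
    then have "no_lack G S (\<rho> ''D'') (B' - {y})" using l unfolding no_lack_def by blast
    then show ?case using e c by (auto intro!: exI[of _ S] simp: keeps_def)
  qed (use y in auto)
qed


lemma potential_delete:
  assumes "S \<subseteq> {..<n}" "x \<in> S"
  shows "potential D (S - {x}) = potential D S + 50 * D"
proof -
  have "card (S - {x}) + 1 = card S" "card S \<le> n"
    using assms card_mono[of "{..<n}" S] finite_subset[of S "{..<n}"] card_Suc_Diff1[of S x] by auto
  then have "n - card (S - {x}) = (n - card S) + 1" by linarith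
  then show ?thesis unfolding potential_def by (simp add: algebra_simps)
qed

text \<open>Losing x raises the potential by 50 * D. Its neighbours are passed twice, at 50 steps
  each to lower the counters and at 150 each to offer them to S. By \<open>bad\<close>, x itself has
  no claim to return.\<close>

lemma wp_drop_vertex:
  assumes g: "graph G" and c: "core G S M" and x: "\<rho> ''x'' = x" "x \<in> S"
    and D: "\<rho> ''D'' = D"
    and e: "no_excess G S D B" and l: "no_lack G S D B'"
    and bad: "card (G x) < D \<Longrightarrow> G x \<inter> S \<noteq> {}"
  shows "wp drop_vertex (\<lambda>t \<rho>' M'. keeps {''i'', ''a'', ''j''} \<rho> \<rho>' \<and> (\<forall>r\<ge>2. M' r = M r) \<and>
    (\<exists>S'. core G S' M' \<and> S' \<subseteq> S \<union> {v. card (G v) < D} \<and> no_excess G S' D (B - {x}) \<and> no_lack G S' D (B' - {x}) \<and>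
      t + potential D S' \<le> potential D S + 50 * D + 200 * card (G x) + 100)) \<rho> M"
proof -
  note C = coreD[OF c] and gr = graphD[OF g]
  have xn: "x < n" using C(2) x(2) by auto
  note A = adjacencyD[OF C(1) xn]
  let ?M = "M(0 := (M 0)(x := 0))" and ?S = "S - {x}"
  let ?M1 = "M(0 := (M 0)(x := 0), 1 := \<lambda>b. if b \<in> G x then M 1 b - 1 else M 1 b)"
  have adj: "adjacency G ?M" using C(1) by (rule adjacency_cong) auto
  have pos: "Suc 0 \<le> M 1 b" if "b \<in> G x" for b
  proof -
    have "M 1 b \<noteq> 0" using count_zero_iff[OF g c gr(5)[OF that]] gr(3)[OF that] x(2) by auto
    then show ?thesis by simp
  qed
  have core1: "core G ?S ?M1" using core_delete[OF c xn x(2)] .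
  have e1: "no_excess G ?S D (B - {x})" using e unfolding no_excess_def by blast
  \<comment> \<open>A vertex other than x that loses its last neighbour in S is a neighbour of x,
    whereas x is heavy or keeps a neighbour in S because G has no loops.\<close>
  have l1: "no_lack G ?S D ((B' \<union> G x) - {x})"
    unfolding no_lack_def
  proof (intro ballI impI)
    fix v assume v: "v \<in> {..<n} - ?S - (B' \<union> G x - {x})" "card (G v) < D"
    show "G v \<inter> ?S \<noteq> {}"
    proof (cases "v = x")
      case True
      then show ?thesis using bad v gr(2)[of x] by auto
    next
      case False
      then have "x \<notin> G v" using v gr(3) by auto
      moreover have "G v \<inter> S \<noteq> {}" using False v l unfolding no_lack_def by blast
      ultimately show ?thesis by blast
    qed
  qed
  define I where "I k \<tau> \<rho>' M' \<longleftrightarrow> keeps {''i'', ''a'', ''j''} \<rho> \<rho>' \<and> \<rho>' ''j'' = k \<and> (\<forall>r\<ge>2. M' r = M r) \<and>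
    (\<exists>S'. core G S' M' \<and> S' \<subseteq> S \<union> {v. card (G v) < D} \<and> no_excess G S' D (B - {x}) \<and>
      no_lack G S' D ((B' \<union> M (6 + x) ` {k..<card (G x)}) - {x}) \<and>
      \<tau> + potential D S' \<le> potential D S + 50 * D + 150 * k)" for k \<tau> :: nat and \<rho>' M'
  have loop: "wp (while (Lt (V ''j'') (deg (V ''x'')))
       (seq [assign ''a'' (adj (V ''x'') (V ''j'')), try_add, incr ''j'']))
       (\<lambda>t \<rho>' M'. \<exists>\<tau>. I (card (G x)) \<tau> \<rho>' M' \<and> t \<le> \<tau> + 10) (\<rho>1(''j'' := 0)) ?M1"
    if "keeps {''i'', ''a''} \<rho> \<rho>1" for \<rho>1
  proof (rule wp_while[where I = I and l = "card (G x)"], goal_cases)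
    case (1 k \<tau> \<rho>' M')
    then obtain S' where I: "keeps {''i'', ''a'', ''j''} \<rho> \<rho>'" "\<rho>' ''j'' = k" "\<And>r. r \<ge> 2 \<Longrightarrow> M' r = M r"
      "core G S' M'" "no_excess G S' D (B - {x})"
      "no_lack G S' D ((B' \<union> M (6 + x) ` {k..<card (G x)}) - {x})"
      "\<tau> + potential D S' \<le> potential D S + 50 * D + 150 * k"
      "S' \<subseteq> S \<union> {v. card (G v) < D}"
      unfolding I_def by blast
    have \<rho>': "\<rho>' ''x'' = x" "\<rho>' ''D'' = D" using I(1) x D by (auto simp: keeps_def)
    let ?y = "M (6 + x) k"
    have y: "?y < n" "k < n" using A(8) 1(1) A(5) by auto
    have "{k..<card (G x)} = insert k {Suc k..<card (G x)}" using 1(1) by auto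
    then have sub: "(B' \<union> M (6 + x) ` {k..<card (G x)}) - {x} - {?y}
        \<subseteq> (B' \<union> M (6 + x) ` {Suc k..<card (G x)}) - {x}" by auto
    have "wp try_add (\<lambda>t \<rho>'' M''. keeps {''i''} (\<rho>'(''a'' := ?y)) \<rho>'' \<and> (\<forall>r\<ge>2. M'' r = M' r) \<and>
      (\<exists>S''. core G S'' M'' \<and> S'' \<subseteq> S' \<union> {v. card (G v) < D} \<and> no_excess G S'' D (B - {x}) \<and>
        no_lack G S'' D ((B' \<union> M (6 + x) ` {k..<card (G x)}) - {x} - {?y}) \<and>
        t + potential D S'' \<le> potential D S' + 100)) (\<rho>'(''a'' := ?y)) M'"
      using wp_try_add[OF g I(4), of "\<rho>'(''a'' := ?y)" ?y "B - {x}"] I(5,6) \<rho>' y by simp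
    then have t: "wp try_add (\<lambda>t \<rho>'' M''. wp (seq [incr ''j''])
        (\<lambda>u. I (Suc k) (f t u)) \<rho>'' M'')
        (\<rho>'(''a'' := ?y)) M'" if f: "\<And>t u. f t u \<le> \<tau> + t + u + 40" for f
    proof (rule wp_mono, goal_cases)
      case (1 t \<rho>'' M'')
      then obtain S'' where 2: "keeps {''i''} (\<rho>'(''a'' := ?y)) \<rho>''" "\<forall>r\<ge>2. M'' r = M' r"
        "core G S'' M''" "no_excess G S'' D (B - {x})"
        "no_lack G S'' D ((B' \<union> M (6 + x) ` {k..<card (G x)}) - {x} - {?y})"
        "t + potential D S'' \<le> potential D S' + 100" "S'' \<subseteq> S' \<union> {v. card (G v) < D}" by blast
      have sub': "S'' \<subseteq> S \<union> {v. card (G v) < D}" using 2(7) I(8) by blast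
      have j: "\<rho>'' ''j'' = k" using 2(1) I(2) by (auto simp: keeps_def)
      show ?case
        apply (intro wp_intros wp_incr)
        using j y word_linear apply simp_all
        unfolding I_def
        apply (intro conjI exI[of _ S''])
        using 2(1) I(1) apply (simp add: keeps_def)
        using 2(2) I(3) apply simp_all
        using 2(3,4) no_lack_mono[OF 2(5) sub] 2(6) I(7) f[of t 5] sub' by simp_all
    qed
    show ?case
      apply (intro conjI wp_intros)
      using \<rho>' I(2,3) A(2) xn y 1(1) word_linear apply simp_all
      apply (rule t)
      apply simp
      done
  next
    case (2 \<tau> \<rho>' M')
    then have "\<rho>' ''j'' = card (G x)" "\<rho>' ''x'' = x" "M' 2 = M 2"
      using x by (auto simp: I_def keeps_def)
    then show ?case using xn A(2) 2 by auto
  next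
    case 3
    have "M (6 + x) ` {0..<card (G x)} = G x" using A(4) by (simp add: atLeast0LessThan)
    then have l2: "no_lack G ?S D ((B' \<union> M (6 + x) ` {0..<card (G x)}) - {x})" using l1 by simp
    have k: "keeps {''i'', ''a'', ''j''} \<rho> (\<rho>1(''j'' := 0))" using that by (simp add: keeps_def)
    show ?case
      unfolding I_def
      by (intro conjI exI[of _ ?S] core1 e1 l2 k)
        (auto simp: potential_delete[OF C(2) x(2), of D])
  qed
  have "wp (while (Lt (V ''j'') (deg (V ''x'')))
       (seq [assign ''a'' (adj (V ''x'') (V ''j'')), try_add, incr ''j'']))
       (\<lambda>t \<rho>' M'. \<exists>\<tau>. I (card (G x)) \<tau> \<rho>' M' \<and> t \<le> \<tau> + 10)
       (\<rho>(''a'' := x, ''i'' := card (G x), ''j'' := 0))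
       (M(0 := (M 0)(x := 0), Suc 0 := \<lambda>b. if b \<in> G x then M (Suc 0) b - Suc 0 else M (Suc 0) b))"
    using loop[of "\<rho>(''a'' := x, ''i'' := card (G x))"] by (simp add: keeps_def cong: if_cong)
  note loop' = wp_mono[OF this]
  show ?thesis
    unfolding drop_vertex_def
    apply (intro wp_intros)
    using x xn apply simp_all
    apply (rule wp_mono[OF wp_nbrs[OF adj xn, where F = "\<lambda>x. x - 1"]])
    using C(6) pos apply simp_all
    apply (intro wp_intros)
    apply (simp_all cong: if_cong)
    apply (rule loop')
    apply (intro wp_intros)
    unfolding I_def
    apply (elim exE conjE)
    subgoal for t t' \<rho>'' M'' \<tau> S'
      by (intro conjI exI[of _ S']) simp_all
    done
qed

lemma no_excess_remove: "no_excess G S D B \<Longrightarrow> (x \<in> S \<Longrightarrow> card (G x) < D \<and> G x \<inter> S = {}) \<Longrightarrow>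
    no_excess G S D (B - {x})"
  unfolding no_excess_def by blast

text \<open>The degree bound E matters only if x is in S and may be dropped. A vertex outside S is
  at most added; then it is light and its own credit pays.\<close>

lemma wp_fix_vertex:
  assumes g: "graph G" and c: "core G S M" and x: "\<rho> ''x'' = x" "x < n"
    and D: "\<rho> ''D'' = D"
    and e: "no_excess G S D B" and l: "no_lack G S D B'"
    and E: "x \<in> S \<Longrightarrow> card (G x) \<le> E"
  shows "wp fix_vertex (\<lambda>t \<rho>' M'. keeps {''i'', ''a'', ''j''} \<rho> \<rho>' \<and> (\<forall>r\<ge>2. M' r = M r) \<and>
    (\<exists>S'. core G S' M' \<and> S' \<subseteq> S \<union> {v. card (G v) < D} \<and> no_excess G S' D (B - {x}) \<and> no_lack G S' D (B' - {x}) \<and>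
      t + potential D S' \<le> potential D S + 50 * D + 200 * E + 200)) \<rho> M"
proof -
  note C = coreD[OF c]
  have d: "M 2 x = card (G x)" using adjacencyD(2)[OF C(1) x(2)] .
  have o: "(M 0 x = 0) = (x \<notin> S)" using C(4) x(2) .
  have z: "(M 1 x = 0) = (G x \<inter> S = {})" using count_zero_iff[OF g c x(2)] .
  show ?thesis
    unfolding fix_vertex_def
  proof (intro wp_intros, goal_cases)
    case 1
    then show ?case using x by simp
  next
    case 2
    then have s: "x \<in> S" "card (G x) < D \<Longrightarrow> G x \<inter> S \<noteq> {}" using x d o z D by auto
    show ?case
      apply (rule wp_mono[OF wp_drop_vertex[OF g c x(1) s(1) D e l s(2)]])
       apply assumption
      apply (elim exE conjE)
      subgoal for t \<rho>' M' S'
        using E[OF s(1)] by (intro conjI exI[of _ S']) simp_all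
      done
  next
    case 5
    then have s: "x \<in> S \<Longrightarrow> card (G x) < D \<and> G x \<inter> S = {}" using x d o z D by auto
    have "wp try_add (\<lambda>t \<rho>' M'. keeps {''i''} (\<rho>(''a'' := x)) \<rho>' \<and> (\<forall>r\<ge>2. M' r = M r) \<and>
      (\<exists>S'. core G S' M' \<and> S' \<subseteq> S \<union> {v. card (G v) < D} \<and> no_excess G S' D (B - {x}) \<and> no_lack G S' D (B' - {x}) \<and>
        t + potential D S' \<le> potential D S + 100)) (\<rho>(''a'' := x)) M"
      using wp_try_add[OF g c, of "\<rho>(''a'' := x)" x "B - {x}" B'] x D l no_excess_remove[OF e s]
      by simp
    then show ?case
      apply (simp add: x(1))
      apply (erule wp_mono)
      apply (intro wp_intros)
      apply (elim exE conjE)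
      subgoal for t \<rho>' M' S'
        by (intro conjI exI[of _ S']) (simp_all add: keeps_def)
      done
  qed simp_all
qed

lemma wp_settle:
  assumes g: "graph G" and c: "core G S M" and x: "\<rho> ''x'' = x" "x < n"
    and D: "\<rho> ''D'' = D"
    and e: "no_excess G S D B" and l: "no_lack G S D B'"
    and E: "x \<in> S \<Longrightarrow> card (G x) \<le> E"
    and h: "D \<le> card (G x) \<Longrightarrow> \<rho> ''h'' < n"
  shows "wp settle (\<lambda>t \<rho>' M'. keeps {''i'', ''a'', ''j'', ''h''} \<rho> \<rho>' \<and>
    \<rho>' ''h'' = (if D \<le> card (G x) then \<rho> ''h'' + 1 else \<rho> ''h'') \<and>
    M' 5 = (if D \<le> card (G x) then (M 5)(\<rho> ''h'' := x) else M 5) \<and>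
    (\<forall>r\<ge>2. r \<noteq> 5 \<longrightarrow> M' r = M r) \<and>
    (\<exists>S'. core G S' M' \<and> S' \<subseteq> S \<union> {v. card (G v) < D} \<and> no_excess G S' D (B - {x}) \<and> no_lack G S' D (B' - {x}) \<and>
      t + potential D S' \<le> potential D S + 50 * D + 200 * E + 300)) \<rho> M"
proof -
  have d: "M 2 x = card (G x)" using adjacencyD(2)[OF coreD(1)[OF c] x(2)] .
  show ?thesis
    unfolding settle_def
    apply (rule wp_seq_Cons)
    apply (rule wp_mono[OF wp_fix_vertex[OF g c x D e l E]])
     apply assumption
    apply (elim exE conjE)
    subgoal for t \<rho>' M' S'
      apply (subgoal_tac "\<rho>' ''x'' = x \<and> \<rho>' ''D'' = D \<and> \<rho>' ''h'' = \<rho> ''h'' \<and> M' 2 x = card (G x)")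
       prefer 2
       apply (simp add: keeps_def x D d)
      apply (intro wp_intros wp_incr)
      using x h word_linear apply simp_all
       apply (intro conjI exI[of _ S'])
           apply (simp_all add: keeps_def)
      apply (intro conjI exI[of _ S'])
         apply (simp_all add: keeps_def)
      apply (rule core_cong)
       apply assumption
      subgoal for r by (cases "r = 5") simp_all
      done
    done
qed

end

section \<open>Adjacency lists and vertex lists\<close>

text \<open>One endpoint of a new edge; an insertion calls it for both orders. The degree is raised
  before the place is written, so that places count from one.\<close>

definition half_insert :: com where
  "half_insert = seq
    [ite (Eql (known (V ''a'')) (N 0))
       (seq [store (N 3) (V ''a'') (N 1), store (N 4) (V ''t'') (V ''a''), incr ''t'']) Skip,
     store (adj_row (V ''a'')) (deg (V ''a'')) (V ''b''),
     store (N 2) (V ''a'') (Plus (deg (V ''a'')) (N 1)),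
     store (pos_row (V ''a'')) (V ''b'') (deg (V ''a'')),
     ite (Eql (out (V ''a'')) (N 0)) Skip (store (N 1) (V ''b'') (Plus (cnt (V ''b'')) (N 1)))]"

text \<open>The last entry \<open>y\<close> fills the hole. Its place is written before that of
  \<open>b\<close> is cleared, so that \<open>b\<close> ends with place 0 even if it was the last
  entry.\<close>

definition half_delete :: com where
  "half_delete = seq
    [assign ''d'' (Minus (deg (V ''a'')) (N 1)),
     assign ''p'' (Minus (pos (V ''a'') (V ''b'')) (N 1)),
     assign ''y'' (adj (V ''a'') (V ''d'')),
     store (adj_row (V ''a'')) (V ''p'') (V ''y''),
     store (pos_row (V ''a'')) (V ''y'') (Plus (V ''p'') (N 1)),
     store (pos_row (V ''a'')) (V ''b'') (N 0),
     store (N 2) (V ''a'') (V ''d''),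
     ite (Eql (out (V ''a'')) (N 0)) Skip (store (N 1) (V ''b'') (Minus (cnt (V ''b'')) (N 1)))]"

text \<open>Besides erasing the marks, this compacts the heavy list in place. The endpoints
  \<open>u\<close> and \<open>v\<close> leave the list because their degrees are about to change;
  \<open>settle\<close> appends them again if they are heavy.\<close>

definition clear :: com where
  "clear = seq
    [assign ''p'' (N 0), assign ''q'' (N 0),
     while (Lt (V ''p'') (V ''h''))
       (seq [assign ''x'' (heavy (V ''p'')),
             store (N 0) (V ''x'') (N 0),
             ite (Conj (Neg (Eql (V ''x'') (V ''u''))) (Neg (Eql (V ''x'') (V ''v''))))
               (seq [store (N 5) (V ''q'') (V ''x''), incr ''q'']) Skip,
             incr ''p'']),
     assign ''h'' (V ''q'')]"

lemma bij_betw_snoc: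
  assumes "bij_betw f {..<k} X" "x \<notin> X"
  shows "bij_betw (f(k := x)) {..<Suc k} (insert x X)"
proof -
  have "bij_betw (f(k := x)) {..<k} X" using assms(1) by (rule bij_betw_cong[THEN iffD1, rotated]) auto
  from bij_betw_combine[OF this, of "{k}" "{x}"] assms(2) show ?thesis
    by (simp add: lessThan_Suc insert_commute)
qed

lemma bij_betw_swap_remove:
  assumes f: "bij_betw f {..<Suc l} X" and p: "p \<le> l"
  shows "bij_betw (f(p := f l)) {..<l} (X - {f p})"
proof -
  have i: "inj_on f {..<Suc l}" and X: "X = f ` {..<Suc l}" using f by (auto simp: bij_betw_def)
  have ne: "f i = f j \<longleftrightarrow> i = j" if "i \<le> l" "j \<le> l" for i j
    using inj_onD[OF i] that by auto
  show ?thesis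
    unfolding bij_betw_def
  proof
    show "inj_on (f(p := f l)) {..<l}"
      using ne p by (auto simp: inj_on_def)
    show "(f(p := f l)) ` {..<l} = X - {f p}"
    proof
      show "(f(p := f l)) ` {..<l} \<subseteq> X - {f p}"
        using ne p unfolding X by (auto split: if_splits)
      show "X - {f p} \<subseteq> (f(p := f l)) ` {..<l}"
      proof
        fix y assume "y \<in> X - {f p}"
        then have "y \<in> f ` {..<Suc l}" and "y \<noteq> f p" using X by auto
        then obtain i where "i < Suc l" "y = f i" by blast
        with \<open>y \<noteq> f p\<close> have i: "i \<le> l" "y = f i" "i \<noteq> p" by auto
        show "y \<in> (f(p := f l)) ` {..<l}"
        proof (cases "i = l")
          case True
          then show ?thesis using i p by (auto intro!: image_eqI[of _ _ p])
        next
          case False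
          then show ?thesis using i by (auto intro!: image_eqI[of _ _ i])
        qed
      qed
    qed
  qed
qed

context ram
begin

lemma word_double: "2 * n + 100 < 2 ^ w"
proof -
  have "n + 2 \<le> (n + 2) ^ 3" by (rule self_le_power) auto
  then show ?thesis using word_cubic by linarith
qed

section \<open>List updates at one endpoint\<close>

lemma adjacency_insert:
  assumes A: "adjacency G M" and a: "a < n" "b < n" "b \<notin> G a"
  shows "adjacency (G(a := insert b (G a)))
    (M(6 + a := (M (6 + a))(card (G a) := b), 2 := (M 2)(a := Suc (card (G a))),
       6 + a + n := (M (6 + a + n))(b := Suc (card (G a)))))"
    (is "adjacency ?G ?M")
  unfolding adjacency_def
proof (intro allI impI)
  fix c assume c: "c < n"
  note Gc = adjacencyD[OF A c]
  have fin: "finite (G c)" using Gc(1) finite_subset by blast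
  have bij: "bij_betw (M (6 + c)) {..<card (G c)} (G c)" using Gc(3,4) by (simp add: bij_betw_def)
  show "?G c \<subseteq> {..<n} \<and> ?M 2 c = card (?G c) \<and> bij_betw (?M (6 + c)) {..<card (?G c)} (?G c) \<and>
     (\<forall>b<n. b \<notin> ?G c \<longrightarrow> ?M (6 + c + n) b = 0) \<and>
     (\<forall>i<card (?G c). ?M (6 + c + n) (?M (6 + c) i) = Suc i)"
  proof (cases "c = a")
    case True
    have card: "card (insert b (G a)) = Suc (card (G a))" using fin True a(3) by simp
    have "M (6 + a) i \<noteq> b" if "i < card (G a)" for i using Gc(9) that True a(3) by blast
    then show ?thesis
      using Gc(1,2,6,7) True a bij_betw_snoc[OF bij, of b] unfolding card
      by (auto simp: card less_Suc_eq)
  next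
    case False
    then show ?thesis using Gc(1,2,6,7) bij a c by auto
  qed
qed

text \<open>The cell behind the shortened list keeps its old value, since \<open>adjacency\<close>
  speaks of the first d entries only.\<close>

lemma adjacency_delete:
  assumes A: "adjacency G M" and a: "a < n" "b \<in> G a"
    and d: "card (G a) = Suc d" and p: "M (6 + a + n) b = Suc p" and y: "y = M (6 + a) d"
  shows "p \<le> d" "adjacency (G(a := G a - {b}))
    (M(6 + a := (M (6 + a))(p := y), 6 + a + n := (M (6 + a + n))(y := Suc p, b := 0),
       2 := (M 2)(a := d)))"
    (is "adjacency ?G ?M")
proof -
  note Ga = adjacencyD[OF A a(1)]
  obtain j where j: "j < card (G a)" "b = M (6 + a) j" using Ga(4) a(2) by blast
  with Ga(7)[of j] p have pj: "p < card (G a)" "b = M (6 + a) p" by auto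
  then show pd: "p \<le> d" using d by simp
  have ne: "M (6 + a) i = M (6 + a) k \<longleftrightarrow> i = k" if "i \<le> d" "k \<le> d" for i k
    using inj_onD[OF Ga(3)] that d by auto
  show "adjacency ?G ?M"
    unfolding adjacency_def
  proof (intro allI impI)
    fix c assume c: "c < n"
    note Gc = adjacencyD[OF A c]
    have fin: "finite (G c)" using Gc(1) finite_subset by blast
    have bij: "bij_betw (M (6 + c)) {..<card (G c)} (G c)" using Gc(3,4) by (simp add: bij_betw_def)
    show "?G c \<subseteq> {..<n} \<and> ?M 2 c = card (?G c) \<and> bij_betw (?M (6 + c)) {..<card (?G c)} (?G c) \<and>
       (\<forall>b<n. b \<notin> ?G c \<longrightarrow> ?M (6 + c + n) b = 0) \<and>
       (\<forall>i<card (?G c). ?M (6 + c + n) (?M (6 + c) i) = Suc i)"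
    proof (cases "c = a")
      case True
      have card: "card (G a - {b}) = d" using fin True a(2) d by simp
      have "bij_betw (?M (6 + a)) {..<d} (G a - {b})"
        using bij_betw_swap_remove[of "M (6 + a)" d "G a" p] bij True d pj(2) pd y a(1) by simp
      moreover have "?M (6 + a) = (M (6 + a))(p := y)"
        "?M (6 + a + n) = (M (6 + a + n))(y := Suc p, b := 0)" using a(1) by simp_all
      moreover have "((M (6 + a + n))(y := Suc p, b := 0)) (((M (6 + a))(p := y)) i) = Suc i"
        if i: "i < d" for i
      proof (cases "i = p")
        case True
        then have "y \<noteq> b" using i ne[of d p] pd unfolding y pj(2) by simp
        then show ?thesis using True by simp
      next
        case False
        then have "M (6 + a) i \<noteq> y" "M (6 + a) i \<noteq> b"
          using i ne[of i d] ne[of i p] pd unfolding y pj(2) by simp_all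
        then show ?thesis using False Ga(7)[of i] i d by simp
      qed
      moreover have "((M (6 + a + n))(y := Suc p, b := 0)) z = 0" if "z < n" "z \<notin> G a - {b}" for z
      proof (cases "z = b")
        case False
        then have "z \<notin> G a" using that by simp
        moreover have "y \<in> G a" using Ga(9)[of d] d y by simp
        ultimately show ?thesis using Ga(6)[of z] that by auto
      qed simp
      moreover have "?M 2 a = d" by simp
      ultimately show ?thesis using Ga(1) unfolding True card fun_upd_same by auto
    next
      case False
      then show ?thesis using Gc(1,2,6,7) bij a c by auto
    qed
  qed
qed

text \<open>The marks in row 3 decide membership in constant time, so that no vertex is listed
  twice.\<close>

definition touched_list :: "nat set \<Rightarrow> rows \<Rightarrow> bool" where
  "touched_list K M \<longleftrightarrow> K \<subseteq> {..<n} \<and> bij_betw (M 4) {..<card K} K \<and> (\<forall>v<n. M 3 v = 0 \<longleftrightarrow> v \<notin> K)"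

text \<open>Stated for an arbitrary G with a condition on \<open>G a\<close> alone, because between
  the two calls for one edge G is asymmetric.\<close>

lemma wp_half_insert:
  assumes g: "G a \<subseteq> {..<n} - {a}" and c: "core G S M" and r: "\<rho> ''a'' = a" "\<rho> ''b'' = b" "\<rho> ''n'' = n"
    and a: "a < n" "b < n" "b \<notin> G a"
    and K: "touched_list K M" "\<rho> ''t'' = card K"
  shows "wp half_insert (\<lambda>t \<rho>' M'. t \<le> 200 \<and> keeps {''t''} \<rho> \<rho>' \<and> M' 0 = M 0 \<and> M' 5 = M 5 \<and>
    core (G(a := insert b (G a))) S M' \<and> touched_list (insert a K) M' \<and> \<rho>' ''t'' = card (insert a K)) \<rho> M"
proof -
  note C = coreD[OF c]
  note A = adjacencyD[OF C(1) a(1)]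
  have a2: "a < 2 * n" "a + n < 2 * n" "n \<noteq> 0" using a(1) by simp_all
  have dg: "M 2 a = card (G a)" "card (G a) < n"
    using A(2) psubset_card_mono[of "{..<n}" "G a"] g a(1) by auto
  have o: "(M 0 a = 0) = (a \<notin> S)" using C(4) a(1) .
  have fK: "finite K" using K(1) unfolding touched_list_def using finite_subset by blast
  have k: "(M 3 a = 0) = (a \<notin> K)" using K(1) a(1) unfolding touched_list_def by blast
  have tn: "card K < n" if "a \<notin> K"
    using K(1) psubset_card_mono[of "{..<n}" K] that a(1) unfolding touched_list_def by auto
  have cb: "Suc (M 1 b) < 2 ^ w" "6 + a + n < 2 ^ w" "6 + a < 2 ^ w" "Suc (card (G a)) < 2 ^ w" "Suc (card K) < 2 ^ w"
  proof -
    have "M 1 b \<le> n" "card K \<le> n"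
      using C(6) a(2) card_mono[of "{..<n}" K] K(1) unfolding touched_list_def by auto
    then show "Suc (M 1 b) < 2 ^ w" "6 + a + n < 2 ^ w" "6 + a < 2 ^ w" "Suc (card (G a)) < 2 ^ w" "Suc (card K) < 2 ^ w"
      using word_double a(1) dg(2) by linarith+
  qed
  let ?G = "G(a := insert b (G a))"
  have count: "card {x \<in> S. y \<in> ?G x} = (if y = b \<and> a \<in> S then Suc (card {x \<in> S. y \<in> G x}) else card {x \<in> S. y \<in> G x})" for y
  proof (cases "y = b \<and> a \<in> S")
    case True
    then have "{x \<in> S. y \<in> ?G x} = insert a {x \<in> S. y \<in> G x}" by auto
    then show ?thesis using True C(3) a(3) by simp
  next
    case False
    then have "{x \<in> S. y \<in> ?G x} = {x \<in> S. y \<in> G x}" by auto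
    then show ?thesis using False by simp
  qed
  have final: "core ?G S M'" if "M' 0 = M 0" "M' (Suc 0) = (if a \<in> S then (M (Suc 0))(b := Suc (M (Suc 0) b)) else M (Suc 0))"
    "M' 2 = (M 2)(a := Suc (card (G a)))"
    "\<And>r. 6 \<le> r \<Longrightarrow> M' r = (M(6 + a := (M (6 + a))(card (G a) := b),
       6 + a + n := (M (6 + a + n))(b := Suc (card (G a))))) r" for M'
  proof -
    have "adjacency ?G M'"
      by (rule adjacency_cong[OF adjacency_insert[OF C(1) a]]) (use that(3,4) in auto)
    moreover have "marks S M'" using c that(1) unfolding core_def marks_def by simp
    moreover have "counts ?G S M'" unfolding counts_def count
      using C(5) that(2) by simp
    ultimately show ?thesis unfolding core_def by simp
  qed
  have final_K: "touched_list (insert a K) M'"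
    if "a \<notin> K" "M' 3 = (M 3)(a := Suc 0)" "M' 4 = (M 4)(card K := a)" for M'
    using K(1) bij_betw_snoc[of "M 4" "card K" K a] that a fK unfolding touched_list_def by auto
  have final_K': "touched_list K M'" if "M' 3 = M 3" "M' 4 = M 4" for M'
    using K(1) that unfolding touched_list_def by simp
  show ?thesis
  proof (cases "a \<in> K")
    case True
    note f = r K(2) True dg cb[simplified] o k a a2 insert_absorb[OF True]
    show ?thesis
      unfolding half_insert_def
      apply ((rule wp_intros wp_incr; (simp add: f)?)+)
       apply (intro conjI final final_K')
      apply (simp_all add: keeps_def True f)
      apply ((rule wp_intros wp_incr; (simp add: f)?)+)
       apply (intro conjI final final_K')
      apply (simp_all add: keeps_def True f)
      done
  next
    case False
    note f = r K(2) False dg cb[simplified] o k a a2 fK tn[OF False]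
    show ?thesis
      unfolding half_insert_def
      apply ((rule wp_intros wp_incr; (simp add: f)?)+)
       apply (intro conjI final final_K)
      apply (simp_all add: keeps_def f)
      apply ((rule wp_intros wp_incr; (simp add: f)?)+)
       apply (intro conjI final final_K)
      apply (simp_all add: keeps_def f)
      done
  qed
qed

lemma wp_half_delete:
  assumes c: "core G S M" and r: "\<rho> ''a'' = a" "\<rho> ''b'' = b" "\<rho> ''n'' = n"
    and a: "a < n" "b < n" "b \<in> G a"
  shows "wp half_delete (\<lambda>t \<rho>' M'. t \<le> 200 \<and> keeps {''d'', ''p'', ''y''} \<rho> \<rho>' \<and>
    M' 0 = M 0 \<and> M' 3 = M 3 \<and> M' 4 = M 4 \<and> M' 5 = M 5 \<and>
    core (G(a := G a - {b})) S M') \<rho> M"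
proof -
  note C = coreD[OF c]
  note A = adjacencyD[OF C(1) a(1)]
  have fin: "finite (G a)" using A(1) finite_subset by blast
  obtain d where d: "card (G a) = Suc d" using a(3) fin by (cases "card (G a)") auto
  obtain j where j: "j < card (G a)" "b = M (6 + a) j" using A(4) a(3) by blast
  then obtain p where p: "M (6 + a + n) b = Suc p" using A(7) by blast
  define y where "y = M (6 + a) d"
  note del = adjacency_delete[OF C(1) a(1,3) d p y_def]
  have lt: "d < n" "p < n" "y < n" "Suc d < 2 ^ w" "Suc p < 2 ^ w" "6 + a + n < 2 ^ w" "6 + a < 2 ^ w"
    "a < 2 * n" "a + n < 2 * n" "n \<noteq> 0" "6 + a + n \<noteq> 2" "d < 2 ^ w" "p < 2 ^ w"
    using d A(5) A(8)[of d] word_double a(1) del(1) y_def by auto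
  have dg: "M 2 a = Suc d" using A(2) d by simp
  have o: "(M 0 a = 0) = (a \<notin> S)" using C(4) a(1) .
  \<comment> \<open>A member a of S with b in its list is itself a witness that the counter of b is
    positive.\<close>
  have b1: "Suc 0 \<le> M (Suc 0) b \<and> M (Suc 0) b < 2 ^ w" if "a \<in> S"
  proof -
    have "M 1 b \<noteq> 0" using C(3,5) a(2,3) that by auto
    moreover have "M 1 b \<le> n" using C(6) a(2) by blast
    ultimately show ?thesis using word_linear by simp
  qed
  let ?G = "G(a := G a - {b})"
  have count: "card {x \<in> S. z \<in> ?G x} = (if z = b \<and> a \<in> S then card {x \<in> S. z \<in> G x} - 1 else card {x \<in> S. z \<in> G x})" for z
  proof (cases "z = b \<and> a \<in> S")
    case True
    then have "{x \<in> S. z \<in> ?G x} = {x \<in> S. z \<in> G x} - {a}" by auto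
    then show ?thesis using True C(3) a(3) by simp
  next
    case False
    then have "{x \<in> S. z \<in> ?G x} = {x \<in> S. z \<in> G x}" by auto
    then show ?thesis using False by (simp only: if_False)
  qed
  have final: "core ?G S M'" if "M' 0 = M 0"
    "M' (Suc 0) = (if a \<in> S then (M (Suc 0))(b := M (Suc 0) b - Suc 0) else M (Suc 0))"
    "M' 2 = (M 2)(a := d)"
    "\<And>r. 6 \<le> r \<Longrightarrow> M' r = (M(6 + a := (M (6 + a))(p := y),
      6 + a + n := (M (6 + a + n))(y := Suc p, b := 0))) r" for M'
  proof -
    have "adjacency ?G M'"
      by (rule adjacency_cong[OF del(2)]) (use that(3,4) in auto)
    moreover have "marks S M'" using c that(1) unfolding core_def marks_def by simp
    moreover have "counts ?G S M'" unfolding counts_def count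
      using C(5) that(2) by simp
    ultimately show ?thesis unfolding core_def by simp
  qed
  note f = r dg p y_def[symmetric] lt o a b1
  show ?thesis
    unfolding half_delete_def
    apply ((rule wp_intros wp_incr; (simp add: f)?)+)
     apply (intro conjI final)
    apply (simp_all add: keeps_def f)
    apply ((rule wp_intros wp_incr; (simp add: f)?)+)
    apply (intro conjI final)
    apply (simp_all add: keeps_def f)
    done
qed

definition heavy_list :: "nat set \<Rightarrow> rows \<Rightarrow> bool" where
  "heavy_list X M \<longleftrightarrow> X \<subseteq> {..<n} \<and> bij_betw (M 5) {..<card X} X"

section \<open>Erasing the heavy vertices from the output\<close>

lemma card_le_n: "X \<subseteq> {..<n} \<Longrightarrow> card X \<le> n"
  using card_mono[of "{..<n}" X] by simp

lemma wp_clear: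
  assumes X: "heavy_list X M" "\<rho> ''h'' = card X"
  shows "wp clear (\<lambda>t \<rho>' M'. t \<le> 100 * card X + 20 \<and> keeps {''p'', ''q'', ''x'', ''h''} \<rho> \<rho>' \<and>
    (\<forall>r. r \<noteq> 0 \<and> r \<noteq> 5 \<longrightarrow> M' r = M r) \<and> M' 0 = (\<lambda>y. if y \<in> X then 0 else M 0 y) \<and>
    heavy_list (X - {\<rho> ''u'', \<rho> ''v''}) M' \<and> \<rho>' ''h'' = card (X - {\<rho> ''u'', \<rho> ''v''})) \<rho> M"
proof -
  let ?l = "card X" and ?R = "{\<rho> ''u'', \<rho> ''v''}" and ?P = "\<lambda>k. M 5 ` {..<k}"
  have l: "?l \<le> n" using card_le_n X(1) by (simp add: heavy_list_def)
  have im: "?P ?l = X" and inj: "inj_on (M 5) {..<?l}" and Xn: "X \<subseteq> {..<n}"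
    using X(1) by (auto simp: heavy_list_def bij_betw_def)
  \<comment> \<open>The write index never overtakes the read index k, so row 5 is still original
    from k on.\<close>
  define I where "I k \<tau> \<rho>' M' \<longleftrightarrow> \<tau> \<le> 100 * k \<and> keeps {''p'', ''q'', ''x''} \<rho> \<rho>' \<and> \<rho>' ''p'' = k \<and>
    (\<forall>r. r \<noteq> 0 \<and> r \<noteq> 5 \<longrightarrow> M' r = M r) \<and> M' 0 = (\<lambda>y. if y \<in> ?P k then 0 else M 0 y) \<and>
    \<rho>' ''q'' \<le> k \<and> bij_betw (M' 5) {..<\<rho>' ''q''} (?P k - ?R) \<and> (\<forall>i\<ge>k. M' 5 i = M 5 i)"
    for k \<tau> :: nat and \<rho>' M'
  show ?thesis
    unfolding clear_def
    apply ((rule wp_intros; simp?)+)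
    apply (rule wp_while[where I = I and l = ?l])
  proof goal_cases
    case (1 k \<tau> \<rho>' M')
    let ?x = "M 5 k"
    have I: "\<tau> \<le> 100 * k" "keeps {''p'', ''q'', ''x''} \<rho> \<rho>'" "\<rho>' ''p'' = k"
      "\<forall>r. r \<noteq> 0 \<and> r \<noteq> 5 \<longrightarrow> M' r = M r" "M' 0 = (\<lambda>y. if y \<in> ?P k then 0 else M 0 y)"
      "\<rho>' ''q'' \<le> k" "bij_betw (M' 5) {..<\<rho>' ''q''} (?P k - ?R)" "\<forall>i\<ge>k. M' 5 i = M 5 i"
      using 1(2) by (auto simp: I_def)
    have x: "?x < n" "k < n" "?x \<notin> ?P k" "\<rho>' ''q'' < n" "Suc k < 2 ^ w" "Suc (\<rho>' ''q'') < 2 ^ w"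
    proof -
      have "?x \<in> X" using 1(1) im by blast
      then show "?x < n" using Xn by auto
      show "?x \<notin> ?P k" using inj_on_image_mem_iff[OF inj, of k "{..<k}"] 1(1) by auto
      show "k < n" "\<rho>' ''q'' < n" "Suc k < 2 ^ w" "Suc (\<rho>' ''q'') < 2 ^ w"
        using 1(1) l I(6) word_linear by linarith+
    qed
    have P: "?P (Suc k) = insert ?x (?P k)" by (simp add: lessThan_Suc)
    have r: "\<rho>' ''h'' = ?l" "\<rho>' ''u'' = \<rho> ''u''" "\<rho>' ''v'' = \<rho> ''v''" "M' 5 k = ?x"
      using I(2,8) X(2) by (auto simp: keeps_def)
    have snoc: "bij_betw ((M' 5)(\<rho>' ''q'' := ?x)) {..<Suc (\<rho>' ''q'')} (insert ?x (?P k) - ?R)" if "?x \<notin> ?R"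
      using bij_betw_snoc[OF I(7), of ?x] x(3) that by (simp add: insert_Diff_if)
    have same: "bij_betw (M' 5) {..<\<rho>' ''q''} (insert ?x (?P k) - ?R)" if "?x \<in> ?R"
      using I(7) that by (simp add: insert_Diff_if)
    note f = r x I(3) 1(1)
    show ?case
      apply (intro conjI)
        apply (simp add: f)
       apply (simp add: f)
      apply ((rule wp_intros wp_incr; (simp add: f)?)+)
       apply (unfold I_def P)[1]
       apply (intro conjI)
      using I snoc
             apply (simp_all add: keeps_def fun_eq_iff f)
      apply ((rule wp_intros wp_incr; (simp add: f)?)+)
      apply (unfold I_def P)[1]
      apply (intro conjI)
      using same
             apply (simp_all add: keeps_def fun_eq_iff f)
      done
  next
    case (2 \<tau> \<rho>' M')
    have h: "\<rho>' ''h'' = ?l" using 2 X(2) by (auto simp: I_def keeps_def)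
    have I: "\<tau> \<le> 100 * ?l" "keeps {''p'', ''q'', ''x''} \<rho> \<rho>'" "\<rho>' ''p'' = ?l"
      "\<forall>r. r \<noteq> 0 \<and> r \<noteq> 5 \<longrightarrow> M' r = M r" "M' 0 = (\<lambda>y. if y \<in> X then 0 else M 0 y)"
      "bij_betw (M' 5) {..<\<rho>' ''q''} (X - ?R)"
      using 2 by (simp_all add: I_def im)
    have q: "\<rho>' ''q'' = card (X - ?R)" using bij_betw_same_card[OF I(6)] by simp
    have "heavy_list (X - ?R) M'" using I(6) Xn unfolding heavy_list_def q by auto
    then show ?case
      apply (intro conjI)
        apply (simp)
       apply (simp add: h I(3))
      apply ((rule wp_intros; simp?)+)
      apply (intro conjI)
      using I q by (simp_all add: keeps_def)
  qed (simp add: I_def keeps_def bij_betw_def)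
qed

end

section \<open>Heavy vertices\<close>

text \<open>The counters see S only, so conflicts among heavy vertices are found by testing all
  pairs; \<open>pos\<close> decides adjacency in constant time. A vertex skipped because of its
  counter keeps the mark 0.\<close>

definition greedy :: com where
  "greedy = seq
    [assign ''p'' (N 0),
     while (Lt (V ''p'') (V ''h''))
       (seq
         [assign ''x'' (heavy (V ''p'')),
          ite (Eql (cnt (V ''x'')) (N 0))
            (seq
              [assign ''o'' (N 1), assign ''q'' (N 0),
               while (Lt (V ''q'') (V ''h''))
                 (seq
                   [assign ''y'' (heavy (V ''q'')),
                    ite (Conj (Neg (Eql (out (V ''y'')) (N 0))) (Neg (Eql (pos (V ''x'') (V ''y'')) (N 0))))
                      (assign ''o'' (N 0)) Skip,
                    incr ''q'']),
               store (N 0) (V ''x'') (V ''o'')])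
            Skip,
          incr ''p''])]"

context ram
begin

lemma pos_zero_iff:
  assumes "adjacency G M" "x < n" "y < n"
  shows "M (6 + x + n) y = 0 \<longleftrightarrow> y \<notin> G x"
proof
  assume z: "M (6 + x + n) y = 0"
  show "y \<notin> G x"
  proof
    assume "y \<in> G x"
    then obtain i where "i < card (G x)" "y = M (6 + x) i" using adjacencyD(4)[OF assms(1,2)] by blast
    then show False using adjacencyD(7)[OF assms(1,2), of i] z by simp
  qed
qed (rule adjacencyD(6)[OF assms])

text \<open>Domination of every outside vertex is the local form of maximality.\<close>

definition mis :: "(nat \<Rightarrow> nat set) \<Rightarrow> nat set \<Rightarrow> bool" where
  "mis G I \<longleftrightarrow> (\<forall>u\<in>I. G u \<inter> I = {}) \<and> (\<forall>v<n. v \<notin> I \<longrightarrow> G v \<inter> I \<noteq> {})"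

lemma wp_greedy_inner:
  assumes A: "adjacency G M" and m: "marks Y M" and x: "\<rho> ''x'' = x" "x < n" "\<rho> ''n'' = n"
    and X: "heavy_list X M" "\<rho> ''h'' = card X" "\<rho> ''q'' = 0" "\<rho> ''o'' = 1"
  shows "wp (while (Lt (V ''q'') (V ''h''))
     (seq
       [assign ''y'' (heavy (V ''q'')),
        ite (Conj (Neg (Eql (out (V ''y'')) (N 0))) (Neg (Eql (pos (V ''x'') (V ''y'')) (N 0))))
          (assign ''o'' (N 0)) Skip,
        incr ''q'']))
     (\<lambda>t \<rho>' M'. t \<le> 60 * card X + 10 \<and> keeps {''q'', ''y'', ''o''} \<rho> \<rho>' \<and> M' = M \<and>
       \<rho>' ''o'' = (if G x \<inter> Y \<inter> X = {} then 1 else 0)) \<rho> M"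
proof -
  let ?l = "card X" and ?P = "\<lambda>k. M 5 ` {..<k}"
  have l: "?l \<le> n" using card_le_n X(1) by (simp add: heavy_list_def)
  have im: "?P ?l = X" and Xn: "X \<subseteq> {..<n}"
    using X(1) by (auto simp: heavy_list_def bij_betw_def)
  define I where "I k \<tau> \<rho>' M' \<longleftrightarrow> \<tau> \<le> 60 * k \<and> keeps {''q'', ''y'', ''o''} \<rho> \<rho>' \<and> \<rho>' ''q'' = k \<and>
    M' = M \<and> \<rho>' ''o'' = (if G x \<inter> Y \<inter> ?P k = {} then 1 else 0)" for k \<tau> :: nat and \<rho>' M'
  show ?thesis
  proof (rule wp_while[where I = I and l = ?l], goal_cases)
    case (1 k \<tau> \<rho>' M')
    let ?y = "M 5 k"
    have I: "\<tau> \<le> 60 * k" "keeps {''q'', ''y'', ''o''} \<rho> \<rho>'" "\<rho>' ''q'' = k" "M' = M"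
      "\<rho>' ''o'' = (if G x \<inter> Y \<inter> ?P k = {} then 1 else 0)"
      using 1(2) by (auto simp: I_def)
    have r: "\<rho>' ''h'' = ?l" "\<rho>' ''x'' = x" "\<rho>' ''n'' = n" using I(2) X x by (auto simp: keeps_def)
    have y: "?y < n" "k < n" "Suc k < 2 ^ w" "6 + x + n < 2 ^ w" "6 + x < 2 ^ w" "x + n < 2 * n"
      using 1(1) l im Xn word_double x(2) by auto
    have o: "(M 0 ?y = 0) = (?y \<notin> Y)" using m y(1) by (simp add: marks_def)
    have p: "(M (6 + x + n) ?y = 0) = (?y \<notin> G x)" using pos_zero_iff[OF A x(2) y(1)] .
    have P: "?P (Suc k) = insert ?y (?P k)" by (simp add: lessThan_Suc)
    note f = r y I(3,4) 1(1) o p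
    show ?case
      apply (intro conjI)
        apply (simp add: f)
       apply (simp add: f)
      apply ((rule wp_intros wp_incr; (simp add: f)?)+)
       apply (unfold I_def P)[1]
       apply (intro conjI)
      using I apply (simp_all add: keeps_def f)
      apply ((rule wp_intros wp_incr; (simp add: f)?)+)
      apply (unfold I_def P)[1]
      apply (intro conjI)
          apply (simp_all add: keeps_def f)
      apply blast
      done
  next
    case (2 \<tau> \<rho>' M')
    then show ?case using X(2) by (simp add: I_def keeps_def im)
  next
    case 3
    then show ?case using X by (simp add: I_def keeps_def)
  qed
qed

text \<open>Light vertices outside S are already dominated by S, so only heavy ones are decided. A
  chosen one has counter 0 and hence no neighbour in S.\<close>

lemma wp_greedy:
  assumes g: "graph G" and c: "core G S M"
    and e: "no_excess G S D {}" and k: "no_lack G S D {}"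
    and X: "heavy_list X M" "\<rho> ''h'' = card X" "\<rho> ''n'' = n" and XD: "X = {v. v < n \<and> D \<le> card (G v)}"
  shows "wp greedy (\<lambda>t \<rho>' M'. t \<le> card X * (60 * card X + 200) + 20 \<and>
    keeps {''p'', ''q'', ''x'', ''y'', ''o''} \<rho> \<rho>' \<and> (\<forall>r. r \<noteq> 0 \<longrightarrow> M' r = M r) \<and>
    (\<exists>Y\<subseteq>X. marks (S \<union> Y) M' \<and> mis G (S \<union> Y))) \<rho> M"
proof -
  note C = coreD[OF c]
  let ?l = "card X" and ?P = "\<lambda>k. M 5 ` {..<k}"
  let ?c = "60 * card X + 200"
  have l: "?l \<le> n" using card_le_n X(1) by (simp add: heavy_list_def)
  have im: "?P ?l = X" and inj: "inj_on (M 5) {..<?l}" and Xn: "X \<subseteq> {..<n}"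
    using X(1) by (auto simp: heavy_list_def bij_betw_def)
  have SX: "S \<inter> X = {}" using e unfolding no_excess_def XD by auto
  define J where "J Y k \<longleftrightarrow> Y \<subseteq> ?P k \<and> (\<forall>u\<in>S \<union> Y. G u \<inter> (S \<union> Y) = {}) \<and>
    (\<forall>v\<in>?P k. v \<notin> Y \<longrightarrow> G v \<inter> (S \<union> Y) \<noteq> {})" for Y k
  define I where "I k \<tau> \<rho>' M' \<longleftrightarrow> \<tau> \<le> k * ?c \<and> keeps {''p'', ''q'', ''x'', ''y'', ''o''} \<rho> \<rho>' \<and>
    \<rho>' ''p'' = k \<and> (\<forall>r. r \<noteq> 0 \<longrightarrow> M' r = M r) \<and> (\<exists>Y. marks (S \<union> Y) M' \<and> J Y k)"
    for k \<tau> :: nat and \<rho>' M'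
  show ?thesis
    unfolding greedy_def
    apply ((rule wp_intros; simp?)+)
    apply (rule wp_while[where I = I and l = ?l])
  proof goal_cases
    case (1 k \<tau> \<rho>' M')
    let ?x = "M 5 k"
    have I: "\<tau> \<le> k * ?c" "keeps {''p'', ''q'', ''x'', ''y'', ''o''} \<rho> \<rho>'" "\<rho>' ''p'' = k"
      "\<And>r. r \<noteq> 0 \<Longrightarrow> M' r = M r"
      using 1(2) by (auto simp: I_def)
    obtain Y where Y: "marks (S \<union> Y) M'" "J Y k" using 1(2) by (auto simp: I_def)
    have x: "?x < n" "k < n" "?x \<notin> ?P k" "?x \<in> X" "Suc k < 2 ^ w"
    proof -
      show "?x \<in> X" using 1(1) im by blast
      then show "?x < n" using Xn by auto
      show "?x \<notin> ?P k" using inj_on_image_mem_iff[OF inj, of k "{..<k}"] 1(1) by auto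
      show "k < n" "Suc k < 2 ^ w" using 1(1) l word_linear by linarith+
    qed
    have Pk: "?P k \<subseteq> X" using 1(1) im by auto
    have P: "?P (Suc k) = insert ?x (?P k)" by (simp add: lessThan_Suc)
    have r: "\<rho>' ''h'' = ?l" "\<rho>' ''n'' = n" using I(2) X by (auto simp: keeps_def)
    have z: "(M (Suc 0) ?x = 0) = (G ?x \<inter> S = {})" using count_zero_iff[OF g c x(1)] by simp
    have M': "M' 5 = M 5" "M' (Suc 0) = M (Suc 0)" using I(4) by simp_all
    have YX: "Y \<subseteq> X" "?x \<notin> S \<union> Y" using Y(2) Pk x SX unfolding J_def by blast+
    have A: "adjacency G M'" using C(1) by (rule adjacency_cong) (use I(4) in auto)
    have H: "heavy_list X M'" using X(1) I(4) by (simp add: heavy_list_def)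
    have skip: "J Y (Suc k)" if "G ?x \<inter> (S \<union> Y) \<noteq> {}"
      using Y(2) that unfolding J_def P by blast
    \<comment> \<open>The new member has no neighbour among the chosen vertices, and by symmetry
      none of them acquires one.\<close>
    have add: "J (insert ?x Y) (Suc k)" if "G ?x \<inter> (S \<union> Y) = {}"
      using Y(2) that graphD(2,3)[OF g] unfolding J_def P by blast
    have m0: "marks (S \<union> Y) (M'(0 := (M' 0)(?x := 0)))" using Y(1) YX(2) by (auto simp: marks_def)
    have m1: "marks (S \<union> insert ?x Y) (M'(0 := (M' 0)(?x := 1)))" using Y(1) x(1) by (auto simp: marks_def)
    let ?\<rho> = "\<rho>'(''x'' := ?x, ''o'' := Suc 0, ''q'' := 0)"
    have inner: "wp (while (Lt (V ''q'') (V ''h''))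
     (seq
       [assign ''y'' (heavy (V ''q'')),
        ite (Conj (Neg (Eql (out (V ''y'')) (N 0))) (Neg (Eql (pos (V ''x'') (V ''y'')) (N 0))))
          (assign ''o'' (N 0)) Skip,
        incr ''q'']))
     (\<lambda>t \<rho>' M''. t \<le> 60 * card X + 10 \<and> keeps {''q'', ''y'', ''o''} ?\<rho> \<rho>' \<and> M'' = M' \<and>
       \<rho>' ''o'' = (if G ?x \<inter> (S \<union> Y) \<inter> X = {} then 1 else 0)) ?\<rho> M'"
      by (rule wp_greedy_inner[OF A Y(1) _ x(1) _ H]) (simp_all add: r)
    note f = r x I(3) M' 1(1) z
    have time: "\<tau> + u \<le> Suc k * ?c" if "u \<le> ?c" for u using I(1) that by simp
    have fin: "I (Suc k) (\<tau> + u) \<rho>'' M''"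
      if "u \<le> ?c" "keeps {''p'', ''q'', ''x'', ''y'', ''o''} \<rho>' \<rho>''" "\<rho>'' ''p'' = Suc k"
        "\<forall>r. r \<noteq> 0 \<longrightarrow> M'' r = M' r" "marks (S \<union> Z) M''" "J Z (Suc k)" for u \<rho>'' M'' Z
      unfolding I_def
      apply (intro conjI exI[of _ Z])
      using that time[OF that(1)] I(2,4) by (simp_all add: keeps_def)
    show ?case
      apply (intro conjI)
        apply (simp add: f)
       apply (simp add: f)
      apply (rule wp_seq_Cons, rule wp_assign, simp, simp add: f, simp only: aval.simps f)
      apply (rule wp_seq_Cons, rule wp_ite, simp add: f)
       apply (rule wp_seq_Cons, rule wp_assign, simp, simp add: f, simp only: aval.simps f)
       apply (rule wp_seq_Cons, rule wp_assign, simp, simp add: f, simp only: aval.simps f)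
       apply (rule wp_seq_Cons)
       apply (rule wp_mono[OF inner])
      subgoal for t \<rho>'' M''
        apply (elim conjE)
        apply (rule wp_seq_Cons, rule wp_store)
             apply (simp_all add: keeps_def f)[5]
        apply (rule wp_seq_Nil, rule wp_seq_Cons, rule wp_incr)
          apply (simp_all add: keeps_def f)[2]
        apply (rule wp_seq_Nil)
        apply (cases "G ?x \<inter> (S \<union> Y) = {}")
        subgoal
          unfolding add.assoc
          apply (rule fin[where Z = "insert ?x Y"])
          using m1 add
               apply (simp_all add: keeps_def f)
          done
        subgoal premises p
        proof -
          \<comment> \<open>The counter of the vertex is 0, so its chosen neighbour lies in Y and is
            therefore heavy; the inner loop does find it.\<close>
          have "G ?x \<inter> (S \<union> Y) \<inter> X \<noteq> {}" using p YX(1) z by (auto simp: f)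
          then show ?thesis
            unfolding add.assoc
            apply (intro fin[where Z = "Y"])
            using m0 skip p
                 apply (simp_all add: keeps_def f)
            done
        qed
        done
      apply (rule wp_skip, rule wp_seq_Cons, rule wp_incr)
        apply (simp_all add: f)[2]
      apply (rule wp_seq_Nil)
      unfolding add.assoc
      apply (rule fin[where Z = "Y"])
      using Y skip
           apply (simp_all add: keeps_def f)
      apply blast
      done
  next
    case (2 \<tau> \<rho>' M')
    then obtain Y where Y: "marks (S \<union> Y) M'" "J Y ?l" by (auto simp: I_def)
    have "mis G (S \<union> Y)"
      unfolding mis_def
    proof (intro conjI allI impI)
      show "\<forall>u\<in>S \<union> Y. G u \<inter> (S \<union> Y) = {}" using Y(2) by (simp add: J_def)
      fix v assume v: "v < n" "v \<notin> S \<union> Y"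
      show "G v \<inter> (S \<union> Y) \<noteq> {}"
      proof (cases "v \<in> X")
        case True
        moreover have "\<forall>v\<in>X. v \<notin> Y \<longrightarrow> G v \<inter> (S \<union> Y) \<noteq> {}" using Y(2)[unfolded J_def im] by (elim conjE)
        ultimately show ?thesis using v(2) by simp
      next
        case False
        then have "G v \<inter> S \<noteq> {}" using v k unfolding no_lack_def XD by auto
        then show ?thesis by blast
      qed
    qed
    moreover have "Y \<subseteq> X" using Y(2)[unfolded J_def im] by (elim conjE)
    ultimately show ?case
      using 2 X(2) Y(1)
      apply (intro conjI)
        apply (simp)
       apply (simp add: I_def keeps_def)
      apply (rule wp_seq_Nil)
      apply (intro conjI exI[of _ Y])
           apply (simp_all add: I_def keeps_def)
      done
  next
    case 3
    have "J {} 0" using e C(2) unfolding J_def no_excess_def by auto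
    then show ?case using c unfolding I_def core_def
      by (auto simp: keeps_def intro!: exI[of _ "{}"])
  qed
qed

end

section \<open>Change of the threshold\<close>

text \<open>The ceiling of m^(2/3), but at least 1, so that an isolated vertex is light even if m =
  0.\<close>

definition threshold :: "nat \<Rightarrow> nat" where
  "threshold m = (LEAST d. 0 < d \<and> m * m \<le> d * d * d)"

lemma threshold_exists: "0 < Suc m \<and> m * m \<le> Suc m * Suc m * Suc m"
  by (simp add: algebra_simps)

lemma threshold_pos: "0 < threshold m"
  and threshold_ge: "m * m \<le> threshold m * threshold m * threshold m"
  using LeastI[of "\<lambda>d. 0 < d \<and> m * m \<le> d * d * d", OF threshold_exists]
  unfolding threshold_def by auto

lemma threshold_le: "0 < d \<Longrightarrow> m * m \<le> d * d * d \<Longrightarrow> threshold m \<le> d"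
  unfolding threshold_def by (rule Least_le) simp

lemma threshold_le_Suc: "threshold m \<le> Suc m"
  by (rule threshold_le) (use threshold_exists[of m] in auto)

text \<open>Linear search for the threshold is affordable, since it takes as many rounds as the
  threshold is large. The touched list is compacted in place and sheds its isolated vertices, which
  brings its length down to at most 2 m.\<close>

definition rebuild :: com where
  "rebuild = seq
    [assign ''D'' (N 1),
     while (Lt (Times (Times (V ''D'') (V ''D'')) (V ''D'')) (Times (V ''m'') (V ''m'')))
       (incr ''D''),
     assign ''k'' (Plus (Half (V ''m'')) (N 1)),
     assign ''h'' (N 0), assign ''p'' (N 0), assign ''q'' (N 0),
     while (Lt (V ''p'') (V ''t''))
       (seq
         [assign ''x'' (touched (V ''p'')),
          ite (Eql (deg (V ''x'')) (N 0))
            (store (N 3) (V ''x'') (N 0))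
            (seq [store (N 4) (V ''q'') (V ''x''), incr ''q'']),
          settle, incr ''p'']),
     assign ''t'' (V ''q'')]"

context ram
begin

lemma wp_threshold:
  assumes m: "\<rho> ''m'' = m" "m \<le> n * n" and D: "\<rho> ''D'' = 1"
  shows "wp (while (Lt (Times (Times (V ''D'') (V ''D'')) (V ''D'')) (Times (V ''m'') (V ''m'')))
       (incr ''D'')) (\<lambda>t \<rho>' M'. t \<le> 20 * threshold m \<and> \<rho>' = \<rho>(''D'' := threshold m) \<and> M' = M) \<rho> M"
proof -
  \<comment> \<open>The search never exceeds the threshold, which is at most n^2 + 1 and hence at
    most (n + 2)^2.\<close>
  have bound: "d * d * d < 2 ^ w" "d < 2 ^ w" if "d \<le> threshold m" for d
  proof -
    have "d \<le> Suc (n * n)" using that threshold_le_Suc[of m] m(2) by simp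
    also have "\<dots> \<le> (n + 2) ^ 2" by (simp add: power2_eq_square)
    finally have d: "d \<le> (n + 2) ^ 2" .
    then have "d * d * d \<le> (n + 2) ^ 2 * (n + 2) ^ 2 * (n + 2) ^ 2" by (intro mult_mono) auto
    also have "\<dots> = (n + 2) ^ 6" by (simp flip: power_add)
    finally have "d * d * d \<le> (n + 2) ^ 6" .
    moreover have "(n + 2) ^ 6 < (n + 2) ^ 10" by (rule power_strict_increasing) auto
    ultimately show "d * d * d < 2 ^ w" by (intro word_bound) linarith
    have "(n + 2) ^ 2 < (n + 2) ^ 10" by (rule power_strict_increasing) auto
    with d show "d < 2 ^ w" by (intro word_bound) linarith
  qed
  have square: "d * d < 2 ^ w" if "d \<le> threshold m" for d
  proof (cases "d = 0")
    case False
    then have "d * d \<le> d * d * d" by simp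
    then show ?thesis using bound(1)[OF that] by linarith
  qed simp
  have "m * m \<le> n * n * (n * n)" using m(2) by (intro mult_mono) auto
  also have "\<dots> = n ^ 4" by (simp add: eval_nat_numeral)
  also have "\<dots> \<le> (n + 2) ^ 4" by (rule power_mono) auto
  also have "\<dots> < (n + 2) ^ 10" by (rule power_strict_increasing) auto
  finally have mm: "m * m < 2 ^ w" by (rule word_bound)
  have lt: "d * d * d < m * m" if "0 < d" "d < threshold m" for d
    using threshold_le[OF that(1), of m] that(2) by linarith
  \<comment> \<open>The search starts at D = 1, so it ends after one round fewer than the
    threshold.\<close>
  define I where "I k \<tau> \<rho>' M' \<longleftrightarrow> \<tau> \<le> 20 * k \<and> \<rho>' = \<rho>(''D'' := Suc k) \<and> M' = M"
    for k \<tau> :: nat and \<rho>' and M' :: rows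
  show ?thesis
  proof (rule wp_while[where I = I and l = "threshold m - 1"], goal_cases)
    case (1 k \<tau> \<rho>' M')
    then have k: "Suc k < threshold m" "Suc k \<le> threshold m" "Suc (Suc k) \<le> threshold m" by simp_all
    show ?case
      using 1 bound(1)[OF k(2)] square[OF k(2)] bound(2)[OF k(3)] mm lt[of "Suc k"] k(1) m(1)
      apply (intro conjI)
        apply (simp add: I_def)
       apply (simp add: I_def)
      apply (rule wp_incr)
        apply (simp_all add: I_def)
      done
  next
    case (2 \<tau> \<rho>' M')
    have s: "Suc (threshold m - 1) = threshold m" using threshold_pos[of m] by simp
    from 2 have \<rho>': "\<rho>' = \<rho>(''D'' := threshold m)" "M' = M" "\<tau> \<le> 20 * (threshold m - 1)"
      unfolding I_def s by blast+
    show ?case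
      using \<rho>' bound(1)[of "threshold m"] square[of "threshold m"] mm threshold_ge[of m] threshold_pos[of m] m(1)
      by (simp add: not_less)
  next
    case 3
    then show ?case using D by (simp add: I_def fun_eq_iff)
  qed
qed

text \<open>S may be wrong for the new threshold at every touched vertex, so all of K is an
  exception at first and is settled once. Vertices outside K are isolated members of S and stay
  correct because D is positive.\<close>

lemma wp_rebuild:
  assumes g: "graph G" and c: "core G S M"
    and K: "touched_list K M" "\<rho> ''t'' = card K" "\<And>v. G v \<noteq> {} \<Longrightarrow> v \<in> K" "{..<n} - K \<subseteq> S"
    and m: "\<rho> ''m'' = m" "m \<le> n * n" and D: "D = threshold m"
    and E: "\<And>v. v \<in> S \<Longrightarrow> card (G v) \<le> E"
  shows "wp rebuild (\<lambda>t \<rho>' M'.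
    keeps {''D'', ''k'', ''h'', ''t'', ''p'', ''q'', ''x'', ''i'', ''a'', ''j''} \<rho> \<rho>' \<and>
    \<rho>' ''D'' = D \<and> \<rho>' ''k'' = m div 2 + 1 \<and>
    touched_list {v. G v \<noteq> {}} M' \<and> \<rho>' ''t'' = card {v. G v \<noteq> {}} \<and>
    heavy_list {v. v < n \<and> D \<le> card (G v)} M' \<and> \<rho>' ''h'' = card {v. v < n \<and> D \<le> card (G v)} \<and>
    (\<exists>S'. core G S' M' \<and> no_excess G S' D {} \<and> no_lack G S' D {} \<and>
      t + potential D S' \<le> potential D S + card K * (250 * D + 200 * E + 500) + 20 * D + 100)) \<rho> M"
proof -
  let ?l = "card K" and ?P = "\<lambda>k. M 4 ` {..<k}"
  \<comment> \<open>Members have degree at most E if old and below D if new, so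
    \<open>settle\<close> costs 50 * D + 200 * (E + D) + 300; the other 200 are for the rest of the
    round.\<close>
  let ?c = "250 * D + 200 * E + 500"
  have Kn: "K \<subseteq> {..<n}" and im: "?P ?l = K" and inj: "inj_on (M 4) {..<?l}"
    using K(1) by (auto simp: touched_list_def bij_betw_def)
  have l: "?l \<le> n" using card_le_n[OF Kn] .
  have D0: "0 < D" using threshold_pos D by simp
  have m1: "Suc (m div 2) < 2 ^ w"
  proof -
    have "Suc (n * n) < (n + 2) ^ 2" by (simp add: power2_eq_square)
    also have "\<dots> < (n + 2) ^ 10" by (rule power_strict_increasing) auto
    finally have "Suc (n * n) < 2 ^ w" by (rule word_bound)
    then show ?thesis using m(2) by linarith
  qed
  have e0: "no_excess G S D K" 
  proof -
    have "G v = {}" if "v \<in> S - K" for v using K(3)[of v] that by auto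
    then show ?thesis using D0 unfolding no_excess_def by auto
  qed
  have k0: "no_lack G S D K" using K(4) unfolding no_lack_def by blast
  define I where "I k \<tau> \<rho>' M' \<longleftrightarrow>
    keeps {''D'', ''k'', ''h'', ''p'', ''q'', ''x'', ''i'', ''a'', ''j''} \<rho> \<rho>' \<and>
    \<rho>' ''D'' = D \<and> \<rho>' ''k'' = m div 2 + 1 \<and> \<rho>' ''p'' = k \<and> \<rho>' ''q'' \<le> k \<and>
    bij_betw (M' 4) {..<\<rho>' ''q''} {v \<in> ?P k. G v \<noteq> {}} \<and> (\<forall>i\<ge>k. M' 4 i = M 4 i) \<and>
    (\<forall>v<n. M' 3 v = 0 \<longleftrightarrow> v \<notin> K \<or> v \<in> ?P k \<and> G v = {}) \<and>
    bij_betw (M' 5) {..<\<rho>' ''h''} {v \<in> ?P k. D \<le> card (G v)} \<and>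
    (\<exists>S'. core G S' M' \<and> S' \<subseteq> S \<union> {v. card (G v) < D} \<and> no_excess G S' D (K - ?P k) \<and>
      no_lack G S' D (K - ?P k) \<and> \<tau> + potential D S' \<le> potential D S + k * ?c)"
    for k \<tau> :: nat and \<rho>' M'
  have loop: "wp (while (Lt (V ''p'') (V ''t''))
       (seq
         [assign ''x'' (touched (V ''p'')),
          ite (Eql (deg (V ''x'')) (N 0))
            (store (N 3) (V ''x'') (N 0))
            (seq [store (N 4) (V ''q'') (V ''x''), incr ''q'']),
          settle, incr ''p'']))
      (\<lambda>t \<rho>' M'. \<exists>\<tau>. I ?l \<tau> \<rho>' M' \<and> t \<le> \<tau> + 10)
      (\<rho>(''D'' := D, ''k'' := Suc (m div 2), ''h'' := 0, ''p'' := 0, ''q'' := 0)) M"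
  proof (rule wp_while[where I = I and l = ?l], goal_cases)
    case (1 k \<tau> \<rho>' M')
    let ?x = "M 4 k"
    have I: "keeps {''D'', ''k'', ''h'', ''p'', ''q'', ''x'', ''i'', ''a'', ''j''} \<rho> \<rho>'"
      "\<rho>' ''D'' = D" "\<rho>' ''k'' = m div 2 + 1" "\<rho>' ''p'' = k" "\<rho>' ''q'' \<le> k"
      "bij_betw (M' 4) {..<\<rho>' ''q''} {v \<in> ?P k. G v \<noteq> {}}" "\<forall>i\<ge>k. M' 4 i = M 4 i"
      "\<forall>v<n. M' 3 v = 0 \<longleftrightarrow> v \<notin> K \<or> v \<in> ?P k \<and> G v = {}"
      "bij_betw (M' 5) {..<\<rho>' ''h''} {v \<in> ?P k. D \<le> card (G v)}"
      using 1(2) by (simp_all add: I_def)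
    obtain S' where S': "core G S' M'" "S' \<subseteq> S \<union> {v. card (G v) < D}" "no_excess G S' D (K - ?P k)"
      "no_lack G S' D (K - ?P k)" "\<tau> + potential D S' \<le> potential D S + k * ?c"
      using 1(2) unfolding I_def by blast
    have x: "?x < n" "k < n" "?x \<notin> ?P k" "?x \<in> K" "\<rho>' ''q'' < n" "Suc k < 2 ^ w" "Suc (\<rho>' ''q'') < 2 ^ w"
    proof -
      show "?x \<in> K" using 1(1) im by blast
      then show "?x < n" using Kn by auto
      show "?x \<notin> ?P k" using inj_on_image_mem_iff[OF inj, of k "{..<k}"] 1(1) by auto
      show "k < n" "\<rho>' ''q'' < n" "Suc k < 2 ^ w" "Suc (\<rho>' ''q'') < 2 ^ w"
        using 1(1) l I(5) word_linear by linarith+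
    qed
    have P: "?P (Suc k) = insert ?x (?P k)" by (simp add: lessThan_Suc)
    have dg: "M' 2 ?x = card (G ?x)" using adjacencyD(2)[OF coreD(1)[OF S'(1)] x(1)] .
    have iso: "card (G ?x) = 0 \<longleftrightarrow> G ?x = {}" using graphD(4)[OF g] by simp
    have h: "\<rho>' ''h'' < n"
    proof -
      have "\<rho>' ''h'' = card {v \<in> ?P k. D \<le> card (G v)}" using bij_betw_same_card[OF I(9)] by simp
      also have "\<dots> \<le> card (?P k)" by (rule card_mono) auto
      also have "\<dots> \<le> k" using card_image_le[of "{..<k}" "M 4"] by simp
      finally show ?thesis using x(2) by simp
    qed
    have heavy_snoc: "bij_betw ((M' 5)(\<rho>' ''h'' := ?x)) {..<Suc (\<rho>' ''h'')} {v \<in> ?P (Suc k). D \<le> card (G v)}"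
      if "D \<le> card (G ?x)"
    proof -
      have "{v \<in> ?P (Suc k). D \<le> card (G v)} = insert ?x {v \<in> ?P k. D \<le> card (G v)}" using that P by auto
      then show ?thesis using bij_betw_snoc[OF I(9), of ?x] x(3) by simp
    qed
    have heavy_same: "{v \<in> ?P (Suc k). D \<le> card (G v)} = {v \<in> ?P k. D \<le> card (G v)}"
      if "\<not> D \<le> card (G ?x)" using that P by auto
    have after: "wp settle (\<lambda>t. wp (seq [incr ''p'']) (\<lambda>u. I (Suc k) (f t u))) \<rho>1 M1"
      if \<rho>1: "keeps {''q'', ''x''} \<rho>' \<rho>1" "\<rho>1 ''x'' = ?x" "\<rho>1 ''q'' \<le> Suc k"
        and M1: "bij_betw (M1 4) {..<\<rho>1 ''q''} {v \<in> ?P (Suc k). G v \<noteq> {}}" "\<forall>i\<ge>Suc k. M1 4 i = M 4 i"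
          "\<forall>v<n. M1 3 v = 0 \<longleftrightarrow> v \<notin> K \<or> v \<in> ?P (Suc k) \<and> G v = {}"
          "\<And>r. r \<noteq> 3 \<Longrightarrow> r \<noteq> 4 \<Longrightarrow> M1 r = M' r"
        and f: "\<And>t u. f t u \<le> \<tau> + t + u + 100" for \<rho>1 M1 f
    proof -
      have core1: "core G S' M1" using S'(1) by (rule core_cong) (rule M1(4), auto)
      have E': "card (G ?x) \<le> E + D" if "?x \<in> S'" using that S'(2) E by fastforce
      have D1: "\<rho>1 ''D'' = D" "\<rho>1 ''h'' = \<rho>' ''h''" using \<rho>1(1) I(2) by (auto simp: keeps_def)
      show ?thesis
        apply (rule wp_mono[OF wp_settle[OF g core1 \<rho>1(2) x(1) D1(1) S'(3,4) E']])
          apply assumption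
         apply (simp add: D1(2) h)
        apply (elim conjE exE)
        subgoal premises p for t \<rho>2 M2 S2
        proof -
          have p2: "\<rho>2 ''p'' = k" "\<rho>2 ''q'' = \<rho>1 ''q''" "\<rho>2 ''D'' = D" "\<rho>2 ''k'' = m div 2 + 1"
            using p(1) \<rho>1(1) I(2,3,4) by (auto simp: keeps_def)
          have rows: "M2 3 = M1 3" "M2 4 = M1 4" using p(4) by simp_all
          have hv: "bij_betw (M2 5) {..<\<rho>2 ''h''} {v \<in> ?P (Suc k). D \<le> card (G v)}"
            using heavy_snoc heavy_same I(9) p(2,3) M1(4)[of 5] D1(2) by (cases "D \<le> card (G ?x)") simp_all
          have kp: "keeps {''D'', ''k'', ''h'', ''p'', ''q'', ''x'', ''i'', ''a'', ''j''} \<rho> (\<rho>2(''p'' := Suc k))"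
            using p(1) \<rho>1(1) I(1) by (simp add: keeps_def)
          have B: "K - ?P k - {?x} = K - ?P (Suc k)" using P by blast
          have sub: "S2 \<subseteq> S \<union> {v. card (G v) < D}" using p(6) S'(2) by blast
          have time: "f t 5 + potential D S2 \<le> potential D S + Suc k * ?c"
            using p(9) S'(5) f[of t 5] by (simp add: algebra_simps)
          show ?thesis
            apply (rule wp_seq_Cons, rule wp_incr)
              apply (simp_all add: p2 x)[2]
            apply (rule wp_seq_Nil)
            unfolding I_def
            apply (intro conjI exI[of _ S2])
            using kp hv sub time p(5,7,8) \<rho>1(3) M1(1,2,3) by (simp_all add: p2 rows B)
        qed
        done
    qed
    have t1: "bij_betw ((M' 4)(\<rho>' ''q'' := ?x)) {..<Suc (\<rho>' ''q'')} {v \<in> ?P (Suc k). G v \<noteq> {}}" if "G ?x \<noteq> {}"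
    proof -
      have "{v \<in> ?P (Suc k). G v \<noteq> {}} = insert ?x {v \<in> ?P k. G v \<noteq> {}}" using that P by auto
      then show ?thesis using bij_betw_snoc[OF I(6), of ?x] x(3) by simp
    qed
    have t2: "{v \<in> ?P (Suc k). G v \<noteq> {}} = {v \<in> ?P k. G v \<noteq> {}}" if "G ?x = {}" using that P by auto
    have r: "\<rho>' ''t'' = ?l" "M' 4 k = ?x" using I(1,7) K(2) by (auto simp: keeps_def)
    note f = r x I(4) dg iso 1(1)
    show ?case
      apply (intro conjI)
        apply (simp add: f)
       apply (simp add: f)
      apply (rule wp_seq_Cons, rule wp_assign, simp, simp add: f, simp only: aval.simps f)
      apply (rule wp_seq_Cons, rule wp_ite, simp add: f)
       apply (rule wp_store)
            apply (simp_all add: f)[5]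
       apply (rule wp_seq_Cons, rule after)
              apply (simp_all add: keeps_def t2 f)
      subgoal using I(5) by simp
      subgoal using I(6) t2 by simp
      subgoal using I(7) by simp
      subgoal using I(8) x(4) P by auto
      apply (rule wp_seq_Cons, rule wp_store)
           apply (simp_all add: f)[5]
      apply (rule wp_seq_Cons, rule wp_incr)
        apply (simp_all add: f)[2]
      apply (rule wp_seq_Nil)
      apply (rule wp_seq_Cons, rule after)
             apply (simp_all add: keeps_def f)
      subgoal using I(5) by simp
      subgoal using t1 by simp
      subgoal using I(5,7) by simp
      subgoal using I(8) x(4) P by auto
      done
  next
    case (2 \<tau> \<rho>' M')
    then have "\<rho>' ''t'' = ?l" "\<rho>' ''p'' = ?l" using K(2) by (simp_all add: I_def keeps_def)
    then show ?case using 2 by auto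
  next
    case 3
    have "\<forall>v<n. M 3 v = 0 \<longleftrightarrow> v \<notin> K" using K(1) by (simp add: touched_list_def)
    then show ?case
      unfolding I_def
      apply (intro conjI exI[of _ S])
      using c e0 k0 by (simp_all add: keeps_def bij_betw_def)
  qed
  have st: "\<rho>(''D'' := 1, ''D'' := threshold m, ''k'' := (\<rho>(''D'' := 1, ''D'' := threshold m)) ''m'' div 2 + 1,
      ''h'' := 0, ''p'' := 0, ''q'' := 0) =
    \<rho>(''D'' := D, ''k'' := Suc (m div 2), ''h'' := 0, ''p'' := 0, ''q'' := 0)"
    by (simp add: m D)
  have T: "{v \<in> K. G v \<noteq> {}} = {v. G v \<noteq> {}}" using K(3) by blast
  have H: "{v \<in> K. D \<le> card (G v)} = {v. v < n \<and> D \<le> card (G v)}"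
  proof -
    have "v \<in> K" if "D \<le> card (G v)" for v using that D0 K(3)[of v] by (cases "G v = {}") auto
    then show ?thesis using Kn by auto
  qed
  show ?thesis
    unfolding rebuild_def
    apply (rule wp_seq_Cons, rule wp_assign, simp, simp, simp only: aval.simps)
    apply (rule wp_seq_Cons, rule wp_mono[OF wp_threshold[where m = m]])
       apply (simp_all add: m)[3]
    apply (elim conjE, hypsubst)
    apply ((rule wp_seq_Cons, rule wp_assign, simp, simp add: m m1, simp only: aval.simps)+)
    apply (unfold st)
    apply (rule wp_seq_Cons, rule wp_mono)
     apply (rule loop)
    apply (elim exE conjE)
    subgoal premises p for t0 _ _ t \<rho>' M' \<tau>
    proof -
      have I: "keeps {''D'', ''k'', ''h'', ''p'', ''q'', ''x'', ''i'', ''a'', ''j''} \<rho> \<rho>'"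
        "\<rho>' ''D'' = D" "\<rho>' ''k'' = m div 2 + 1"
        "bij_betw (M' 4) {..<\<rho>' ''q''} {v. G v \<noteq> {}}"
        "\<forall>v<n. M' 3 v = 0 \<longleftrightarrow> v \<notin> K \<or> v \<in> K \<and> G v = {}"
        "bij_betw (M' 5) {..<\<rho>' ''h''} {v. v < n \<and> D \<le> card (G v)}"
        using p(2) unfolding I_def im T H by blast+
      obtain S' where S': "core G S' M'" "no_excess G S' D {}" "no_lack G S' D {}"
        "\<tau> + potential D S' \<le> potential D S + ?l * ?c"
        using p(2) unfolding I_def im Diff_cancel by blast
      have q: "\<rho>' ''q'' = card {v. G v \<noteq> {}}" using bij_betw_same_card[OF I(4)] by simp
      have h: "\<rho>' ''h'' = card {v. v < n \<and> D \<le> card (G v)}" using bij_betw_same_card[OF I(6)] by simp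
      have tl: "touched_list {v. G v \<noteq> {}} M'"
        using I(4,5) K(3) Kn unfolding q touched_list_def by blast
      have hl: "heavy_list {v. v < n \<and> D \<le> card (G v)} M'" using I(6) unfolding h heavy_list_def by auto
      have k: "keeps {''D'', ''k'', ''h'', ''t'', ''p'', ''q'', ''x'', ''i'', ''a'', ''j''} \<rho> (\<rho>'(''t'' := \<rho>' ''q''))"
        using I(1) by (simp add: keeps_def)
      show ?thesis
        apply (rule wp_seq_Cons, rule wp_assign, simp, simp, simp only: aval.simps)
        apply (rule wp_seq_Nil)
        apply (intro conjI exI[of _ S'] k tl hl S'(1,2,3))
        using I(2,3) q h p(1,3) S'(4) by (simp_all add: D)
    qed
    done
qed

end

section \<open>The state invariant and its potential\<close>

text \<open>A rebuild precedes \<open>greedy\<close>, which has to work with the heavy list of the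
  new threshold.\<close>

definition finish :: com where
  "finish = seq
    [assign ''x'' (V ''u''), settle, assign ''x'' (V ''v''), settle,
     assign ''k'' (Minus (V ''k'') (N 1)),
     ite (Eql (V ''k'') (N 0)) rebuild Skip, greedy]"

text \<open>For mc >= 1 the hypothesis gives m <= 5/2 * mc, and (5/2)^2 < 2^3. Compares a new
  threshold with the one that it replaces.\<close>

lemma threshold_double:
  assumes "m \<le> mc + (mc div 2 + 1)"
  shows "threshold m \<le> 2 * threshold mc"
proof (rule threshold_le)
  let ?d = "threshold mc"
  show "0 < 2 * ?d" using threshold_pos by simp
  have d: "1 \<le> ?d * ?d * ?d" using threshold_pos[of mc] by (simp add: Suc_le_eq)
  have "m * m \<le> 8 * (?d * ?d * ?d)"
  proof (cases "mc = 0")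
    case True
    then have "m \<le> 1" using assms by simp
    then have "m * m \<le> 1" by (cases m) auto
    then show ?thesis using d by linarith
  next
    case False
    then have "1 \<le> mc" by simp
    moreover have "2 * (mc div 2) \<le> mc" by simp
    ultimately have "2 * m \<le> 5 * mc" using assms by linarith
    from mult_le_mono[OF this this] have "(2 * m) * (2 * m) \<le> (5 * mc) * (5 * mc)" .
    then have "4 * (m * m) \<le> 25 * (mc * mc)" by (simp add: algebra_simps)
    then have "m * m \<le> 8 * (mc * mc)" by linarith
    also have "\<dots> \<le> 8 * (?d * ?d * ?d)" using threshold_ge[of mc] by simp
    finally show ?thesis by linarith
  qed
  then show "m * m \<le> 2 * ?d * (2 * ?d) * (2 * ?d)" by simp
qed

text \<open>For m >= 1 the hypothesis gives mc <= 4 * m, and 4^2 < 3^3. The budget is charged with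
  the current number of edges, which may have fallen since the threshold was computed.\<close>

lemma threshold_triple:
  assumes "mc \<le> m + (mc div 2 + 1)"
  shows "threshold mc \<le> 3 * threshold m"
proof (rule threshold_le)
  let ?d = "threshold m"
  show "0 < 3 * ?d" using threshold_pos by simp
  have d: "1 \<le> ?d * ?d * ?d" using threshold_pos[of m] by (simp add: Suc_le_eq)
  have mc: "mc \<le> 2 * m + 2" using assms by linarith
  have "mc * mc \<le> 27 * (?d * ?d * ?d)"
  proof (cases "m = 0")
    case True
    then have "mc * mc \<le> 2 * 2" using mc by (intro mult_mono) auto
    then show ?thesis using d by linarith
  next
    case False
    then have "mc \<le> 4 * m" using mc by simp
    from mult_le_mono[OF this this] have "mc * mc \<le> (4 * m) * (4 * m)" .
    then have "mc * mc \<le> 16 * (m * m)" by (simp add: algebra_simps)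
    also have "\<dots> \<le> 16 * (?d * ?d * ?d)" using threshold_ge[of m] by simp
    finally show ?thesis by linarith
  qed
  then show "mc * mc \<le> 3 * ?d * (3 * ?d) * (3 * ?d)" by simp
qed

text \<open>Squaring c * D <= 5 * mc and using mc^2 <= D^3 gives c^2 * D^2 <= 25 * D^3. The
  quadratic bound pays for the pair tests, the linear one for single passes over the heavy
  list.\<close>

lemma heavy_few:
  assumes "c * threshold mc \<le> 2 * m" "m \<le> mc + (mc div 2 + 1)"
  shows "c * c \<le> 25 * threshold mc" "c \<le> 25 * threshold mc"
proof -
  let ?d = "threshold mc"
  have d0: "0 < ?d" by (rule threshold_pos)
  have d: "1 \<le> ?d * ?d * ?d" using d0 by (simp add: Suc_le_eq)
  have le: "c * ?d \<le> 3 * mc + 2" using assms by linarith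
  have "(c * ?d) * (c * ?d) \<le> 25 * (?d * ?d * ?d)"
  proof (cases "mc = 0")
    case True
    then have "(c * ?d) * (c * ?d) \<le> 2 * 2" using le by (intro mult_mono) auto
    then show ?thesis using d by linarith
  next
    case False
    then have "c * ?d \<le> 5 * mc" using le by simp
    from mult_le_mono[OF this this] have "(c * ?d) * (c * ?d) \<le> (5 * mc) * (5 * mc)" .
    also have "\<dots> = 25 * (mc * mc)" by (simp add: algebra_simps)
    also have "\<dots> \<le> 25 * (?d * ?d * ?d)" using threshold_ge[of mc] by simp
    finally show ?thesis .
  qed
  then have "(c * c) * (?d * ?d) \<le> (25 * ?d) * (?d * ?d)" by (simp add: algebra_simps)
  then show *: "c * c \<le> 25 * ?d" using d0 by simp
  have "c \<le> c * c" by simp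
  then show "c \<le> 25 * ?d" using * by linarith
qed

context ram
begin

definition heavies :: "(nat \<Rightarrow> nat set) \<Rightarrow> nat \<Rightarrow> nat set" where
  "heavies G D = {v. v < n \<and> D \<le> card (G v)}"

text \<open>\<open>mc\<close> is the number of edges at the beginning of the current phase and \<open>el\<close> the number of
  updates since then; \<open>S\<close> is the maximal independent set of the light vertices, \<open>Y\<close> the heavy
  vertices added to it and \<open>\<psi>\<close> the credit saved so far.\<close>

definition state_inv :: "(nat \<Rightarrow> nat set) \<Rightarrow> nat \<Rightarrow> nat \<Rightarrow> regs \<Rightarrow> rows \<Rightarrow> bool" where
  "state_inv G m \<psi> \<rho> M \<longleftrightarrow> graph G \<and> \<rho> ''n'' = n \<and> \<rho> ''m'' = m \<and> (\<exists>S Y K mc el D.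
     D = threshold mc \<and> \<rho> ''D'' = D \<and>
     adjacency G M \<and> counts G S M \<and> S \<subseteq> {..<n} \<and> Y \<subseteq> heavies G D \<and>
     marks (S \<union> Y) M \<and> mis G (S \<union> Y) \<and> no_excess G S D {} \<and> no_lack G S D {} \<and>
     heavy_list (heavies G D) M \<and> \<rho> ''h'' = card (heavies G D) \<and>
     touched_list K M \<and> \<rho> ''t'' = card K \<and> (\<forall>v. G v \<noteq> {} \<longrightarrow> v \<in> K) \<and>
     \<rho> ''k'' + el = mc div 2 + 1 \<and> 0 < \<rho> ''k'' \<and>
     card K \<le> 2 * mc + 2 * el \<and> m \<le> mc + el \<and> mc \<le> m + el \<and>
     \<psi> = potential D S + 8000 * D * el)"

text \<open>Ordered pairs avoid the factor 2 of the handshake lemma: first components cover the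
  non-isolated vertices, and the degrees of heavy vertices count disjoint sets of pairs.\<close>

lemma card_arcs:
  assumes "graph G"
  shows "finite {(a, b). b \<in> G a}"
    "card {v. G v \<noteq> {}} \<le> card {(a, b). b \<in> G a}"
    "card (heavies G D) * D \<le> card {(a, b). b \<in> G a}"
proof -
  have "{(a, b). b \<in> G a} \<subseteq> {..<n} \<times> {..<n}" using graphD(5,6)[OF assms] by auto
  then show fin: "finite {(a, b). b \<in> G a}" by (rule finite_subset) simp
  have "{v. G v \<noteq> {}} \<subseteq> fst ` {(a, b). b \<in> G a}" by force
  then show "card {v. G v \<noteq> {}} \<le> card {(a, b). b \<in> G a}"
    using fin by (meson card_image_le card_mono finite_imageI le_trans)
  have "card (heavies G D) * D \<le> (\<Sum>v\<in>heavies G D. card (G v))"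
    using sum_bounded_below[of "heavies G D" D "\<lambda>v. card (G v)"] by (simp add: heavies_def)
  also have "\<dots> = card (Sigma (heavies G D) G)"
    using graphD(4)[OF assms] by (simp add: heavies_def)
  also have "\<dots> \<le> card {(a, b). b \<in> G a}"
    using fin by (rule card_mono) auto
  finally show "card (heavies G D) * D \<le> card {(a, b). b \<in> G a}" .
qed

lemma wp_settle_list:
  assumes g: "graph G" and c: "core G S M" and x: "\<rho> ''x'' = x" "x < n"
    and D: "\<rho> ''D'' = D"
    and e: "no_excess G S D B" and l: "no_lack G S D B'"
    and E: "x \<in> S \<Longrightarrow> card (G x) \<le> E"
    and h: "heavy_list X M" "\<rho> ''h'' = card X" "x \<notin> X"
  shows "wp settle (\<lambda>t \<rho>' M'. keeps {''i'', ''a'', ''j'', ''h''} \<rho> \<rho>' \<and>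
    heavy_list (X \<union> {x} \<inter> heavies G D) M' \<and> \<rho>' ''h'' = card (X \<union> {x} \<inter> heavies G D) \<and>
    M' 3 = M 3 \<and> M' 4 = M 4 \<and>
    (\<exists>S'. core G S' M' \<and> S' \<subseteq> S \<union> {v. card (G v) < D} \<and> no_excess G S' D (B - {x}) \<and>
      no_lack G S' D (B' - {x}) \<and>
      t + potential D S' \<le> potential D S + 50 * D + 200 * E + 300)) \<rho> M"
proof -
  have X: "X \<subseteq> {..<n}" "finite X" using h(1) finite_subset[of X "{..<n}"] by (auto simp: heavy_list_def)
  have "card X < n" using psubset_card_mono[of "{..<n}" X] X(1) h(3) x(2) by auto
  then have hn: "\<rho> ''h'' < n" using h(2) by simp
  show ?thesis
    apply (rule wp_mono[OF wp_settle[OF g c x D e l E hn]])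
     apply assumption
    apply (elim conjE exE)
    subgoal premises p for t \<rho>' M' S'
    proof -
      have "heavy_list (X \<union> {x} \<inter> heavies G D) M' \<and> \<rho>' ''h'' = card (X \<union> {x} \<inter> heavies G D)"
      proof (cases "D \<le> card (G x)")
        case True
        then have X': "X \<union> {x} \<inter> heavies G D = insert x X" using x(2) by (auto simp: heavies_def)
        have "card (insert x X) = Suc (card X)" using X(2) h(3) by simp
        then show ?thesis
          using p(2,3) True h x(2) X(1) bij_betw_snoc[of "M 5" "card X" X x]
          unfolding X' heavy_list_def by simp
      next
        case False
        then have "X \<union> {x} \<inter> heavies G D = X" by (auto simp: heavies_def)
        then show ?thesis using p(2,3) False h by (simp add: heavy_list_def)
      qed
      then show ?thesis using p by (intro conjI exI[of _ S']) simp_all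
    qed
    done
qed

text \<open>At most 1100 * D goes to settling the endpoints and 13100 * D to \<open>greedy\<close>.
  A further 8000 * D is saved for the next rebuild or, if one is due, 7800 * D is spent on
  it.\<close>

lemma wp_finish:
  assumes g: "graph G" and c: "core G S M" and u: "\<rho> ''u'' = u" "\<rho> ''v'' = v" "u < n" "v < n" "u \<noteq> v"
    and r: "\<rho> ''n'' = n" "\<rho> ''m'' = m" "\<rho> ''D'' = D" and D: "D = threshold mc"
    and m: "card {(a, b). b \<in> G a} \<le> 2 * m" "m \<le> n * n"
    and e: "no_excess G S D {u, v}" and l: "no_lack G S D {u, v}"
    and E: "\<And>x. x \<in> S \<Longrightarrow> card (G x) \<le> D"
    and h: "heavy_list (heavies G D - {u, v}) M" "\<rho> ''h'' = card (heavies G D - {u, v})"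
    and K: "touched_list K M" "\<rho> ''t'' = card K" "\<And>v. G v \<noteq> {} \<Longrightarrow> v \<in> K"
    and num: "\<rho> ''k'' + el = mc div 2 + 1" "0 < \<rho> ''k''"
      "card K \<le> 2 * mc + 2 * Suc el" "m \<le> mc + Suc el" "mc \<le> m + Suc el"
  shows "wp finish (\<lambda>t \<rho>' M'. \<exists>\<psi>. state_inv G m \<psi> \<rho>' M' \<and>
    t + \<psi> \<le> potential D S + 8000 * D * el + 30000 * D) \<rho> M"
proof -
  let ?H = "heavies G D"
  have D0: "0 < D" using D threshold_pos by simp
  have el: "Suc el \<le> mc div 2 + 1" using num(1,2) by simp
  have D3: "threshold m \<le> 2 * D" unfolding D by (rule threshold_double) (use num(4) el in linarith)
  have m1: "\<rho> ''k'' < 2 ^ w" "Suc 0 \<le> \<rho> ''k''"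
  proof -
    have "mc \<le> 2 * m + 2" using num(5) el by linarith
    then have "\<rho> ''k'' \<le> n * n + 2" using num(1) m(2) by linarith
    also have "\<dots> < (n + 2) ^ 2" by (simp add: power2_eq_square)
    also have "\<dots> < (n + 2) ^ 10" by (rule power_strict_increasing) auto
    finally show "\<rho> ''k'' < 2 ^ w" by (rule word_bound)
    show "Suc 0 \<le> \<rho> ''k''" using num(2) by simp
  qed
  \<comment> \<open>Both c^2 and c are at most 25 * d for c heavy vertices, so the time is at most
    (60 + 200) * 25 * d + 20, and d <= 2 * D.\<close>
  have greedy_time: "card (heavies G d) * (60 * card (heavies G d) + 200) + 20 \<le> 13100 * D"
    if "d = threshold mc'" "m \<le> mc' + (mc' div 2 + 1)" "d \<le> 2 * D" for d mc'
  proof -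
    have "card (heavies G d) * d \<le> 2 * m" using card_arcs(3)[OF g, of d] m(1) by linarith
    from heavy_few[OF this[unfolded that(1)] that(2), folded that(1)] that(3)
    show ?thesis using D0 by (simp add: algebra_simps)
  qed
  \<comment> \<open>Common end of both branches: the parameters belong either to the running phase
    or to a new phase with \<open>el'\<close> = 0.\<close>
  have last: "wp greedy (\<lambda>t \<rho>' M'. \<exists>\<psi>. state_inv G m \<psi> \<rho>' M' \<and> t + \<psi> \<le> 13100 * D + (potential d S1 + 8000 * d * el')) \<rho>1 M1"
    if 1: "core G S1 M1" "no_excess G S1 d {}" "no_lack G S1 d {}"
      "heavy_list (heavies G d) M1" "\<rho>1 ''h'' = card (heavies G d)"
      "touched_list K1 M1" "\<rho>1 ''t'' = card K1" "\<And>v. G v \<noteq> {} \<Longrightarrow> v \<in> K1"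
      "\<rho>1 ''n'' = n" "\<rho>1 ''m'' = m" "\<rho>1 ''D'' = d" "d = threshold mc'" "d \<le> 2 * D"
      "\<rho>1 ''k'' + el' = mc' div 2 + 1" "0 < \<rho>1 ''k''"
      "card K1 \<le> 2 * mc' + 2 * el'" "m \<le> mc' + el'" "mc' \<le> m + el'"
    for S1 \<rho>1 M1 d K1 mc' el'
    apply (rule wp_mono[OF wp_greedy[OF g 1(1,2,3,4,5,9) heavies_def]])
    apply (elim conjE exE)
    subgoal premises p for t \<rho>' M' Y
    proof -
      have a: "adjacency G M'" using coreD(1)[OF 1(1)] by (rule adjacency_cong) (use p(3) in auto)
      have b: "counts G S1 M'" using 1(1) p(3) by (simp add: core_def counts_def)
      have c: "heavy_list (heavies G d) M'" using 1(4) p(3) by (simp add: heavy_list_def)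
      have d: "touched_list K1 M'" using 1(6) p(3) by (simp add: touched_list_def)
      have e: "\<rho>' ''n'' = n" "\<rho>' ''m'' = m" "\<rho>' ''D'' = d" "\<rho>' ''h'' = card (heavies G d)"
        "\<rho>' ''t'' = card K1" "\<rho>' ''k'' = \<rho>1 ''k''"
        using p(2) 1 by (simp_all add: keeps_def)
      have "state_inv G m (potential d S1 + 8000 * d * el') \<rho>' M'"
        unfolding state_inv_def
        apply (rule conjI[OF g], rule conjI[OF e(1)], rule conjI[OF e(2)])
        apply (rule exI[of _ S1], rule exI[of _ Y], rule exI[of _ K1], rule exI[of _ mc'],
          rule exI[of _ el'], rule exI[of _ d])
        using a b c d e 1(2,3,12,14-18) 1(8) p(4-6) coreD(2)[OF 1(1)] by simp
      moreover have "t \<le> 13100 * D" using p(1) greedy_time[OF 1(12) _ 1(13)] 1(14,17) by linarith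
      ultimately show ?thesis by (intro exI[of _ "potential d S1 + 8000 * d * el'"]) simp
    qed
    done
  have H1: "heavies G D - {u, v} \<union> {u} \<inter> heavies G D \<union> {v} \<inter> heavies G D = heavies G D" by blast
  show ?thesis
    unfolding finish_def
    apply (rule wp_seq_Cons, rule wp_assign, simp, simp, simp only: aval.simps)
    apply (rule wp_seq_Cons)
    apply (rule wp_mono[OF wp_settle_list[OF g c _ u(3) _ e l E h(1)]])
        apply (simp_all add: u r h)[5]
    apply (elim conjE exE)
    subgoal premises p for t \<rho>1 M1 S1
    proof -
      have \<rho>1: "\<rho>1 ''u'' = u" "\<rho>1 ''v'' = v" "\<rho>1 ''n'' = n" "\<rho>1 ''m'' = m" "\<rho>1 ''D'' = D"
        "\<rho>1 ''t'' = card K" "\<rho>1 ''k'' = \<rho> ''k''"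
        using p(1) u r K(2) by (simp_all add: keeps_def)
      have E1: "card (G x) \<le> D" if "x \<in> S1" for x using that p(7) E by fastforce
      have vB: "{u, v} - {u} - {v} = {}" by blast
      show ?thesis
        apply (rule wp_seq_Cons, rule wp_assign, simp, simp, simp only: aval.simps)
        apply (rule wp_seq_Cons)
        apply (rule wp_mono[OF wp_settle_list[OF g p(6) _ u(4) _ p(8,9) E1 p(2)]])
            apply (use u(5) in \<open>simp_all add: \<rho>1 p(3)\<close>)[5]
        apply (elim conjE exE)
        subgoal premises q for t2 \<rho>2 M2 S2
        proof -
          have \<rho>2: "\<rho>2 ''n'' = n" "\<rho>2 ''m'' = m" "\<rho>2 ''D'' = D"
            "\<rho>2 ''t'' = card K" "\<rho>2 ''k'' = \<rho> ''k''"
            using q(1) \<rho>1 by (simp_all add: keeps_def)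
          note hl = q(2,3)[unfolded H1]
          note ne = q(8,9)[unfolded vB]
          have E2: "card (G x) \<le> D" if "x \<in> S2" for x using that q(7) E1 by fastforce
          have tl: "touched_list K M2" using K(1) p(4,5) q(4,5) by (simp add: touched_list_def)
          have KS: "{..<n} - K \<subseteq> S2"
          proof
            fix x assume x: "x \<in> {..<n} - K"
            then have "G x = {}" using K(3) by blast
            then have "card (G x) < D" "G x \<inter> S2 = {}" using D0 by simp_all
            then show "x \<in> S2" using ne(2) x unfolding no_lack_def by blast
          qed
          let ?\<rho> = "\<rho>2(''k'' := \<rho>2 ''k'' - 1)"
          show ?thesis
            apply (rule wp_seq_Cons, rule wp_assign, simp)
             apply (simp add: \<rho>2 m1)
            apply (simp only: aval.simps)
            apply (rule wp_seq_Cons, rule wp_ite, simp)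
            subgoal premises k0
            proof -
              have el': "Suc el = mc div 2 + 1" using k0 num(1,2) \<rho>2 by simp
              \<comment> \<open>The phase is over, so mc <= 2 * Suc el: there are at most six
                touched vertices per update of the phase.\<close>
              have K6: "card K \<le> 6 * Suc el" 
              proof -
                have "mc \<le> 2 * (mc div 2) + 1" by presburger
                then have "mc \<le> 2 * Suc el" using el' by simp
                then show ?thesis using num(3) by simp
              qed
              \<comment> \<open>All untouched vertices are in S2, so the credit required by the new
                threshold is charged to touched vertices and n disappears.\<close>
              have "n - card S2 \<le> card K"
              proof -
                have "finite S2" using coreD(3)[OF q(6)] .
                have "{..<n} \<subseteq> K \<union> S2" using KS by blast
                then have "n \<le> card (K \<union> S2)"
                  using card_mono[of "K \<union> S2" "{..<n}"] \<open>finite S2\<close> K(1) finite_subset[of K "{..<n}"]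
                  by (simp add: touched_list_def)
                then show ?thesis using card_Un_le[of K S2] by linarith
              qed
              then have pot: "potential (threshold m) S2 \<le> 50 * (2 * D) * card K"
                unfolding potential_def using D3 by (intro mult_mono) auto
              have "card K * (250 * threshold m + 200 * D + 500) \<le> card K * (1200 * D)"
                using D3 D0 by (intro mult_left_mono) auto
              then have "potential (threshold m) S2 + card K * (250 * threshold m + 200 * D + 500)
                  \<le> 1300 * D * card K" using pot by (simp add: algebra_simps)
              also have "\<dots> \<le> 1300 * D * (6 * Suc el)" using K6 by (rule mult_left_mono) simp
              \<comment> \<open>1300 * D for each of at most six touched vertices per update: 7800 *
                D, which stays below the 8000 * D that every earlier update of the phase has
                saved.\<close>
              finally have cost: "potential (threshold m) S2 + card K * (250 * threshold m + 200 * D + 500)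
                  \<le> 7800 * D + 7800 * (D * el)" by (simp add: algebra_simps)
              have a: "\<And>x. x \<in> S2 \<Longrightarrow> card (G x) \<le> D" by (rule E2)
              show ?thesis
                apply (rule wp_mono)
                 apply (rule wp_rebuild[OF g q(6) tl _ K(3) KS _ m(2) refl a])
                     apply (simp_all add: \<rho>2)[4]
                apply (elim conjE exE)
                subgoal premises s for t3 \<rho>3 M3 S3
                proof -
                  have \<rho>3: "\<rho>3 ''n'' = n" "\<rho>3 ''m'' = m" using s(1) \<rho>2 by (simp_all add: keeps_def)
                  have c2: "card {v. G v \<noteq> {}} \<le> 2 * m" using card_arcs(2)[OF g] m(1) by linarith
                  have L: "wp greedy (\<lambda>t \<rho>' M'. \<exists>\<psi>. state_inv G m \<psi> \<rho>' M' \<and>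
                      t + \<psi> \<le> 13100 * D + (potential (threshold m) S3 + 8000 * threshold m * 0)) \<rho>3 M3"
                    by (rule last[OF s(8,9,10) s(6,7)[folded heavies_def] s(4,5) _ \<rho>3 s(2) refl D3])
                      (use s(3) c2 in auto)
                  show ?thesis
                    apply (rule wp_seq_Cons, rule wp_mono[OF L])
                    apply (elim exE conjE)
                    subgoal for t4 \<rho>4 M4 \<psi>
                      apply (rule wp_seq_Nil)
                      apply (rule exI[of _ \<psi>])
                      using s(11) cost p(10) q(10) D0 D3 by (simp add: algebra_simps)
                    done
                qed
                done
            qed
            subgoal premises k1
            proof -
              have L: "wp greedy (\<lambda>t \<rho>' M'. \<exists>\<psi>. state_inv G m \<psi> \<rho>' M' \<and>
                  t + \<psi> \<le> 13100 * D + (potential D S2 + 8000 * D * Suc el)) ?\<rho> M2"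
                apply (rule last[OF q(6) ne hl(1) _ tl _ K(3)])
                using k1 num D \<rho>2 hl(2) by simp_all
              show ?thesis
                apply (rule wp_skip, rule wp_seq_Cons, rule wp_mono[OF L])
                apply (elim exE conjE)
                subgoal for t4 \<rho>4 M4 \<psi>
                  apply (rule wp_seq_Nil)
                  apply (rule exI[of _ \<psi>])
                  using p(10) q(10) D0 by (simp add: algebra_simps)
                done
            qed
            done
        qed
        done
    qed
    done
qed

end

section \<open>Handling an update\<close>

definition on_insert :: com where
  "on_insert = seq
    [clear,
     assign ''a'' (V ''u''), assign ''b'' (V ''v''), half_insert,
     assign ''a'' (V ''v''), assign ''b'' (V ''u''), half_insert,
     incr ''m'', finish]"

definition on_delete :: com where
  "on_delete = seq
    [clear,
     assign ''a'' (V ''u''), assign ''b'' (V ''v''), half_delete,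
     assign ''a'' (V ''v''), assign ''b'' (V ''u''), half_delete,
     assign ''m'' (Minus (V ''m'') (N 1)), finish]"

definition initialise :: com where
  "initialise = seq
    [assign ''D'' (N 1), assign ''k'' (N 1), assign ''i'' (N 0),
     while (Lt (V ''i'') (V ''n'')) (seq [store (N 0) (V ''i'') (N 1), incr ''i''])]"

definition algorithm :: dynamic_algorithm where
  "algorithm = \<lparr>init = initialise, ins = on_insert, del = on_delete\<rparr>"

definition neighbours :: "edges \<Rightarrow> nat \<Rightarrow> nat set" where
  "neighbours E v = {y. {v, y} \<in> E}"

context ram
begin

section \<open>Simple graphs given by their edges\<close>

definition simple :: "edges \<Rightarrow> bool" where
  "simple E \<longleftrightarrow> (\<forall>e\<in>E. \<exists>a b. a < n \<and> b < n \<and> a \<noteq> b \<and> e = {a, b})"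

lemma simple_edge: "simple E \<Longrightarrow> {a, b} \<in> E \<Longrightarrow> a < n \<and> b < n \<and> a \<noteq> b"
  unfolding simple_def by (metis doubleton_eq_iff)

lemma graph_neighbours: "simple E \<Longrightarrow> graph (neighbours E)"
  using simple_edge[of E] simple_edge[of E a a for a]
  unfolding graph_def neighbours_def by (auto simp: insert_commute)

lemma simple_card:
  assumes "simple E"
  shows "finite E" "card E \<le> n * n" "card {(a, b). b \<in> neighbours E a} \<le> 2 * card E"
proof -
  have sub: "E \<subseteq> (\<lambda>(a, b). {a, b}) ` ({..<n} \<times> {..<n})"
    using assms unfolding simple_def by fastforce
  then show fin: "finite E" by (rule finite_subset) simp
  have "card E \<le> card ((\<lambda>(a, b). {a, b}) ` ({..<n} \<times> {..<n}))"
    using sub by (rule card_mono[rotated]) simp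
  also have "\<dots> \<le> card ({..<n} \<times> {..<n})" by (rule card_image_le) simp
  finally show "card E \<le> n * n" by simp
  have "{(a, b). b \<in> neighbours E a} = (\<Union>e\<in>E. {(a, b). {a, b} = e})"
    by (auto simp: neighbours_def)
  then have "card {(a, b). b \<in> neighbours E a} \<le> (\<Sum>e\<in>E. card {(a, b). {a, b} = e})"
    using card_UN_le[OF fin] by simp
  also have "\<dots> \<le> (\<Sum>e\<in>E. 2)"
  proof (rule sum_mono)
    fix e assume "e \<in> E"
    then obtain a b where e: "e = {a, b}" using assms unfolding simple_def by blast
    have "{(x, y). {x, y} = e} \<subseteq> {(a, b), (b, a)}" unfolding e by (auto simp: doubleton_eq_iff)
    then have "card {(x, y). {x, y} = e} \<le> card {(a, b), (b, a)}" by (rule card_mono[rotated]) simp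
    also have "\<dots> \<le> 2" by (cases "a = b") simp_all
    finally show "card {(x, y). {x, y} = e} \<le> 2" .
  qed
  finally show "card {(a, b). b \<in> neighbours E a} \<le> 2 * card E" by simp
qed

lemma simple_apply_update:
  "simple E \<Longrightarrow> admissible n E x \<Longrightarrow> simple (apply_update x E)"
  by (cases x) (auto simp: simple_def)

text \<open>Forgets the heavy choices: S contains no heavy vertex, so erasing their marks leaves
  exactly S. With at most 25 * D heavy vertices at 100 steps each, 2600 * D suffices.\<close>

lemma wp_clear_state:
  assumes i: "state_inv G m \<psi> \<rho> M" and uv: "\<rho> ''u'' = u" "\<rho> ''v'' = v"
    and m: "card {(a, b). b \<in> G a} \<le> 2 * m"
  shows "wp clear (\<lambda>t \<rho>' M'. \<exists>S K mc el D.
    keeps {''p'', ''q'', ''x'', ''h''} \<rho> \<rho>' \<and> D = threshold mc \<and> \<rho>' ''D'' = D \<and>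
    core G S M' \<and> no_excess G S D {} \<and> no_lack G S D {} \<and>
    heavy_list (heavies G D - {u, v}) M' \<and> \<rho>' ''h'' = card (heavies G D - {u, v}) \<and>
    touched_list K M' \<and> \<rho>' ''t'' = card K \<and> (\<forall>v. G v \<noteq> {} \<longrightarrow> v \<in> K) \<and>
    \<rho>' ''k'' + el = mc div 2 + 1 \<and> 0 < \<rho>' ''k'' \<and> card K \<le> 2 * mc + 2 * el \<and>
    m \<le> mc + el \<and> mc \<le> m + el \<and>
    t + potential D S + 8000 * D * el \<le> \<psi> + 2600 * D) \<rho> M"
proof -
  from i obtain S Y K mc el D where s: "graph G" "D = threshold mc" "\<rho> ''D'' = D"
     "adjacency G M" "counts G S M" "S \<subseteq> {..<n}" "Y \<subseteq> heavies G D"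
     "marks (S \<union> Y) M" "no_excess G S D {}" "no_lack G S D {}"
     "heavy_list (heavies G D) M" "\<rho> ''h'' = card (heavies G D)"
     "touched_list K M" "\<rho> ''t'' = card K" "\<forall>v. G v \<noteq> {} \<longrightarrow> v \<in> K"
     "\<rho> ''k'' + el = mc div 2 + 1" "0 < \<rho> ''k''"
     "card K \<le> 2 * mc + 2 * el" "m \<le> mc + el" "mc \<le> m + el"
     "\<psi> = potential D S + 8000 * D * el"
    unfolding state_inv_def by blast
  have D0: "0 < D" using s(2) threshold_pos by simp
  have "card (heavies G D) * D \<le> 2 * m" using card_arcs(3)[OF s(1), of D] m by linarith
  then have few: "card (heavies G D) \<le> 25 * D"
    unfolding s(2) by (rule heavy_few(2)) (use s(16,19) in linarith)
  have SH: "S \<inter> heavies G D = {}" using s(9) unfolding no_excess_def heavies_def by auto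
  show ?thesis
    apply (rule wp_mono[OF wp_clear[where \<rho> = \<rho>, OF s(11,12)]])
    apply (elim conjE)
    subgoal premises p for t \<rho>' M'
    proof -
      have a: "adjacency G M'" using s(4) by (rule adjacency_cong) (use p(3) in auto)
      have c: "counts G S M'" using s(5) p(3) by (simp add: counts_def)
      have mk: "marks S M'"
        using s(6,7,8) p(4) SH unfolding marks_def by auto
      have tl: "touched_list K M'" using s(13) p(3) by (simp add: touched_list_def)
      have r: "\<rho>' ''D'' = D" "\<rho>' ''t'' = card K" "\<rho>' ''k'' = \<rho> ''k''"
        using p(2) s(3,14) by (simp_all add: keeps_def)
      show ?thesis
        apply (rule exI[of _ S], rule exI[of _ K], rule exI[of _ mc], rule exI[of _ el], rule exI[of _ D])
        using p(1,2,5,6) a c mk tl r s(2,9,10,15-21) few D0 uv by (simp add: core_def)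
    qed
    done
qed

lemma heavies_cong:
  "(\<And>x. x \<notin> B \<Longrightarrow> G' x = G x) \<Longrightarrow> heavies G' D - B = heavies G D - B"
  unfolding heavies_def by auto

text \<open>An update changes neighbourhoods at its endpoints only; these become the
  exceptions.\<close>

lemma no_excess_cong:
  "no_excess G S D {} \<Longrightarrow> (\<And>x. x \<notin> B \<Longrightarrow> G' x = G x) \<Longrightarrow> no_excess G' S D B"
  unfolding no_excess_def by auto

lemma no_lack_cong:
  "no_lack G S D {} \<Longrightarrow> (\<And>x. x \<notin> B \<Longrightarrow> G' x = G x) \<Longrightarrow> no_lack G' S D B"
  unfolding no_lack_def by auto

lemma wp_on_insert:
  assumes i: "state_inv (neighbours E) (card E) \<psi> \<rho> M" and uv: "\<rho> ''u'' = u" "\<rho> ''v'' = v"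
    and E: "simple E" and ad: "admissible n E (Insert u v)"
  shows "wp on_insert (\<lambda>t \<rho>' M'. \<exists>\<psi>'.
    state_inv (neighbours (insert {u, v} E)) (card (insert {u, v} E)) \<psi>' \<rho>' M' \<and>
    t + \<psi>' \<le> \<psi> + 150000 * threshold (card (insert {u, v} E))) \<rho> M"
proof -
  let ?G = "neighbours E" and ?E = "insert {u, v} E"
  have a: "u < n" "v < n" "u \<noteq> v" "{u, v} \<notin> E" using ad by auto
  have E': "simple ?E" using simple_apply_update[OF E ad] by simp
  note sc = simple_card[OF E] and sc' = simple_card[OF E']
  have m': "card ?E = Suc (card E)" using sc(1) a(4) by simp
  have rn: "\<rho> ''n'' = n" "\<rho> ''m'' = card E" using i by (simp_all add: state_inv_def)
  note g = graph_neighbours[OF E] and g' = graph_neighbours[OF E']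
  let ?G1 = "?G(u := insert v (?G u))"
  have G': "neighbours ?E = ?G1(v := insert u (?G1 v))"
    using a(3) by (auto simp: neighbours_def doubleton_eq_iff fun_eq_iff)
  have same: "neighbours ?E x = ?G x" if "x \<notin> {u, v}" for x
    using that unfolding G' by simp
  have hc: "heavies (neighbours ?E) D - {u, v} = heavies ?G D - {u, v}" for D
    by (rule heavies_cong) (rule same)
  have grow: "card (neighbours ?E x) \<le> Suc (card (?G x))" for x
    using graphD(4)[OF g] a(3) unfolding G' by (auto simp: card_insert_if)
  have sub1: "?G u \<subseteq> {..<n} - {u}" using graphD(1,2)[OF g] by blast
  have sub2: "?G1 v \<subseteq> {..<n} - {v}" using graphD(1,2)[OF g] a(3) by auto
  have n1: "v \<notin> ?G u" "u \<notin> ?G1 v" using a(3,4) by (auto simp: neighbours_def insert_commute)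
  have mw: "card E + 1 < 2 ^ w"
  proof -
    have "card E + 1 < (n + 2) ^ 2" using sc(2) by (simp add: power2_eq_square)
    also have "\<dots> < (n + 2) ^ 10" by (rule power_strict_increasing) auto
    finally show ?thesis by (rule word_bound)
  qed
  show ?thesis
    unfolding on_insert_def
    apply (rule wp_seq_Cons, rule wp_mono[OF wp_clear_state[OF i uv sc(3)]])
    apply (elim exE conjE)
    subgoal premises p for t \<rho>1 M1 S K mc el D
    proof -
      have r: "\<rho>1 ''u'' = u" "\<rho>1 ''v'' = v" "\<rho>1 ''n'' = n" "\<rho>1 ''m'' = card E"
        using p(1) uv rn by (simp_all add: keeps_def)
      have D0: "0 < D" using p(2) threshold_pos by simp
      have "D \<le> 3 * threshold (card ?E)" unfolding p(2)
        by (rule threshold_triple) (use p(12,13,16) m' in linarith)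
      \<comment> \<open>50000 * D covers \<open>clear\<close>, the two list updates and
        \<open>finish\<close>; the factor 3 leads from the threshold of the phase to that of the
        current graph.\<close>
      then have budget: "50000 * D \<le> 150000 * threshold (card ?E)" by simp
      let ?\<rho>1 = "\<rho>1(''a'' := u, ''b'' := v)"
      have h1: "wp half_insert (\<lambda>t \<rho>' M'. t \<le> 200 \<and> keeps {''t''} ?\<rho>1 \<rho>' \<and> M' 0 = M1 0 \<and> M' 5 = M1 5 \<and>
        core ?G1 S M' \<and> touched_list (insert u K) M' \<and> \<rho>' ''t'' = card (insert u K)) ?\<rho>1 M1"
        by (rule wp_half_insert[OF sub1 p(4) _ _ _ a(1,2) n1(1) p(9)]) (simp_all add: r p(10))
      show ?thesis
        apply (rule wp_seq_Cons, rule wp_assign, simp, simp, simp only: aval.simps r)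
        apply (rule wp_seq_Cons, rule wp_assign, simp, simp)
        apply (subgoal_tac "aval (V ''v'') (\<rho>1(''a'' := u)) M1 = v")
         prefer 2
         apply (simp add: r)
        apply (simp only:, thin_tac "_ = _")
        apply (rule wp_seq_Cons, rule wp_mono[OF h1])
        apply (elim conjE)
        subgoal premises q for t2 \<rho>2 M2
        proof -
          have r2: "\<rho>2 ''u'' = u" "\<rho>2 ''v'' = v" "\<rho>2 ''n'' = n" "\<rho>2 ''m'' = card E"
            "\<rho>2 ''D'' = D" "\<rho>2 ''h'' = card (heavies ?G D - {u, v})" "\<rho>2 ''k'' = \<rho>1 ''k''"
            using q(2) r p(3,8) by (simp_all add: keeps_def)
          let ?\<rho>2 = "\<rho>2(''a'' := v, ''b'' := u)" and ?K = "insert v (insert u K)"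
          have h2: "wp half_insert (\<lambda>t \<rho>' M'. t \<le> 200 \<and> keeps {''t''} ?\<rho>2 \<rho>' \<and> M' 0 = M2 0 \<and> M' 5 = M2 5 \<and>
            core (neighbours ?E) S M' \<and> touched_list ?K M' \<and> \<rho>' ''t'' = card ?K) ?\<rho>2 M2"
            unfolding G'
            by (rule wp_half_insert[OF sub2 q(5) _ _ _ a(2,1) n1(2) q(6)]) (simp_all add: r2 q(7))
          show ?thesis
            apply (rule wp_seq_Cons, rule wp_assign, simp, simp, simp only: aval.simps r2)
            apply (rule wp_seq_Cons, rule wp_assign, simp, simp)
            apply (subgoal_tac "aval (V ''u'') (\<rho>2(''a'' := v)) M2 = u")
             prefer 2
             apply (simp add: r2)
            apply (simp only:, thin_tac "_ = _")
            apply (rule wp_seq_Cons, rule wp_mono[OF h2])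
            apply (elim conjE)
            subgoal premises s for t3 \<rho>3 M3
            proof -
              have r3: "\<rho>3 ''u'' = u" "\<rho>3 ''v'' = v" "\<rho>3 ''n'' = n" "\<rho>3 ''m'' = card E"
                "\<rho>3 ''D'' = D" "\<rho>3 ''h'' = card (heavies ?G D - {u, v})" "\<rho>3 ''k'' = \<rho>1 ''k''"
                using s(2) r2 by (simp_all add: keeps_def)
              let ?\<rho>3 = "\<rho>3(''m'' := \<rho>3 ''m'' + 1)"
              have hl: "heavy_list (heavies (neighbours ?E) D - {u, v}) M3"
                using p(7) s(4) q(4) hc by (simp add: heavy_list_def)
              have ne: "no_excess (neighbours ?E) S D {u, v}" by (rule no_excess_cong[OF p(5)]) (rule same)
              have nl: "no_lack (neighbours ?E) S D {u, v}" by (rule no_lack_cong[OF p(6)]) (rule same)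
              \<comment> \<open>At most D and no longer below D: an endpoint in S may just have
                become heavy.\<close>
              have small: "card (neighbours ?E x) \<le> D" if "x \<in> S" for x
                using p(5) that grow[of x] unfolding no_excess_def by fastforce
              have cK: "card ?K \<le> card K + 2"
                using card_insert_le_m1[of "card K + 1" K u] card_insert_le_m1[of "card K + 2" "insert u K" v] by simp
              have nonempty: "x \<in> ?K" if "neighbours ?E x \<noteq> {}" for x
                using that same[of x] p(11) by auto
              have fin: "wp finish (\<lambda>t \<rho>' M'. \<exists>\<psi>. state_inv (neighbours ?E) (card ?E) \<psi> \<rho>' M' \<and>
                t + \<psi> \<le> potential D S + 8000 * D * el + 30000 * D) ?\<rho>3 M3"
                apply (rule wp_finish[OF g' s(5) _ _ a(1,2,3) _ _ _ p(2) sc'(3,2)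
                      ne nl small hl _ s(6)])
                using r3 m' s(7) nonempty cK p(12-16) hc by simp_all
              show ?thesis
                apply (rule wp_seq_Cons, rule wp_incr, simp, simp add: r3 mw[simplified])
                apply (rule wp_seq_Cons, rule wp_mono[OF fin])
                apply (elim exE conjE)
                subgoal for t4 \<rho>4 M4 \<psi>'
                  apply (rule wp_seq_Nil)
                  apply (rule exI[of _ \<psi>'])
                  using p(17) q(1) s(1) D0 budget by simp
                done
            qed
            done
        qed
        done
    qed
    done
qed

text \<open>The touched list does not change here: an endpoint that becomes isolated remains in it
  until the next rebuild.\<close>

lemma wp_on_delete:
  assumes i: "state_inv (neighbours E) (card E) \<psi> \<rho> M" and uv: "\<rho> ''u'' = u" "\<rho> ''v'' = v"
    and E: "simple E" and ad: "admissible n E (Delete u v)"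
  shows "wp on_delete (\<lambda>t \<rho>' M'. \<exists>\<psi>'.
    state_inv (neighbours (E - {{u, v}})) (card (E - {{u, v}})) \<psi>' \<rho>' M' \<and>
    t + \<psi>' \<le> \<psi> + 150000 * threshold (card (E - {{u, v}}))) \<rho> M"
proof -
  let ?G = "neighbours E" and ?E = "E - {{u, v}}"
  have uvE: "{u, v} \<in> E" using ad by simp
  have a: "u < n" "v < n" "u \<noteq> v" using simple_edge[OF E uvE] by auto
  have E': "simple ?E" using simple_apply_update[OF E ad] by simp
  note sc = simple_card[OF E] and sc' = simple_card[OF E']
  have m': "card E = Suc (card ?E)" using card_Suc_Diff1[OF sc(1) uvE] by simp
  have rn: "\<rho> ''n'' = n" "\<rho> ''m'' = card E" using i by (simp_all add: state_inv_def)
  note g = graph_neighbours[OF E] and g' = graph_neighbours[OF E']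
  let ?G1 = "?G(u := ?G u - {v})"
  have G': "neighbours ?E = ?G1(v := ?G1 v - {u})"
    using a(3) by (auto simp: neighbours_def doubleton_eq_iff fun_eq_iff)
  have same: "neighbours ?E x = ?G x" if "x \<notin> {u, v}" for x
    using that unfolding G' by simp
  have hc: "heavies (neighbours ?E) D - {u, v} = heavies ?G D - {u, v}" for D
    by (rule heavies_cong) (rule same)
  have sub: "neighbours ?E x \<subseteq> ?G x" for x by (auto simp: neighbours_def)
  have shrink: "card (neighbours ?E x) \<le> card (?G x)" for x
    using sub by (rule card_mono[OF graphD(4)[OF g]])
  have n1: "v \<in> ?G u" "u \<in> ?G1 v" using a(3) uvE by (auto simp: neighbours_def insert_commute)
  have mw: "card E < 2 ^ w" "Suc 0 \<le> card E"
  proof -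
    have "card E < (n + 2) ^ 2" using sc(2) by (simp add: power2_eq_square)
    also have "\<dots> < (n + 2) ^ 10" by (rule power_strict_increasing) auto
    finally show "card E < 2 ^ w" by (rule word_bound)
    show "Suc 0 \<le> card E" using m' by simp
  qed
  show ?thesis
    unfolding on_delete_def
    apply (rule wp_seq_Cons, rule wp_mono[OF wp_clear_state[OF i uv sc(3)]])
    apply (elim exE conjE)
    subgoal premises p for t \<rho>1 M1 S K mc el D
    proof -
      have r: "\<rho>1 ''u'' = u" "\<rho>1 ''v'' = v" "\<rho>1 ''n'' = n" "\<rho>1 ''m'' = card E"
        using p(1) uv rn by (simp_all add: keeps_def)
      have D0: "0 < D" using p(2) threshold_pos by simp
      have "D \<le> 3 * threshold (card ?E)" unfolding p(2)
        by (rule threshold_triple) (use p(12,13,16) m' in linarith)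
      then have budget: "50000 * D \<le> 150000 * threshold (card ?E)" by simp
      let ?\<rho>1 = "\<rho>1(''a'' := u, ''b'' := v)"
      have h1: "wp half_delete (\<lambda>t \<rho>' M'. t \<le> 200 \<and> keeps {''d'', ''p'', ''y''} ?\<rho>1 \<rho>' \<and>
        M' 0 = M1 0 \<and> M' 3 = M1 3 \<and> M' 4 = M1 4 \<and> M' 5 = M1 5 \<and> core ?G1 S M') ?\<rho>1 M1"
        by (rule wp_half_delete[OF p(4) _ _ _ a(1,2) n1(1)]) (simp_all add: r)
      show ?thesis
        apply (rule wp_seq_Cons, rule wp_assign, simp, simp, simp only: aval.simps r)
        apply (rule wp_seq_Cons, rule wp_assign, simp, simp)
        apply (subgoal_tac "aval (V ''v'') (\<rho>1(''a'' := u)) M1 = v")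
         prefer 2
         apply (simp add: r)
        apply (simp only:, thin_tac "_ = _")
        apply (rule wp_seq_Cons, rule wp_mono[OF h1])
        apply (elim conjE)
        subgoal premises q for t2 \<rho>2 M2
        proof -
          have r2: "\<rho>2 ''u'' = u" "\<rho>2 ''v'' = v" "\<rho>2 ''n'' = n" "\<rho>2 ''m'' = card E" "\<rho>2 ''t'' = card K"
            "\<rho>2 ''D'' = D" "\<rho>2 ''h'' = card (heavies ?G D - {u, v})" "\<rho>2 ''k'' = \<rho>1 ''k''"
            using q(2) r p(3,8,10) by (simp_all add: keeps_def)
          let ?\<rho>2 = "\<rho>2(''a'' := v, ''b'' := u)"
          have h2: "wp half_delete (\<lambda>t \<rho>' M'. t \<le> 200 \<and> keeps {''d'', ''p'', ''y''} ?\<rho>2 \<rho>' \<and>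
            M' 0 = M2 0 \<and> M' 3 = M2 3 \<and> M' 4 = M2 4 \<and> M' 5 = M2 5 \<and> core (neighbours ?E) S M') ?\<rho>2 M2"
            unfolding G'
            by (rule wp_half_delete[OF q(7) _ _ _ a(2,1) n1(2)]) (simp_all add: r2)
          show ?thesis
            apply (rule wp_seq_Cons, rule wp_assign, simp, simp, simp only: aval.simps r2)
            apply (rule wp_seq_Cons, rule wp_assign, simp, simp)
            apply (subgoal_tac "aval (V ''u'') (\<rho>2(''a'' := v)) M2 = u")
             prefer 2
             apply (simp add: r2)
            apply (simp only:, thin_tac "_ = _")
            apply (rule wp_seq_Cons, rule wp_mono[OF h2])
            apply (elim conjE)
            subgoal premises s for t3 \<rho>3 M3
            proof -
              have r3: "\<rho>3 ''u'' = u" "\<rho>3 ''v'' = v" "\<rho>3 ''n'' = n" "\<rho>3 ''m'' = card E" "\<rho>3 ''t'' = card K"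
                "\<rho>3 ''D'' = D" "\<rho>3 ''h'' = card (heavies ?G D - {u, v})" "\<rho>3 ''k'' = \<rho>1 ''k''"
                using s(2) r2 by (simp_all add: keeps_def)
              let ?\<rho>3 = "\<rho>3(''m'' := \<rho>3 ''m'' - 1)"
              have hl: "heavy_list (heavies (neighbours ?E) D - {u, v}) M3"
                using p(7) s(6) q(6) hc by (simp add: heavy_list_def)
              have tl: "touched_list K M3" using p(9) q(4,5) s(4,5) by (simp add: touched_list_def)
              have ne: "no_excess (neighbours ?E) S D {u, v}" by (rule no_excess_cong[OF p(5)]) (rule same)
              have nl: "no_lack (neighbours ?E) S D {u, v}" by (rule no_lack_cong[OF p(6)]) (rule same)
              have small: "card (neighbours ?E x) \<le> D" if "x \<in> S" for x
                using p(5) that shrink[of x] unfolding no_excess_def by fastforce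
              have nonempty: "x \<in> K" if "neighbours ?E x \<noteq> {}" for x
                using that sub[of x] p(11) by auto
              have fin: "wp finish (\<lambda>t \<rho>' M'. \<exists>\<psi>. state_inv (neighbours ?E) (card ?E) \<psi> \<rho>' M' \<and>
                t + \<psi> \<le> potential D S + 8000 * D * el + 30000 * D) ?\<rho>3 M3"
                apply (rule wp_finish[OF g' s(7) _ _ a(1,2,3) _ _ _ p(2) sc'(3,2)
                      ne nl small hl _ tl])
                using r3 m' nonempty p(12-16) hc by simp_all
              show ?thesis
                apply (rule wp_seq_Cons, rule wp_assign, simp, simp add: r3 mw, simp only: aval.simps)
                apply (rule wp_seq_Cons, rule wp_mono[OF fin])
                apply (elim exE conjE)
                subgoal for t4 \<rho>4 M4 \<psi>'
                  apply (rule wp_seq_Nil)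
                  apply (rule exI[of _ \<psi>'])
                  using p(17) q(1) s(1) D0 budget by simp
                done
            qed
            done
        qed
        done
    qed
    done
qed

lemma threshold_0: "threshold 0 = 1"
  using threshold_le[of 1 0] threshold_pos[of 0] by simp

text \<open>In the empty graph S is the whole vertex set, so the potential is 0. The other rows rely
  on memory being zero at the start. The first phase has mc = 0 and lasts a single update, whence
  \<open>k\<close> = 1.\<close>

lemma wp_initialise:
  "wp initialise (\<lambda>t \<rho>' M'. t \<le> 20 * n + 20 \<and> state_inv (neighbours {}) 0 0 \<rho>' M')
    ((\<lambda>_. 0)(''n'' := n)) (\<lambda>_ _. 0)"
proof -
  let ?\<rho> = "((\<lambda>_. 0)(''n'' := n))(''D'' := 1, ''k'' := 1)"
  define I where "I j \<tau> \<rho>' M' \<longleftrightarrow> \<tau> \<le> 20 * j \<and> \<rho>' = ?\<rho>(''i'' := j) \<and>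
    M' = (\<lambda>_ _. 0)(0 := \<lambda>v. if v < j then 1 else 0)" for j \<tau> :: nat and \<rho>' and M' :: rows
  have nb: "neighbours {} = (\<lambda>_. {})" by (simp add: neighbours_def fun_eq_iff)
  have "wp (while (Lt (V ''i'') (V ''n'')) (seq [store (N 0) (V ''i'') (N 1), incr ''i'']))
    (\<lambda>t \<rho>' M'. t \<le> 20 * n + 5 \<and> state_inv (neighbours {}) 0 0 \<rho>' M') (?\<rho>(''i'' := 0)) (\<lambda>_ _. 0)"
  proof (rule wp_while[where I = I and l = n], goal_cases)
    case (1 j \<tau> \<rho>' M')
    then have j: "\<tau> \<le> 20 * j" "\<rho>' = ?\<rho>(''i'' := j)"
      "M' = (\<lambda>_ _. 0)(0 := \<lambda>v. if v < j then 1 else 0)" "j < n" "Suc j < 2 ^ w"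
      using word_linear by (simp_all add: I_def)
    show ?case
      unfolding j(2,3)
      apply (intro conjI)
        apply (simp_all add: j(4))[2]
      apply ((rule wp_intros wp_incr; (simp add: j)?)+)
      using j(1) by (auto simp: I_def fun_eq_iff)
  next
    case (2 \<tau> \<rho>' M')
    then have j: "\<tau> \<le> 20 * n" "\<rho>' = ?\<rho>(''i'' := n)"
      "M' = (\<lambda>_ _. 0)(0 := \<lambda>v. if v < n then 1 else 0)" by (simp_all add: I_def)
    have "state_inv (neighbours {}) 0 0 \<rho>' M'"
      unfolding nb state_inv_def j(2,3)
      apply (intro conjI)
         apply (simp add: graph_def)
        apply simp
       apply simp
      apply (rule exI[of _ "{..<n}"], rule exI[of _ "{}"], rule exI[of _ "{}"], rule exI[of _ 0],
          rule exI[of _ 0], rule exI[of _ 1])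
      by (simp add: threshold_0 adjacency_def counts_def marks_def mis_def no_excess_def no_lack_def
          heavy_list_def heavies_def touched_list_def potential_def bij_betw_def)
    then show ?case using j(1) by (simp add: j(2))
  next
    case 3
    show ?case by (simp add: I_def fun_eq_iff)
  qed
  from wp_mono[OF this] show ?thesis
    unfolding initialise_def
    apply -
    apply ((rule wp_seq_Cons, rule wp_assign, simp, simp, simp only: aval.simps)+)
    apply (rule wp_seq_Cons)
    apply (rule wp_mono, assumption)
    apply (rule wp_seq_Nil)
    apply simp
    done
qed

lemma state_inv_pass_edge:
  "state_inv G m \<psi> (\<rho>(''u'' := a, ''v'' := b)) M \<longleftrightarrow> state_inv G m \<psi> \<rho> M"
  by (simp add: state_inv_def)

section \<open>From one update to a sequence\<close>

definition good :: "edges \<Rightarrow> nat \<Rightarrow> state \<Rightarrow> bool" where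
  "good E \<psi> s \<longleftrightarrow> simple E \<and> (\<exists>\<rho> M. represents \<rho> M s \<and> state_inv (neighbours E) (card E) \<psi> \<rho> M)"

lemma exec_handler:
  assumes "good E \<psi> s" "admissible n E x"
  obtains t s' \<psi>' where "exec w (handler algorithm x) (pass_input x s) t s'"
    "good (apply_update x E) \<psi>' s'" "t + \<psi>' \<le> \<psi> + 150000 * threshold (card (apply_update x E))"
proof -
  from assms(1) obtain \<rho> M where E: "simple E" and r: "represents \<rho> M s"
    and i: "state_inv (neighbours E) (card E) \<psi> \<rho> M" unfolding good_def by blast
  have E': "simple (apply_update x E)" using simple_apply_update[OF E assms(2)] .
  define u v where "u = (case x of Insert u v \<Rightarrow> u | Delete u v \<Rightarrow> u)"
    and "v = (case x of Insert u v \<Rightarrow> v | Delete u v \<Rightarrow> v)"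
  let ?\<rho> = "\<rho>(''u'' := u, ''v'' := v)"
  have r': "represents ?\<rho> M (pass_input x s)"
    using r by (cases x) (auto simp: represents_def pass_edge_def u_def v_def)
  have i': "state_inv (neighbours E) (card E) \<psi> ?\<rho> M" using i by (simp only: state_inv_pass_edge)
  have "wp (handler algorithm x) (\<lambda>t \<rho>' M'. \<exists>\<psi>'.
    state_inv (neighbours (apply_update x E)) (card (apply_update x E)) \<psi>' \<rho>' M' \<and>
    t + \<psi>' \<le> \<psi> + 150000 * threshold (card (apply_update x E))) ?\<rho> M"
  proof (cases x)
    case (Insert a b)
    then show ?thesis using wp_on_insert[OF i' _ _ E, of a b] assms(2)
      by (simp add: algorithm_def u_def v_def)
  next
    case (Delete a b)
    then show ?thesis using wp_on_delete[OF i' _ _ E, of a b] assms(2)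
      by (simp add: algorithm_def u_def v_def)
  qed
  with r' E' that show thesis unfolding wp_def good_def by blast
qed

text \<open>The potentials telescope, and every summand refers to the graph right after its update,
  as in \<open>amortized_budget\<close>.\<close>

lemma run_algorithm:
  assumes "good E \<psi> s" "valid_from n E xs"
  shows "\<exists>T s' \<psi>'. run w algorithm s xs T s' \<and> good (fold apply_update xs E) \<psi>' s' \<and>
    T + \<psi>' \<le> \<psi> + (\<Sum>i<length xs. 150000 * threshold (card (fold apply_update (take (Suc i) xs) E)))"
  using assms
proof (induction xs arbitrary: E \<psi> s)
  case Nil
  then have "run w algorithm s [] 0 s \<and> good (fold apply_update [] E) \<psi> s \<and> 0 + \<psi> \<le> \<psi> + 0"
    by (simp add: run.Nil)
  then show ?case by (metis list.size(3) lessThan_0 sum.empty)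
next
  case (Cons x xs)
  then have ad: "admissible n E x" "valid_from n (apply_update x E) xs" by simp_all
  obtain t s1 \<psi>1 where 1: "exec w (handler algorithm x) (pass_input x s) t s1"
    "good (apply_update x E) \<psi>1 s1" "t + \<psi>1 \<le> \<psi> + 150000 * threshold (card (apply_update x E))"
    using exec_handler[OF Cons.prems(1) ad(1)] by blast
  obtain T s2 \<psi>2 where 2: "run w algorithm s1 xs T s2" "good (fold apply_update xs (apply_update x E)) \<psi>2 s2"
    "T + \<psi>2 \<le> \<psi>1 + (\<Sum>i<length xs. 150000 * threshold (card (fold apply_update (take (Suc i) xs) (apply_update x E))))"
    using Cons.IH[OF 1(2) ad(2)] by blast
  have "run w algorithm s (x # xs) (t + T) s2" using 1(1) 2(1) by (rule run.Cons)
  moreover have "t + T + \<psi>2 \<le> \<psi> + (\<Sum>i<length (x # xs). 150000 * threshold (card (fold apply_update (take (Suc i) (x # xs)) E)))"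
    using 1(3) 2(3) by (simp only: length_Cons sum.lessThan_Suc_shift) simp
  ultimately show ?case using 2(2) by auto
qed

lemma good_maximal:
  assumes "good E \<psi> s"
  shows "maximal_independent n E (held_set n s)"
proof -
  from assms obtain \<rho> M where E: "simple E" and r: "represents \<rho> M s"
    and i: "state_inv (neighbours E) (card E) \<psi> \<rho> M" unfolding good_def by blast
  from i obtain I where I: "marks I M" "mis (neighbours E) I" unfolding state_inv_def by blast
  \<comment> \<open>Row 0 begins at address 0, so it is the output vector itself.\<close>
  have "mem s v = M 0 v" if "v < n" for v
    using r that unfolding represents_def by (metis add_0 mult_zero_left)
  then have "mem s v \<noteq> 0 \<longleftrightarrow> v \<in> I" if "v < n" for v
    using I(1) that unfolding marks_def by simp
  then have h: "held_set n s = I" using I(1) unfolding held_set_def marks_def by blast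
  have In: "I \<subseteq> {..<n}" using I(1) by (simp add: marks_def)
  have "independent n E I"
    using I(2) In unfolding independent_def mis_def neighbours_def by blast
  moreover have False if J: "independent n E J" "I \<subset> J" for J
  proof -
    obtain x where x: "x \<in> J" "x \<notin> I" using J(2) by blast
    then have "x < n" using J(1) by (auto simp: independent_def)
    then obtain y where "y \<in> I" "{x, y} \<in> E" using I(2) x(2) unfolding mis_def neighbours_def by blast
    then show False using J x(1) unfolding independent_def by blast
  qed
  ultimately show ?thesis unfolding maximal_independent_def h by blast
qed

end

section \<open>Word length and asymptotics\<close>

lemma word_length_ram: "ram n (word_length 10 n)"
proof
  define k where "k = nat \<lceil>log 2 (real n + 2)\<rceil>"
  have "log 2 (real n + 2) \<le> real k" unfolding k_def by linarith
  then have "real n + 2 \<le> 2 powr real k" by (simp add: log_le_iff)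
  then have "real (n + 2) \<le> real (2 ^ k)" by (simp add: powr_realpow)
  then have "n + 2 \<le> 2 ^ k" by (simp only: of_nat_le_iff)
  then have "(n + 2) ^ 10 \<le> (2 ^ k) ^ 10" by (rule power_mono) simp
  then show "(n + 2) ^ 10 \<le> 2 ^ word_length 10 n"
    unfolding word_length_def k_def[symmetric] by (simp add: power_mult mult.commute)
qed

text \<open>The ceiling of m^(2/3) is a candidate in the definition of the threshold; rounding costs
  at most a factor 2 because m^(2/3) >= 1.\<close>

lemma threshold_le_powr:
  assumes "1 \<le> m"
  shows "real (threshold m) \<le> 2 * real m powr (2 / 3)"
proof -
  let ?p = "real m powr (2 / 3)"
  define d where "d = nat \<lceil>?p\<rceil>"
  have p: "1 \<le> ?p" using assms by (intro ge_one_powr_ge_zero) auto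
  have d: "?p \<le> real d" "real d \<le> ?p + 1" unfolding d_def using p by linarith+
  have "?p ^ 3 = ?p powr real 3" using p by (intro powr_realpow[symmetric]) linarith
  also have "\<dots> = real m powr 2" by (simp add: powr_powr)
  also have "\<dots> = (real m)\<^sup>2" by simp
  finally have "?p ^ 3 = (real m)\<^sup>2" .
  moreover have "?p ^ 3 \<le> real d ^ 3" using d(1) by (rule power_mono) simp
  ultimately have "real (m * m) \<le> real (d * d * d)" by (simp add: power2_eq_square power3_eq_cube)
  then have "m * m \<le> d * d * d" by (simp only: of_nat_le_iff)
  moreover have "0 < d" using d(1) p by linarith
  ultimately have "threshold m \<le> d" by (intro threshold_le)
  then show ?thesis using d(2) p by linarith
qed

text \<open>The threshold is of order m^(2/3), and \<open>sqrt (ln m)\<close> is at least 1 from m =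
  3 on, as e <= 3.\<close>

lemma threshold_bigo:
  "(\<lambda>m. real (150000 * threshold m)) \<in> O(\<lambda>m. real m powr (2 / 3) * sqrt (ln (real m)))"
proof (rule bigoI[of _ 300000], rule eventually_sequentiallyI[of 3])
  fix m :: nat assume m: "3 \<le> m"
  have "exp 1 \<le> real m" using exp_le m by linarith
  then have "1 \<le> ln (real m)" using m by (subst ln_ge_iff) auto
  then have "1 \<le> sqrt (ln (real m))" by simp
  then have key: "real m powr (2 / 3) * 1 \<le> real m powr (2 / 3) * sqrt (ln (real m))"
    by (intro mult_left_mono) auto
  then have nn: "0 \<le> real m powr (2 / 3) * sqrt (ln (real m))" by (rule order_trans[rotated]) simp
  have "150000 * real (threshold m) \<le> 300000 * (real m powr (2 / 3) * sqrt (ln (real m)))"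
    using threshold_le_powr[of m] m key by linarith
  then show "norm (real (150000 * threshold m)) \<le>
      300000 * norm (real m powr (2 / 3) * sqrt (ln (real m)))"
    unfolding real_norm_def abs_of_nonneg[OF nn] by simp
qed

theorem theorem1:
  shows "\<exists>(A :: dynamic_algorithm) (g :: nat \<Rightarrow> real).
    g \<in> O(\<lambda>m. real m powr (2 / 3) * sqrt (ln (real m))) \<and> maintains_mis A g"
proof (intro exI conjI)
  let ?g = "\<lambda>m. real (150000 * threshold m)"
  show "?g \<in> O(\<lambda>m. real m powr (2 / 3) * sqrt (ln (real m)))" by (rule threshold_bigo)
  show "maintains_mis algorithm ?g"
    unfolding maintains_mis_def
  \<comment> \<open>10 is the exponent in the locale \<open>ram\<close>; 20 matches the time 20 n +
    20 of the initialisation.\<close>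
  proof (rule exI[of _ 10], rule exI[of _ 20], intro conjI allI)
    fix n
    let ?w = "word_length 10 n"
    interpret ram n ?w by (rule word_length_ram)
    have "represents ((\<lambda>_. 0)(''n'' := n)) (\<lambda>_ _. 0) (start n)"
      by (simp add: represents_def start_def)
    then obtain t s \<rho> M where 0: "exec ?w initialise (start n) t s" "represents \<rho> M s"
      "t \<le> 20 * n + 20" "state_inv (neighbours {}) 0 0 \<rho> M"
      using wp_initialise unfolding wp_def by blast
    have good: "good {} 0 s" using 0(2,4) unfolding good_def simple_def by auto
    show "\<exists>t\<^sub>0 s\<^sub>0. exec ?w (init algorithm) (start n) t\<^sub>0 s\<^sub>0 \<and> real t\<^sub>0 \<le> 20 * (real n + 1) \<and>
          (\<forall>xs. valid_updates n xs \<longrightarrow>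
             (\<exists>T s. run ?w algorithm s\<^sub>0 xs T s \<and>
                maximal_independent n (graph_after xs) (held_set n s) \<and>
                amortized_time T xs \<le> amortized_budget ?g xs))"
    proof (rule exI[of _ t], rule exI[of _ s], intro conjI allI impI)
      show "exec ?w (init algorithm) (start n) t s" using 0(1) by (simp add: algorithm_def)
      show "real t \<le> 20 * (real n + 1)" using 0(3) by simp
      fix xs assume "valid_updates n xs"
      from run_algorithm[OF good this] obtain T s' \<psi> where r: "run ?w algorithm s xs T s'"
        "good (graph_after xs) \<psi> s'"
        "T \<le> (\<Sum>i<length xs. 150000 * threshold (card (graph_after (take (Suc i) xs))))"
        unfolding graph_after_def by auto
      have "real T \<le> (\<Sum>i<length xs. ?g (card (graph_after (take (Suc i) xs))))"
        using r(3) unfolding of_nat_sum[symmetric] of_nat_le_iff .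
      then have "amortized_time T xs \<le> amortized_budget ?g xs"
        unfolding amortized_time_def amortized_budget_def by (rule divide_right_mono) simp
      then show "\<exists>T s'. run ?w algorithm s xs T s' \<and>
                maximal_independent n (graph_after xs) (held_set n s') \<and>
                amortized_time T xs \<le> amortized_budget ?g xs"
        using r(1) good_maximal[OF r(2)] by blast
    qed
  qed simp
qed

end
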